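(* Let $E=\{(s_n,\sigma_n)\}_{n\ge1}\subseteq\mathbb{R}^d\times\widehat{\mathbb{R}}^d$ be a separated sequence, and let $\Lambda\subseteq\widehat{\mathbb{R}}^d\times\mathbb{R}^d$ be an S-set of strict multiplicity that is compact, convex, and symmetric about $0$. Assume balayage is possible for $(E,\Lambda)$. Let $g\in L^2(\mathbb{R}^d)$, $\widehat g=G$, with $\|g\|_2=1$. Then there exist $A,B>0$ such that for all $f\in\mathcal{S}_0(\mathbb{R}^d)$ with $\operatorname{supp}(\widehat{V_gf})\subseteq\Lambda$, $$A\|f\|_2^2\le\sum_{n=1}^\infty|V_gf(s_n,\sigma_n)|^2\le B\|f\|_2^2.$$ Consequently, the frame operator $S_{g,E}$ is invertible in $L^2(\mathbb{R}^d)$-norm on the subspace of $\mathcal{S}_0(\mathbb{R}^d)$ consisting of those $f$ with $\operatorname{supp}(\widehat{V_gf})\subseteq\Lambda$, and every $f\in\mathcal{S}_0(\mathbb{R}^d)$ with $\operatorname{supp}(\widehat{V_gf})\subseteq\Lambda$ has the non-uniform Gabor expansion $$f=\sum_{n=1}^\infty\langle f,\tau_{s_n}e_{\sigma_n}g\rangle\,S_{g,E}^{-1}(\tau_{s_n}e_{\sigma_n}g),$$ where the series converges unconditionally in $L^2(\mathbb{R}^d)$.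
   Context: Fourier transform on $\mathbb{R}^m$: $\widehat f(\gamma)=\int f(x)e^{-2\pi i x\cdot\gamma}dx$; here $\mathbb{R}^d\times\widehat{\mathbb{R}}^d$ has dual group $\widehat{\mathbb{R}}^d\times\mathbb{R}^d$. $e_\sigma(t)=e^{2\pi i t\cdot\sigma}$, $\tau_sg(t)=g(t-s)$. STFT: $V_gf(x,\omega)=\int f(t)\overline{g(t-x)}e^{-2\pi i t\cdot\omega}dt$, a function on $\mathbb{R}^d\times\widehat{\mathbb{R}}^d$, and $\widehat{V_gf}$ is its Fourier transform on $\mathbb{R}^{2d}$. $g_0(x)=2^{d/4}e^{-\pi\|x\|^2}$; $\mathcal{S}_0(\mathbb{R}^d)=\{f\in L^2(\mathbb{R}^d):\|V_{g_0}f\|_{L^1(\mathbb{R}^{2d})}<\infty\}$. Frame operator: $S_{g,E}f=\sum_n\langle f,\tau_{s_n}e_{\sigma_n}g\rangle\tau_{s_n}e_{\sigma_n}g$. The notions below are taken on the group $\mathbb{R}^{2d}=\mathbb{R}^d\times\widehat{\mathbb{R}}^d$ with dual $\widehat{\mathbb{R}}^d\times\mathbb{R}^d$: $M_b(X)$ bounded complex Radon measures supported in closed $X$; $\mathcal{C}(\Lambda)$ bounded continuous functions on $\mathbb{R}^{2d}$ whose distributional Fourier transform is supported in $\Lambda$; balayage is possible for $(E,\Lambda)$ if for every $\mu\in M_b(\mathbb{R}^{2d})$ there is $\nu\in M_b(E)$ with $\widehat\mu=\widehat\nu$ on $\Lambda$; $\Lambda$ is an S-set if for all $f\in\mathcal{C}(\Lambda)$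 and $\mu\in M_b(\mathbb{R}^{2d})$ with $\widehat\mu=0$ on $\Lambda$, $\int f\,d\mu=0$; $\Lambda$ is of strict multiplicity if some $\mu\in M_b(\Lambda)\setminus\{0\}$ has inverse Fourier transform tending to $0$ at infinity; $E$ separated means pairwise distances of distinct points are bounded below by a positive constant.
   Formalization: For general g in L^2 the frame operator series need not converge in L^2 and S^{-1}(τ_s e_σ g) may be undefined; invertibility and the expansion are stated for the weak frame operator compressed to the L^2-closure of the subspace, with τ_s e_σ g projected onto it. *)

theory Defs
  imports "HOL-Analysis.Analysis"
begin

definition L2 :: "('a::euclidean_space \<Rightarrow> complex) \<Rightarrow> bool" where
  "L2 f \<longleftrightarrow> f \<in> borel_measurable lebesgue \<and> integrable lebesgue (\<lambda>x. (cmod (f x))^2)"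

definition L2norm :: "('a::euclidean_space \<Rightarrow> complex) \<Rightarrow> real" where
  "L2norm f = sqrt (\<integral>x. (cmod (f x))^2 \<partial>lebesgue)"

definition L2inner :: "('a::euclidean_space \<Rightarrow> complex) \<Rightarrow> ('a \<Rightarrow> complex) \<Rightarrow> complex" where
  "L2inner f h = (\<integral>x. f x * cnj (h x) \<partial>lebesgue)"

text \<open>Fourier transform: hat f(gamma) = int f(x) e^(-2 pi i x.gamma) dx.  On a product
  space the inner product is the duality pairing (x,w).(gamma,y) = x.gamma + w.y.\<close>
definition fourier :: "('a::euclidean_space \<Rightarrow> complex) \<Rightarrow> 'a \<Rightarrow> complex" where
  "fourier f \<gamma> = (\<integral>x. f x * cis (- 2 * pi * (x \<bullet> \<gamma>)) \<partial>lebesgue)"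

definition tsupport :: "('a::topological_space \<Rightarrow> complex) \<Rightarrow> 'a set" where
  "tsupport \<phi> = closure {x. \<phi> x \<noteq> 0}"

fun Ck :: "nat \<Rightarrow> ('a::euclidean_space \<Rightarrow> complex) \<Rightarrow> bool" where
  "Ck 0 f = continuous_on UNIV f"
| "Ck (Suc k) f = ((\<forall>x. f differentiable (at x)) \<and>
      (\<forall>b\<in>Basis. Ck k (\<lambda>x. frechet_derivative f (at x) b)))"

definition smooth_fun :: "('a::euclidean_space \<Rightarrow> complex) \<Rightarrow> bool" where
  "smooth_fun f \<longleftrightarrow> (\<forall>k. Ck k f)"

definition test_function :: "('a::euclidean_space \<Rightarrow> complex) \<Rightarrow> bool" where
  "test_function \<phi> \<longleftrightarrow> smooth_fun \<phi> \<and> compact (tsupport \<phi>)"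

text \<open>The distributional Fourier transform of F is supported in the closed set Lambda:
  <hat F, phi> = int F * hat phi = 0 for every test function phi whose support misses Lambda.\<close>
definition fourier_supp_in :: "('a::euclidean_space \<Rightarrow> complex) \<Rightarrow> 'a set \<Rightarrow> bool" where
  "fourier_supp_in F \<Lambda> \<longleftrightarrow>
     (\<forall>\<phi>. test_function \<phi> \<and> tsupport \<phi> \<inter> \<Lambda> = {} \<longrightarrow>
          (\<integral>z. F z * fourier \<phi> z \<partial>lebesgue) = 0)"

definition Cspec :: "'a::euclidean_space set \<Rightarrow> ('a \<Rightarrow> complex) set" where
  "Cspec \<Lambda> = {F. continuous_on UNIV F \<and> bounded (range F) \<and> fourier_supp_in F \<Lambda>}"

text \<open>A bounded complex Radon measure is represented as mu = sum_{k<4} i^k mu_k with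
  mu_0..mu_3 finite (hence Radon) positive Borel measures (components k >= 4 are ignored).\<close>
type_synonym 'a cmeasure = "nat \<Rightarrow> 'a measure"

definition Mb :: "'a::euclidean_space set \<Rightarrow> 'a cmeasure set" where
  "Mb X = {\<mu>. \<forall>k<4. sets (\<mu> k) = sets borel \<and> finite_measure (\<mu> k) \<and>
                     emeasure (\<mu> k) (UNIV - X) = 0}"

definition cm_integral :: "'a::euclidean_space cmeasure \<Rightarrow> ('a \<Rightarrow> complex) \<Rightarrow> complex" where
  "cm_integral \<mu> F = (\<Sum>k<4. \<i> ^ k * (\<integral>x. F x \<partial>(\<mu> k)))"

definition cm_value :: "'a::euclidean_space cmeasure \<Rightarrow> 'a set \<Rightarrow> complex" where
  "cm_value \<mu> A = (\<Sum>k<4. \<i> ^ k * complex_of_real (measure (\<mu> k) A))"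

definition cm_fourier :: "'a::euclidean_space cmeasure \<Rightarrow> 'a \<Rightarrow> complex" where
  "cm_fourier \<mu> \<gamma> = cm_integral \<mu> (\<lambda>x. cis (- 2 * pi * (x \<bullet> \<gamma>)))"

definition cm_ifourier :: "'a::euclidean_space cmeasure \<Rightarrow> 'a \<Rightarrow> complex" where
  "cm_ifourier \<mu> x = cm_integral \<mu> (\<lambda>\<gamma>. cis (2 * pi * (x \<bullet> \<gamma>)))"

definition cm_nonzero :: "'a::euclidean_space cmeasure \<Rightarrow> bool" where
  "cm_nonzero \<mu> \<longleftrightarrow> (\<exists>A\<in>sets borel. cm_value \<mu> A \<noteq> 0)"

definition balayage_possible :: "'a::euclidean_space set \<Rightarrow> 'a set \<Rightarrow> bool" where
  "balayage_possible E \<Lambda> \<longleftrightarrow>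
     (\<forall>\<mu>\<in>Mb UNIV. \<exists>\<nu>\<in>Mb E. \<forall>\<gamma>\<in>\<Lambda>. cm_fourier \<nu> \<gamma> = cm_fourier \<mu> \<gamma>)"

definition S_set :: "'a::euclidean_space set \<Rightarrow> bool" where
  "S_set \<Lambda> \<longleftrightarrow>
     (\<forall>F\<in>Cspec \<Lambda>. \<forall>\<mu>\<in>Mb UNIV. (\<forall>\<gamma>\<in>\<Lambda>. cm_fourier \<mu> \<gamma> = 0) \<longrightarrow> cm_integral \<mu> F = 0)"

definition strict_multiplicity :: "'a::euclidean_space set \<Rightarrow> bool" where
  "strict_multiplicity \<Lambda> \<longleftrightarrow>
     (\<exists>\<mu>\<in>Mb \<Lambda>. cm_nonzero \<mu> \<and> (cm_ifourier \<mu> \<longlongrightarrow> 0) at_infinity)"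

definition separated :: "(nat \<Rightarrow> 'a::metric_space) \<Rightarrow> bool" where
  "separated E \<longleftrightarrow> (\<exists>\<delta>>0. \<forall>m n. m \<noteq> n \<longrightarrow> \<delta> \<le> dist (E m) (E n))"

definition stft :: "(real^'n \<Rightarrow> complex) \<Rightarrow> (real^'n \<Rightarrow> complex) \<Rightarrow> ((real^'n) \<times> (real^'n)) \<Rightarrow> complex" where
  "stft g f z = (case z of (x, \<omega>) \<Rightarrow>
      \<integral>t. f t * cnj (g (t - x)) * cis (- 2 * pi * (t \<bullet> \<omega>)) \<partial>lebesgue)"

definition gauss0 :: "real^'n \<Rightarrow> complex" where
  "gauss0 x = complex_of_real (2 powr (real CARD('n) / 4) * exp (- pi * (norm x)^2))"

definition S0 :: "(real^'n \<Rightarrow> complex) set" where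
  "S0 = {f. L2 f \<and> integrable lebesgue (stft gauss0 f)}"

definition tf_shift :: "real^'n \<Rightarrow> real^'n \<Rightarrow> (real^'n \<Rightarrow> complex) \<Rightarrow> real^'n \<Rightarrow> complex" where
  "tf_shift s \<sigma> g t = cis (2 * pi * ((t - s) \<bullet> \<sigma>)) * g (t - s)"

definition L2_uncond_sum :: "(nat \<Rightarrow> 'a::euclidean_space \<Rightarrow> complex) \<Rightarrow> ('a \<Rightarrow> complex) \<Rightarrow> bool" where
  "L2_uncond_sum u f \<longleftrightarrow>
     (\<forall>\<epsilon>>0. \<exists>F0. finite F0 \<and> (\<forall>F. finite F \<and> F0 \<subseteq> F \<longrightarrow>
          L2norm (\<lambda>t. f t - (\<Sum>n\<in>F. u n t)) < \<epsilon>))"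

definition L2_closure :: "('a::euclidean_space \<Rightarrow> complex) set \<Rightarrow> ('a \<Rightarrow> complex) set" where
  "L2_closure V = {h. L2 h \<and> (\<forall>\<epsilon>>0. \<exists>f\<in>V. L2norm (\<lambda>t. h t - f t) < \<epsilon>)}"

text \<open>Weak form of the frame operator: frame_op_weak g E f u h says <S_{g,E} f, h> = <u, h>,
  i.e. the frame operator maps f to u (tested against h).\<close>
definition frame_op_weak :: "(real^'n \<Rightarrow> complex) \<Rightarrow> (nat \<Rightarrow> (real^'n) \<times> (real^'n))
     \<Rightarrow> (real^'n \<Rightarrow> complex) \<Rightarrow> (real^'n \<Rightarrow> complex) \<Rightarrow> (real^'n \<Rightarrow> complex) \<Rightarrow> bool" where
  "frame_op_weak g E f u h \<longleftrightarrow>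
     ((\<lambda>n. L2inner f (tf_shift (fst (E n)) (snd (E n)) g) *
           L2inner (tf_shift (fst (E n)) (snd (E n)) g) h) sums L2inner u h)"

end

theory Submission
  imports Defs "HOL-Probability.Probability"
begin

text \<open>
  The function $F = V_g f$ is continuous, bounded and square-integrable with
  $\|F\|_2 = \|f\|_2$, and its spectrum lies in $\Lambda$; so the frame inequality is a
  sampling inequality for such $F$, and the remaining claims follow by Hilbert space arguments.

  If $\Lambda$ has empty interior it lies in a hyperplane through $0$, the S-set property applied to
  $\delta_{z+v} - \delta_z$ shows that $F$ is constant along a line, and hence $F = 0$.
  Otherwise a gliding hump argument turns balayage into $\sup |F| \le K \sup_E |F|$ for bounded $F$
  with spectrum in $\Lambda$. This inequality survives a small dilation of $\Lambda$: for $f$ with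
  spectrum in $(1+\epsilon)\Lambda$ the average over $j < N$ of
  $f(y + r_j(x-y))\, h(\delta_j(x-y))$, with $h$ a band-limited cut-off, $h(0) = 1$, and
  $r_j = (1-\delta_j)/(1+\epsilon)$, has spectrum in $\Lambda$, and if the scales $\delta_j$ are sparse,
  then at each sample point all but one of the terms are nearly dominated by $|f|$ or nearly vanish.
  Applying the dilated inequality to $F(x)\, h(\epsilon(x-y))$ gives
  $|F(y)|^2 \le C \sum_n |F(x_n)|^2 |h(\epsilon(x_n-y))|^2$, and integration in $y$ yields the
  lower frame bound. The upper bound is the Plancherel-Polya inequality for separated sequences.
\<close>

section \<open>Square-integrable functions\<close>

text \<open>Balayage supplies a measure for each given one without any bound on its mass; the
  gliding hump plays the part of an open mapping theorem, and discrete measures suffice for it. The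
  factor \<open>h\<close> is what turns a supremum estimate into a square-summable one, but it
  enlarges the spectrum beyond \<Lambda>, where balayage is not assumed. This is the obstacle. The
  way back into \<Lambda> is to contract \<open>f\<close>, because (1 - delta) \<Lambda> + delta
  \<Lambda> lies in the convex set \<Lambda>. Contraction about y moves a sample at distance t by at
  most 2 delta t: harmless for small delta t, since band-limited functions are equicontinuous, while
  for large delta t the decay of \<open>h\<close> wins. In between nothing is gained, so a single
  scale cannot do; averaging over N scales divides the loss by N. All errors are small multiples of
  the finite number sup |f| and are absorbed on the left. The subspace is not known to be closed or
  invariant under the frame operator, so inversion takes place on its L2-closure, against test
  vectors from that closure.\<close>

lemma L2_measurable: "L2 f \<Longrightarrow> f \<in> borel_measurable lebesgue"
  by (simp add: L2_def)

lemma L2_integrable: "L2 f \<Longrightarrow> integrable lebesgue (\<lambda>x. (cmod (f x))^2)"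
  by (simp add: L2_def)

lemma norm_add_sq_le:
  fixes a b :: "'a::real_normed_vector"
  shows "norm (a + b) ^ 2 \<le> 2 * norm a ^ 2 + 2 * norm b ^ 2"
proof -
  have "norm (a + b) ^ 2 \<le> (norm a + norm b) ^ 2"
    by (intro power_mono norm_triangle_ineq) auto
  also have "\<dots> \<le> 2 * norm a ^ 2 + 2 * norm b ^ 2"
    using sum_squares_bound[of "norm a" "norm b"] by (simp add: power2_sum)
  finally show ?thesis .
qed

lemma L2_bound:
  assumes "f \<in> borel_measurable lebesgue" "integrable lebesgue h"
    and "\<And>x. (cmod (f x))^2 \<le> h x"
  shows "L2 f"
  unfolding L2_def
proof
  show "integrable lebesgue (\<lambda>x. (cmod (f x))\<^sup>2)"
    by (rule Bochner_Integration.integrable_bound[OF assms(2)])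
       (use assms in \<open>auto intro!: AE_I2 order_trans[OF assms(3) abs_ge_self]\<close>)
qed fact

lemma L2_zero [simp]: "L2 (\<lambda>x. 0)"
  by (simp add: L2_def)

lemma L2_add:
  assumes "L2 f" "L2 h"
  shows "L2 (\<lambda>x. f x + h x)"
proof (rule L2_bound)
  show "(cmod (f x + h x))\<^sup>2 \<le> 2 * (cmod (f x))\<^sup>2 + 2 * (cmod (h x))\<^sup>2" for x
    by (rule norm_add_sq_le)
qed (use assms in \<open>auto simp: L2_def\<close>)

lemma L2_scale:
  assumes "L2 f"
  shows "L2 (\<lambda>x. c * f x)"
  using assms by (auto simp: L2_def norm_mult power_mult_distrib)

lemma L2_uminus: "L2 f \<Longrightarrow> L2 (\<lambda>x. - f x)"
  using L2_scale[of f "-1"] by simp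

lemma L2_diff: "L2 f \<Longrightarrow> L2 h \<Longrightarrow> L2 (\<lambda>x. f x - h x)"
  using L2_add[of f "\<lambda>x. - h x"] L2_uminus[of h] by simp

lemma L2_sum: "(\<And>i. i \<in> I \<Longrightarrow> L2 (u i)) \<Longrightarrow> L2 (\<lambda>x. \<Sum>i\<in>I. u i x)"
proof (induction I rule: infinite_finite_induct)
  case (insert i I)
  then show ?case using L2_add[of "u i" "\<lambda>x. \<Sum>i\<in>I. u i x"] by simp
qed auto

lemma L2_abs_mult_integrable:
  assumes "L2 f" "L2 h"
  shows "integrable lebesgue (\<lambda>x. cmod (f x) * cmod (h x))"
proof (rule Bochner_Integration.integrable_bound)
  show "integrable lebesgue (\<lambda>x. (cmod (f x))^2 + (cmod (h x))^2)"
    using assms by (auto simp: L2_def)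
  have "cmod (f x) * cmod (h x) \<le> (cmod (f x))^2 + (cmod (h x))^2" for x
  proof -
    have "2 * cmod (f x) * cmod (h x) \<le> (cmod (f x))^2 + (cmod (h x))^2"
      by (rule sum_squares_bound)
    moreover have "0 \<le> cmod (f x) * cmod (h x)" by simp
    ultimately show ?thesis by linarith
  qed
  then show "AE x in lebesgue. norm (cmod (f x) * cmod (h x)) \<le> norm ((cmod (f x))\<^sup>2 + (cmod (h x))\<^sup>2)"
    by auto
qed (use assms in \<open>auto simp: L2_def\<close>)

lemma L2_mult_integrable:
  assumes "L2 f" "L2 h"
  shows "integrable lebesgue (\<lambda>x. f x * cnj (h x))"
proof (rule Bochner_Integration.integrable_bound[OF L2_abs_mult_integrable[OF assms]])
  show "(\<lambda>x. f x * cnj (h x)) \<in> borel_measurable lebesgue"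
    using assms by (auto simp: L2_def intro!: borel_measurable_times
        measurable_compose[of h _ borel cnj] borel_measurable_continuous_onI continuous_intros)
qed (auto simp: norm_mult)

lemma L2norm_nonneg [simp]: "0 \<le> L2norm f"
  by (simp add: L2norm_def)

lemma L2norm_sq: "(L2norm f)^2 = (\<integral>x. (cmod (f x))^2 \<partial>lebesgue)"
  by (simp add: L2norm_def)

lemma L2inner_self: "L2inner f f = complex_of_real ((L2norm f)^2)"
proof -
  have "L2inner f f = (\<integral>x. complex_of_real ((cmod (f x))^2) \<partial>lebesgue)"
    unfolding L2inner_def by (simp only: complex_norm_square)
  then show ?thesis by (simp add: L2norm_sq del: of_real_power)
qed

lemma L2inner_cnj: "cnj (L2inner f h) = L2inner h f"
  unfolding L2inner_def
  by (subst Bochner_Integration.integral_cnj[symmetric]) (simp add: mult.commute)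

lemma L2inner_add_left:
  "L2 f \<Longrightarrow> L2 h \<Longrightarrow> L2 k \<Longrightarrow> L2inner (\<lambda>x. f x + h x) k = L2inner f k + L2inner h k"
  unfolding L2inner_def ring_distribs
  by (intro Bochner_Integration.integral_add L2_mult_integrable)

lemma L2inner_scale_left: "L2inner (\<lambda>x. c * f x) k = c * L2inner f k"
  by (simp add: L2inner_def mult.assoc)

lemma L2inner_add_right:
  "L2 f \<Longrightarrow> L2 h \<Longrightarrow> L2 k \<Longrightarrow> L2inner k (\<lambda>x. f x + h x) = L2inner k f + L2inner k h"
  by (metis L2inner_add_left L2inner_cnj complex_cnj_add)

lemma L2inner_scale_right: "L2inner k (\<lambda>x. c * f x) = cnj c * L2inner k f"
  by (metis L2inner_scale_left L2inner_cnj complex_cnj_mult)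

lemma L2inner_diff_left:
  assumes "L2 f" "L2 h" "L2 k"
  shows "L2inner (\<lambda>x. f x - h x) k = L2inner f k - L2inner h k"
  using L2inner_add_left[OF assms(1) L2_uminus[OF assms(2)] assms(3)]
    L2inner_scale_left[of "-1" h k] by simp

lemma L2inner_diff_right:
  "L2 f \<Longrightarrow> L2 h \<Longrightarrow> L2 k \<Longrightarrow> L2inner k (\<lambda>x. f x - h x) = L2inner k f - L2inner k h"
  by (metis L2inner_diff_left L2inner_cnj complex_cnj_diff)

lemma L2inner_zero_left [simp]: "L2inner (\<lambda>x. 0) k = 0"
  by (simp add: L2inner_def)

lemma L2inner_sum_left:
  "(\<And>i. i \<in> I \<Longrightarrow> L2 (u i)) \<Longrightarrow> L2 k \<Longrightarrow>
     L2inner (\<lambda>x. \<Sum>i\<in>I. u i x) k = (\<Sum>i\<in>I. L2inner (u i) k)"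
proof (induction I rule: infinite_finite_induct)
  case (insert i I)
  then show ?case by (simp add: L2inner_add_left L2_sum)
qed auto

lemma abs_integral_sq_le:
  assumes f: "L2 f" and h: "L2 h"
  shows "(\<integral>x. cmod (f x) * cmod (h x) \<partial>lebesgue) \<le> L2norm f * L2norm h"
proof -
  have m: "f \<in> borel_measurable lebesgue" "h \<in> borel_measurable lebesgue"
    using assms by (auto simp: L2_def)
  have e: "(\<integral>\<^sup>+x. ennreal (cmod (k x)) ^ 2 \<partial>lebesgue) = ennreal ((L2norm k)^2)" if "L2 k" for k :: "'a \<Rightarrow> complex"
    using that by (simp add: L2norm_sq nn_integral_eq_integral ennreal_power L2_def)
  have "ennreal ((\<integral>x. cmod (f x) * cmod (h x) \<partial>lebesgue)^2) =
      (\<integral>\<^sup>+x. ennreal (cmod (f x)) * ennreal (cmod (h x)) \<partial>lebesgue)^2"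
    using nn_integral_eq_integral[OF L2_abs_mult_integrable[OF assms]]
    by (simp add: ennreal_mult ennreal_power)
  also have "\<dots> \<le> ennreal ((L2norm f)^2) * ennreal ((L2norm h)^2)"
    using Cauchy_Schwarz_nn_integral[of "\<lambda>x. ennreal (cmod (f x))" lebesgue "\<lambda>x. ennreal (cmod (h x))"] m
    by (simp add: e f h)
  finally have "(\<integral>x. cmod (f x) * cmod (h x) \<partial>lebesgue)^2 \<le> (L2norm f * L2norm h)^2"
    by (simp add: ennreal_mult[symmetric] power_mult_distrib)
  then show ?thesis
    by (rule power2_le_imp_le) simp
qed

lemma L2_Cauchy_Schwarz:
  assumes "L2 f" "L2 h"
  shows "cmod (L2inner f h) \<le> L2norm f * L2norm h"
proof -
  have "cmod (L2inner f h) \<le> (\<integral>x. norm (f x * cnj (h x)) \<partial>lebesgue)"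
    unfolding L2inner_def by (rule integral_norm_bound)
  also have "\<dots> = (\<integral>x. cmod (f x) * cmod (h x) \<partial>lebesgue)"
    by (simp add: norm_mult)
  finally show ?thesis using abs_integral_sq_le[OF assms] by linarith
qed

lemma L2norm_add_sq:
  assumes "L2 f" "L2 h"
  shows "(L2norm (\<lambda>x. f x + h x))^2 = (L2norm f)^2 + 2 * Re (L2inner f h) + (L2norm h)^2"
proof -
  have "complex_of_real ((L2norm (\<lambda>x. f x + h x))^2) =
      L2inner f f + L2inner f h + (cnj (L2inner f h) + L2inner h h)"
    by (simp only: L2inner_self[symmetric] L2inner_add_left L2inner_add_right L2_add assms L2inner_cnj)
  then have "complex_of_real ((L2norm (\<lambda>x. f x + h x))^2) =
     complex_of_real ((L2norm f)^2) + (L2inner f h + cnj (L2inner f h)) + complex_of_real ((L2norm h)^2)"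
    by (simp only: L2inner_self add.assoc)
  then have "Re (complex_of_real ((L2norm (\<lambda>x. f x + h x))^2)) = Re (complex_of_real ((L2norm f)^2) + (L2inner f h + cnj (L2inner f h)) + complex_of_real ((L2norm h)^2))"
    by (rule arg_cong)
  then show ?thesis by (simp del: of_real_power)
qed

lemma L2norm_triangle:
  assumes "L2 f" "L2 h"
  shows "L2norm (\<lambda>x. f x + h x) \<le> L2norm f + L2norm h"
proof (rule power2_le_imp_le)
  have "Re (L2inner f h) \<le> L2norm f * L2norm h"
    using L2_Cauchy_Schwarz[OF assms] complex_Re_le_cmod order_trans by blast
  then show "(L2norm (\<lambda>x. f x + h x))\<^sup>2 \<le> (L2norm f + L2norm h)\<^sup>2"
    by (simp add: L2norm_add_sq assms power2_sum)
qed simp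

lemma L2norm_scale: "L2norm (\<lambda>x. c * f x) = cmod c * L2norm f"
  by (simp add: L2norm_def norm_mult power_mult_distrib real_sqrt_mult)

lemma L2norm_commute: "L2norm (\<lambda>x. f x - h x) = L2norm (\<lambda>x. h x - f x)"
  by (simp add: L2norm_def norm_minus_commute)

lemma L2norm_triangle_diff:
  assumes "L2 f" "L2 h"
  shows "L2norm f \<le> L2norm h + L2norm (\<lambda>x. f x - h x)"
  using L2norm_triangle[OF assms(2) L2_diff[OF assms]] by simp

lemma L2norm_triangle3:
  assumes "L2 f" "L2 h" "L2 k"
  shows "L2norm (\<lambda>x. f x - k x) \<le> L2norm (\<lambda>x. f x - h x) + L2norm (\<lambda>x. h x - k x)"
  using L2norm_triangle[OF L2_diff[OF assms(1,2)] L2_diff[OF assms(2,3)]] by simp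

lemma L2norm_cong_AE:
  assumes "AE x in lebesgue. f x = h x" "f \<in> borel_measurable lebesgue" "h \<in> borel_measurable lebesgue"
  shows "L2norm f = L2norm h"
proof -
  have "(\<integral>x. (cmod (f x))^2 \<partial>lebesgue) = (\<integral>x. (cmod (h x))^2 \<partial>lebesgue)"
    by (rule integral_cong_AE) (use assms in auto)
  then show ?thesis by (simp add: L2norm_def)
qed

lemma L2norm_ennreal:
  assumes "L2 f"
  shows "ennreal ((L2norm f)^2) = (\<integral>\<^sup>+x. ennreal ((cmod (f x))^2) \<partial>lebesgue)"
  using assms by (simp add: L2norm_sq nn_integral_eq_integral L2_def)

lemma L2norm_le_if_nn_integral_le:
  assumes "f \<in> borel_measurable lebesgue" "0 \<le> c"
    and "(\<integral>\<^sup>+x. ennreal ((cmod (f x))^2) \<partial>lebesgue) \<le> ennreal (c^2)"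
  shows "L2 f" "L2norm f \<le> c"
proof -
  have "integrable lebesgue (\<lambda>x. (cmod (f x))^2)"
  proof (rule integrableI_bounded)
    show "(\<integral>\<^sup>+ x. ennreal (norm ((cmod (f x))\<^sup>2)) \<partial>lebesgue) < \<infinity>"
      using assms(3) by (simp add: order_le_less_trans)
  qed (use assms(1) in auto)
  with assms(1) show L: "L2 f" by (simp add: L2_def)
  then have "(L2norm f)^2 \<le> c^2"
    using assms(3) by (simp add: L2norm_ennreal[symmetric])
  then show "L2norm f \<le> c" using assms(2) by (rule power2_le_imp_le)
qed

text \<open>Riesz-Fischer argument. The partial sums of the absolute increments have L2 norm at most
  2, so by monotone convergence they stay bounded almost everywhere and \<open>f\<close> converges
  there; Fatou's lemma carries the norm estimates over to the limit.\<close>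

lemma L2_complete_geometric:
  fixes f :: "nat \<Rightarrow> 'a::euclidean_space \<Rightarrow> complex"
  assumes L: "\<And>k. L2 (f k)"
    and d: "\<And>k. L2norm (\<lambda>x. f (Suc k) x - f k x) \<le> (1/2)^k"
  shows "\<exists>h. L2 h \<and> (\<lambda>k. L2norm (\<lambda>x. h x - f k x)) \<longlonglongrightarrow> 0"
proof -
  define D where "D k x = f (Suc k) x - f k x" for k x
  define S where "S n x = (\<Sum>k<n. complex_of_real (cmod (D k x)))" for n x
  have meas[measurable]: "f k \<in> borel_measurable lebesgue" for k
    using L by (simp add: L2_def)
  have measD[measurable]: "D k \<in> borel_measurable lebesgue" for k
    unfolding D_def by measurable
  have LD: "L2 (D k)" for k unfolding D_def by (intro L2_diff L)
  have LDc: "L2 (\<lambda>x. complex_of_real (cmod (D k x)))" for k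
    using LD[of k] by (auto simp: L2_def)
  have nD: "L2norm (\<lambda>x. complex_of_real (cmod (D k x))) \<le> (1/2)^k" for k
    using d[of k] by (simp add: L2norm_def D_def)
  have LS: "L2 (S n)" for n unfolding S_def by (intro L2_sum LDc)
  have nS': "L2norm (S n) \<le> (\<Sum>k<n. (1/2)^k)" for n
  proof (induction n)
    case 0 then show ?case by (simp add: S_def L2norm_def)
  next
    case (Suc n)
    have "L2norm (S (Suc n)) \<le> L2norm (S n) + L2norm (\<lambda>x. complex_of_real (cmod (D n x)))"
      using L2norm_triangle[OF LS[of n] LDc[of n]] unfolding S_def by simp
    with Suc nD[of n] show ?case by simp
  qed
  have "(\<Sum>k<n. (1/2::real)^k) \<le> 2" for n
    using sum_le_suminf[of "\<lambda>k. (1/2::real)^k" "{..<n}"] suminf_geometric[of "1/2::real"]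
    by (simp add: summable_geometric)
  with nS' have nS: "L2norm (S n) \<le> 2" for n using order_trans by blast
  define T where "T n x = ennreal ((\<Sum>k<n. cmod (D k x))^2)" for n x
  have T: "(\<integral>\<^sup>+x. T n x \<partial>lebesgue) \<le> 4" for n
  proof -
    have "(cmod (S n x))^2 = (\<Sum>k<n. cmod (D k x))^2" for x
      unfolding S_def of_real_sum[symmetric] norm_of_real by simp
    then have "(\<integral>\<^sup>+x. T n x \<partial>lebesgue) = ennreal ((L2norm (S n))^2)"
      by (simp add: L2norm_ennreal[OF LS] T_def)
    also have "\<dots> \<le> ennreal (2^2)"
      by (intro ennreal_leI power_mono nS) auto
    finally show ?thesis by simp
  qed
  have "(\<integral>\<^sup>+x. (SUP n. T n x) \<partial>lebesgue) = (SUP n. \<integral>\<^sup>+x. T n x \<partial>lebesgue)"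
  proof (rule nn_integral_monotone_convergence_SUP)
    show "incseq T"
      unfolding T_def incseq_def le_fun_def
      by (auto intro!: ennreal_leI power_mono sum_mono2 sum_nonneg)
  qed (auto simp: T_def)
  also have "\<dots> \<le> 4" using T by (auto intro: SUP_least)
  finally have "(\<integral>\<^sup>+x. (SUP n. T n x) \<partial>lebesgue) \<noteq> \<infinity>"
    by (metis ennreal_numeral_less_top infinity_ennreal_def leD)
  then have "AE x in lebesgue. (SUP n. T n x) \<noteq> \<infinity>"
    by (intro nn_integral_noteq_infinite) (auto simp: T_def)
  then have conv: "AE x in lebesgue. convergent (\<lambda>n. f n x)"
  proof eventually_elim
    case (elim x)
    then obtain B where B: "(SUP n. T n x) = ennreal B" "0 \<le> B" by (cases "SUP n. T n x") auto
    have "T n x \<le> ennreal B" for n unfolding B(1)[symmetric] by (rule SUP_upper) simp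
    then have "(\<Sum>k<n. cmod (D k x))^2 \<le> B" for n using B(2) by (simp add: T_def)
    then have "(\<Sum>k<n. cmod (D k x)) \<le> sqrt B" for n by (intro real_le_rsqrt)
    then have "summable (\<lambda>k. cmod (D k x))"
      by (intro summableI_nonneg_bounded) auto
    then have "summable (\<lambda>k. D k x)" by (rule summable_norm_cancel)
    then have "convergent (\<lambda>n. \<Sum>k<n. D k x)" by (simp add: summable_iff_convergent)
    moreover have "(\<Sum>k<n. D k x) = f n x - f 0 x" for n
      unfolding D_def by (rule sum_lessThan_telescope)
    ultimately have "convergent (\<lambda>n. f n x - f 0 x)" by simp
    then show ?case using convergent_diff_const_right_iff[of "\<lambda>n. f n x" "f 0 x"] by simp
  qed
  define h where "h x = lim (\<lambda>n. f n x)" for x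
  have mh[measurable]: "h \<in> borel_measurable lebesgue"
    unfolding h_def by measurable
  have lim: "AE x in lebesgue. (\<lambda>n. f n x) \<longlonglongrightarrow> h x"
    using conv by eventually_elim (simp add: h_def convergent_LIMSEQ_iff)
  have tail: "L2norm (\<lambda>x. f (k + j) x - f k x) \<le> 2 * (1/2)^k" for k j
  proof -
    have "L2norm (\<lambda>x. f (k + j) x - f k x) \<le> (\<Sum>i<j. (1/2)^(k+i))"
    proof (induction j)
      case 0 then show ?case by (simp add: L2norm_def)
    next
      case (Suc j)
      have "L2norm (\<lambda>x. f (k + Suc j) x - f k x) \<le>
         L2norm (\<lambda>x. f (Suc (k + j)) x - f (k+j) x) + L2norm (\<lambda>x. f (k + j) x - f k x)"
        using L2norm_triangle3[OF L[of "Suc (k+j)"] L[of "k+j"] L[of k]] by simp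
      with Suc d[of "k+j"] show ?case by simp
    qed
    also have "\<dots> = (1/2)^k * (\<Sum>i<j. (1/2)^i)" by (simp add: power_add sum_distrib_left)
    also have "\<dots> \<le> (1/2)^k * 2" using \<open>(\<Sum>k<j. (1/2::real)^k) \<le> 2\<close>
      by (intro mult_left_mono) auto
    finally show ?thesis by simp
  qed
  have bd: "(\<integral>\<^sup>+x. ennreal ((cmod (h x - f k x))^2) \<partial>lebesgue) \<le> ennreal ((2 * (1/2)^k)^2)" for k
  proof -
    have "(\<integral>\<^sup>+x. ennreal ((cmod (h x - f k x))^2) \<partial>lebesgue) =
      (\<integral>\<^sup>+x. liminf (\<lambda>j. ennreal ((cmod (f (k + j) x - f k x))^2)) \<partial>lebesgue)"
    proof (rule nn_integral_cong_AE)
      show "AE x in lebesgue. ennreal ((cmod (h x - f k x))\<^sup>2) =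
            liminf (\<lambda>j. ennreal ((cmod (f (k + j) x - f k x))\<^sup>2))"
        using lim
      proof eventually_elim
        case (elim x)
        then have "(\<lambda>j. f (k + j) x) \<longlonglongrightarrow> h x"
          using LIMSEQ_ignore_initial_segment[of "\<lambda>n. f n x" "h x" k] by (simp add: add.commute)
        then have "(\<lambda>j. ennreal ((cmod (f (k + j) x - f k x))\<^sup>2)) \<longlonglongrightarrow> ennreal ((cmod (h x - f k x))\<^sup>2)"
          by (intro tendsto_ennrealI tendsto_intros)
        then show ?case by (rule lim_imp_Liminf[OF sequentially_bot, symmetric])
      qed
    qed
    also have "\<dots> \<le> liminf (\<lambda>j. \<integral>\<^sup>+x. ennreal ((cmod (f (k + j) x - f k x))^2) \<partial>lebesgue)"
      by (rule nn_integral_liminf) measurable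
    also have "\<dots> \<le> liminf (\<lambda>j::nat. ennreal ((2 * (1/2)^k)^2))"
    proof (rule Liminf_mono, rule always_eventually, rule allI)
      fix j
      show "(\<integral>\<^sup>+ x. ennreal ((cmod (f (k + j) x - f k x))\<^sup>2) \<partial>lebesgue) \<le> ennreal ((2 * (1 / 2) ^ k)\<^sup>2)"
        unfolding L2norm_ennreal[OF L2_diff[OF L L], symmetric]
        by (intro ennreal_leI power_mono tail) simp
    qed
    finally show ?thesis by (simp add: Liminf_const)
  qed
  have b: "L2 (\<lambda>x. h x - f k x)" "L2norm (\<lambda>x. h x - f k x) \<le> 2 * (1/2)^k" for k
    using L2norm_le_if_nn_integral_le[of "\<lambda>x. h x - f k x", OF _ _ bd[of k]] by auto
  have "L2 h" using L2_add[OF b(1)[of 0] L[of 0]] by simp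
  moreover have "(\<lambda>k. L2norm (\<lambda>x. h x - f k x)) \<longlonglongrightarrow> 0"
  proof (rule tendsto_sandwich[OF _ _ tendsto_const])
    show "(\<lambda>k. 2 * (1/2::real)^k) \<longlonglongrightarrow> 0"
      by (intro tendsto_mult_right_zero LIMSEQ_power_zero) simp
  qed (use b in auto)
  ultimately show ?thesis by blast
qed

lemma L2_complete:
  fixes f :: "nat \<Rightarrow> 'a::euclidean_space \<Rightarrow> complex"
  assumes L: "\<And>k. L2 (f k)"
    and C: "\<And>e. e > 0 \<Longrightarrow> \<exists>N. \<forall>m\<ge>N. \<forall>n\<ge>N. L2norm (\<lambda>x. f m x - f n x) < e"
  shows "\<exists>h. L2 h \<and> (\<lambda>k. L2norm (\<lambda>x. h x - f k x)) \<longlonglongrightarrow> 0"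
proof -
  have "\<exists>N. \<forall>m\<ge>N. \<forall>n\<ge>N. L2norm (\<lambda>x. f m x - f n x) < (1/2)^k" for k :: nat
    by (rule C) simp
  then obtain N0 where N0: "\<And>k m n. m \<ge> N0 k \<Longrightarrow> n \<ge> N0 k \<Longrightarrow> L2norm (\<lambda>x. f m x - f n x) < (1/2)^k"
    by metis
  \<comment> \<open>Summing the thresholds makes the indices nondecreasing, so that both
    \<open>N (Suc k)\<close> and \<open>N k\<close> are at least \<open>N0 k\<close>.\<close>
  define N where "N k = (\<Sum>i\<le>k. N0 i)" for k
  have N: "N k \<ge> N0 k" "N (Suc k) \<ge> N k" for k
    by (auto simp: N_def intro: member_le_sum)
  have "\<exists>h. L2 h \<and> (\<lambda>k. L2norm (\<lambda>x. h x - f (N k) x)) \<longlonglongrightarrow> 0"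
  proof (rule L2_complete_geometric[OF L])
    show "L2norm (\<lambda>x. f (N (Suc k)) x - f (N k) x) \<le> (1 / 2) ^ k" for k
      using N0[of k "N (Suc k)" "N k"] N[of k] by force
  qed
  then obtain h where h: "L2 h" "(\<lambda>k. L2norm (\<lambda>x. h x - f (N k) x)) \<longlonglongrightarrow> 0" by blast
  have "(\<lambda>k. L2norm (\<lambda>x. h x - f k x)) \<longlonglongrightarrow> 0"
  proof (rule LIMSEQ_I)
    fix e :: real assume e: "e > 0"
    obtain M where M: "\<And>m n. m \<ge> M \<Longrightarrow> n \<ge> M \<Longrightarrow> L2norm (\<lambda>x. f m x - f n x) < e/2"
      using C[of "e/2"] e by auto
    obtain M' where M': "\<And>k. k \<ge> M' \<Longrightarrow> L2norm (\<lambda>x. h x - f (N k) x) < e/2"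
      using LIMSEQ_D[OF h(2), of "e/2"] e by auto
    obtain k0 where k0: "(1/2::real)^k0 < e/2"
      using e real_arch_pow_inv[of "e/2" "1/2"] by auto
    define k where "k = max M' k0"
    have "(1/2::real)^k \<le> (1/2)^k0"
      unfolding k_def by (intro power_decreasing) auto
    show "\<exists>no. \<forall>n\<ge>no. norm (L2norm (\<lambda>x. h x - f n x) - 0) < e"
    proof (intro exI allI impI)
      fix n assume n: "n \<ge> N k"
      have "L2norm (\<lambda>x. h x - f n x) \<le> L2norm (\<lambda>x. h x - f (N k) x) + L2norm (\<lambda>x. f (N k) x - f n x)"
        by (rule L2norm_triangle3) (use h L in auto)
      also have "L2norm (\<lambda>x. h x - f (N k) x) < e/2" by (rule M') (simp add: k_def)
      also have "L2norm (\<lambda>x. f (N k) x - f n x) < (1/2)^k"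
        by (rule N0) (use N(1)[of k] n in auto)
      finally have "L2norm (\<lambda>x. h x - f n x) < e"
        using k0 \<open>(1/2::real)^k \<le> (1/2)^k0\<close> by linarith
      then show "norm (L2norm (\<lambda>x. h x - f n x) - 0) < e" by simp
    qed
  qed
  with h(1) show ?thesis by blast
qed

section \<open>Frames on a closed subspace of square-integrable functions\<close>

text \<open>The vectors \<open>e n\<close> are not assumed to lie in \<open>V\<close>. Only their
  inner products with members of \<open>V\<close> are controlled, so the frame operator is met only
  through its form, tested against the closure of \<open>V\<close>.\<close>

locale L2_frame =
  fixes V :: "('a::euclidean_space \<Rightarrow> complex) set" and e :: "nat \<Rightarrow> 'a \<Rightarrow> complex" and A B :: real
  assumes V_L2: "f \<in> V \<Longrightarrow> L2 f"
    and V_zero: "(\<lambda>x. 0) \<in> V"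
    and V_add: "f \<in> V \<Longrightarrow> h \<in> V \<Longrightarrow> (\<lambda>x. f x + h x) \<in> V"
    and V_scale: "f \<in> V \<Longrightarrow> (\<lambda>x. c * f x) \<in> V"
    and e_L2: "L2 (e n)"
    and A_pos: "0 < A" and B_pos: "0 < B"
    and V_summable: "f \<in> V \<Longrightarrow> summable (\<lambda>n. (cmod (L2inner f (e n)))^2)"
    and V_lower: "f \<in> V \<Longrightarrow> A * (L2norm f)^2 \<le> (\<Sum>n. (cmod (L2inner f (e n)))^2)"
    and V_upper: "f \<in> V \<Longrightarrow> (\<Sum>n. (cmod (L2inner f (e n)))^2) \<le> B * (L2norm f)^2"
begin

section \<open>The closure \<open>H\<close> of the subspace and the frame bounds on it\<close>

abbreviation "H \<equiv> L2_closure V"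

definition N where "N f = (\<Sum>n. (cmod (L2inner f (e n)))^2)"

text \<open>\<open>a f h\<close> stands for the inner product of S f with h, where S is the frame
  operator. Working with the form avoids proving that the series for S f converges in L2.\<close>

definition a where "a f h = (\<Sum>n. L2inner f (e n) * L2inner (e n) h)"

lemma H_L2: "f \<in> H \<Longrightarrow> L2 f"
  by (simp add: L2_closure_def)

lemma H_approx: "f \<in> H \<Longrightarrow> d > 0 \<Longrightarrow> \<exists>h\<in>V. L2norm (\<lambda>t. f t - h t) < d"
  by (simp add: L2_closure_def)

lemma V_H: "f \<in> V \<Longrightarrow> f \<in> H"
proof -
  assume "f \<in> V"
  moreover have "L2norm (\<lambda>t. f t - f t) = 0" by (simp add: L2norm_def)
  ultimately show ?thesis
    unfolding L2_closure_def using V_L2 by force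
qed

lemma H_add:
  assumes "f \<in> H" "h \<in> H"
  shows "(\<lambda>x. f x + h x) \<in> H"
  unfolding L2_closure_def
proof (intro CollectI conjI allI impI)
  show "L2 (\<lambda>x. f x + h x)" using assms by (intro L2_add H_L2)
  fix d :: real assume "d > 0"
  then obtain f' h' where f': "f' \<in> V" "L2norm (\<lambda>t. f t - f' t) < d/2"
    and h': "h' \<in> V" "L2norm (\<lambda>t. h t - h' t) < d/2"
    using H_approx[OF assms(1), of "d/2"] H_approx[OF assms(2), of "d/2"] by auto
  have "L2norm (\<lambda>t. (f t - f' t) + (h t - h' t)) \<le> L2norm (\<lambda>t. f t - f' t) + L2norm (\<lambda>t. h t - h' t)"
    by (intro L2norm_triangle L2_diff H_L2 V_L2 assms f' h')
  with f' h' have "L2norm (\<lambda>t. (f t + h t) - (f' t + h' t)) < d"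
    by (simp add: algebra_simps)
  then show "\<exists>k\<in>V. L2norm (\<lambda>t. f t + h t - k t) < d"
    using V_add[OF f'(1) h'(1)] by (intro bexI)
qed

lemma H_scale:
  assumes "f \<in> H"
  shows "(\<lambda>x. c * f x) \<in> H"
  unfolding L2_closure_def
proof (intro CollectI conjI allI impI)
  show "L2 (\<lambda>x. c * f x)" using assms by (intro L2_scale H_L2)
  fix d :: real assume d: "d > 0"
  then have "d / (cmod c + 1) > 0" by (simp add: add_nonneg_pos)
  then obtain f' where f': "f' \<in> V" "L2norm (\<lambda>t. f t - f' t) < d / (cmod c + 1)"
    using H_approx[OF assms] by blast
  have "L2norm (\<lambda>t. c * f t - c * f' t) = cmod c * L2norm (\<lambda>t. f t - f' t)"
    by (simp add: L2norm_scale[symmetric] right_diff_distrib)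
  also have "\<dots> \<le> cmod c * (d / (cmod c + 1))"
    using f' by (intro mult_left_mono) auto
  also have "\<dots> < d"
    using d by (simp add: pos_divide_less_eq add_nonneg_pos mult.commute)
  finally show "\<exists>k\<in>V. L2norm (\<lambda>t. c * f t - k t) < d"
    by (rule bexI[OF _ V_scale[OF f'(1), of c]])
qed

lemma H_diff: "f \<in> H \<Longrightarrow> h \<in> H \<Longrightarrow> (\<lambda>x. f x - h x) \<in> H"
  using H_add[of f "\<lambda>x. (-1) * h x"] H_scale[of h "-1"] by simp

lemma H_sum: "(\<And>i. i \<in> I \<Longrightarrow> u i \<in> H) \<Longrightarrow> (\<lambda>x. \<Sum>i\<in>I. u i x) \<in> H"
proof (induction I rule: infinite_finite_induct)
  case (insert i I)
  then show ?case using H_add[of "u i" "\<lambda>x. \<Sum>i\<in>I. u i x"] by simp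
qed (auto intro: V_H V_zero)

lemma H_closed:
  assumes "\<And>k. f k \<in> H" "L2 h" "(\<lambda>k. L2norm (\<lambda>x. h x - f k x)) \<longlonglongrightarrow> 0"
  shows "h \<in> H"
  unfolding L2_closure_def
proof (intro CollectI conjI allI impI)
  fix d :: real assume d: "d > 0"
  obtain k where k: "L2norm (\<lambda>x. h x - f k x) < d/2"
    using LIMSEQ_D[OF assms(3), of "d/2"] d by force
  obtain f' where f': "f' \<in> V" "L2norm (\<lambda>t. f k t - f' t) < d/2"
    using H_approx[OF assms(1)[of k], of "d/2"] d by auto
  have "L2norm (\<lambda>t. h t - f' t) \<le> L2norm (\<lambda>x. h x - f k x) + L2norm (\<lambda>t. f k t - f' t)"
    by (intro L2norm_triangle3 assms H_L2 V_L2 f')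
  with k f' show "\<exists>f\<in>V. L2norm (\<lambda>t. h t - f t) < d" by force
qed fact

lemma L2inner_tendsto:
  assumes "\<And>k. L2 (f k)" "L2 h" "(\<lambda>k. L2norm (\<lambda>x. h x - f k x)) \<longlonglongrightarrow> 0" "L2 w"
  shows "(\<lambda>k. L2inner (f k) w) \<longlonglongrightarrow> L2inner h w"
proof -
  have "(\<lambda>k. L2inner h w - L2inner (f k) w) \<longlonglongrightarrow> 0"
  proof (rule Lim_null_comparison)
    show "\<forall>\<^sub>F k in sequentially. norm (L2inner h w - L2inner (f k) w) \<le> L2norm (\<lambda>x. h x - f k x) * L2norm w"
      using L2_Cauchy_Schwarz[OF L2_diff[OF assms(2,1)] assms(4)]
      by (simp add: L2inner_diff_left assms)
    show "(\<lambda>k. L2norm (\<lambda>x. h x - f k x) * L2norm w) \<longlonglongrightarrow> 0"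
      using tendsto_mult_left_zero[OF assms(3)] by simp
  qed
  then have "(\<lambda>k. L2inner h w - (L2inner h w - L2inner (f k) w)) \<longlonglongrightarrow> L2inner h w - 0"
    by (intro tendsto_intros)
  then show ?thesis by simp
qed

lemma L2norm_tendsto:
  assumes "\<And>k. L2 (f k)" "L2 h" "(\<lambda>k. L2norm (\<lambda>x. h x - f k x)) \<longlonglongrightarrow> 0"
  shows "(\<lambda>k. L2norm (f k)) \<longlonglongrightarrow> L2norm h"
proof -
  have "(\<lambda>k. L2norm (f k) - L2norm h) \<longlonglongrightarrow> 0"
  proof (rule Lim_null_comparison[OF _ assms(3)])
    have "\<bar>L2norm (f k) - L2norm h\<bar> \<le> L2norm (\<lambda>x. h x - f k x)" for k
      using L2norm_triangle_diff[OF assms(2) assms(1)[of k]] L2norm_triangle_diff[OF assms(1)[of k] assms(2)]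
        L2norm_commute[of h "f k"] by linarith
    then show "\<forall>\<^sub>F k in sequentially. norm (L2norm (f k) - L2norm h) \<le> L2norm (\<lambda>x. h x - f k x)"
      by simp
  qed
  then show ?thesis by (rule LIM_zero_cancel)
qed

lemma H_seq:
  assumes "f \<in> H"
  obtains s where "\<And>k. s k \<in> V" "(\<lambda>k. L2norm (\<lambda>x. f x - s k x)) \<longlonglongrightarrow> 0"
proof -
  have "\<exists>h\<in>V. L2norm (\<lambda>t. f t - h t) < inverse (real (Suc k))" for k
    by (rule H_approx[OF assms]) simp
  then obtain s where s: "\<And>k. s k \<in> V" "\<And>k. L2norm (\<lambda>t. f t - s k t) < inverse (real (Suc k))"
    by metis
  have "(\<lambda>k. L2norm (\<lambda>x. f x - s k x)) \<longlonglongrightarrow> 0"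
    by (rule tendsto_sandwich[OF _ _ tendsto_const LIMSEQ_inverse_real_of_nat])
      (use s(2) in \<open>auto intro!: always_eventually less_imp_le\<close>)
  with s(1) show ?thesis by (rule that)
qed

lemma partial_sum_tendsto:
  assumes "\<And>k. L2 (f k)" "L2 h" "(\<lambda>k. L2norm (\<lambda>x. h x - f k x)) \<longlonglongrightarrow> 0"
  shows "(\<lambda>k. \<Sum>n<m. (cmod (L2inner (f k) (e n)))^2) \<longlonglongrightarrow> (\<Sum>n<m. (cmod (L2inner h (e n)))^2)"
  by (intro tendsto_intros L2inner_tendsto assms e_L2)

text \<open>A finite sum is continuous in L2 and inherits the bound from approximants in
  \<open>V\<close>. Bounding the partial sums first is what makes the infinite sum over
  \<open>n\<close> available on \<open>H\<close>.\<close>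

lemma H_partial:
  assumes "f \<in> H"
  shows "(\<Sum>n<m. (cmod (L2inner f (e n)))^2) \<le> B * (L2norm f)^2"
proof -
  obtain s where s: "\<And>k. s k \<in> V" "(\<lambda>k. L2norm (\<lambda>x. f x - s k x)) \<longlonglongrightarrow> 0"
    using H_seq[OF assms] by blast
  have L: "L2 (s k)" for k by (intro V_L2 s)
  show ?thesis
  proof (rule LIMSEQ_le[OF partial_sum_tendsto[OF L H_L2[OF assms] s(2)]])
    show "(\<lambda>k. B * (L2norm (s k))^2) \<longlonglongrightarrow> B * (L2norm f)^2"
      by (intro tendsto_intros L2norm_tendsto L H_L2 assms s(2))
    have "(\<Sum>n<m. (cmod (L2inner (s k) (e n)))^2) \<le> B * (L2norm (s k))^2" for k
      using sum_le_suminf[OF V_summable[OF s(1)], of "{..<m}" k] V_upper[OF s(1), of k] by force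
    then show "\<exists>K. \<forall>k\<ge>K. (\<Sum>n<m. (cmod (L2inner (s k) (e n)))\<^sup>2) \<le> B * (L2norm (s k))\<^sup>2"
      by blast
  qed
qed

lemma H_summable: "f \<in> H \<Longrightarrow> summable (\<lambda>n. (cmod (L2inner f (e n)))^2)"
  by (rule summableI_nonneg_bounded[OF _ H_partial]) auto

lemma H_upper: "f \<in> H \<Longrightarrow> N f \<le> B * (L2norm f)^2"
  unfolding N_def by (rule suminf_le_const[OF H_summable H_partial])

lemma N_nonneg: "0 \<le> N f" if "f \<in> H"
  unfolding N_def by (intro suminf_nonneg H_summable that) auto

text \<open>Continuity of \<open>N\<close> is not at hand. Writing s_k = f - (f - s_k) and using |x
  + y|^2 \<le> 2 |x|^2 + 2 |y|^2 in each term gives N(s_k) \<le> 2 N(f) + 2 N(f - s_k), whose last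
  term tends to 0 by \<open>H_upper\<close>; the factor 2 costs half of \<open>A\<close>.\<close>

lemma H_lower:
  assumes "f \<in> H"
  shows "A / 2 * (L2norm f)^2 \<le> N f"
proof -
  obtain s where s: "\<And>k. s k \<in> V" "(\<lambda>k. L2norm (\<lambda>x. f x - s k x)) \<longlonglongrightarrow> 0"
    using H_seq[OF assms] by blast
  have L: "L2 (s k)" for k by (intro V_L2 s)
  have "A * (L2norm f)^2 \<le> 2 * N f + 2 * (B * 0^2)"
  proof (rule LIMSEQ_le)
    show "(\<lambda>k. A * (L2norm (s k))^2) \<longlonglongrightarrow> A * (L2norm f)^2"
      by (intro tendsto_intros L2norm_tendsto L H_L2 assms s(2))
    show "(\<lambda>k. 2 * N f + 2 * (B * (L2norm (\<lambda>x. f x - s k x))^2)) \<longlonglongrightarrow> 2 * N f + 2 * (B * 0^2)"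
      by (intro tendsto_intros s(2))
    have "A * (L2norm (s k))^2 \<le> 2 * N f + 2 * (B * (L2norm (\<lambda>x. f x - s k x))^2)" for k
    proof -
      have d: "(\<lambda>x. f x - s k x) \<in> H" by (intro H_diff assms V_H s)
      have "N (s k) \<le> (\<Sum>n. 2 * (cmod (L2inner f (e n)))^2 + 2 * (cmod (L2inner (\<lambda>x. f x - s k x) (e n)))^2)"
        unfolding N_def
      proof (rule suminf_le)
        show "(cmod (L2inner (s k) (e n)))\<^sup>2 \<le> 2 * (cmod (L2inner f (e n)))\<^sup>2 +
              2 * (cmod (L2inner (\<lambda>x. f x - s k x) (e n)))\<^sup>2" for n
          using norm_add_sq_le[of "L2inner f (e n)" "- L2inner (\<lambda>x. f x - s k x) (e n)"]
          by (simp add: L2inner_diff_left H_L2 assms L e_L2 norm_minus_commute)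
      qed (intro H_summable V_H s summable_add summable_mult assms d)+
      also have "\<dots> = 2 * N f + 2 * N (\<lambda>x. f x - s k x)"
        unfolding N_def
        by (simp only: suminf_add[symmetric] suminf_mult summable_mult H_summable[OF assms] H_summable[OF d])
      finally show ?thesis using V_lower[OF s(1), of k] H_upper[OF d] by (simp add: N_def)
    qed
    then show "\<exists>M. \<forall>k\<ge>M. A * (L2norm (s k))\<^sup>2 \<le> 2 * N f + 2 * (B * (L2norm (\<lambda>x. f x - s k x))\<^sup>2)"
      by blast
  qed
  then show ?thesis by simp
qed

section \<open>The form of the frame operator and its inversion\<close>

lemma prod_le_half_squares: "cmod (z * w) \<le> (cmod z)^2 / 2 + (cmod w)^2 / 2"
  using sum_squares_bound[of "cmod z" "cmod w"] by (simp add: norm_mult)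

lemma a_summable_norm:
  assumes "f \<in> H" "h \<in> H"
  shows "summable (\<lambda>n. cmod (L2inner f (e n) * L2inner (e n) h))"
proof (rule summable_comparison_test')
  show "summable (\<lambda>n. (cmod (L2inner f (e n)))^2 / 2 + (cmod (L2inner h (e n)))^2 / 2)"
    by (intro summable_add summable_divide H_summable assms)
  show "norm (cmod (L2inner f (e n) * L2inner (e n) h)) \<le>
     (cmod (L2inner f (e n)))^2 / 2 + (cmod (L2inner h (e n)))^2 / 2" for n
    using prod_le_half_squares[of "L2inner f (e n)" "L2inner (e n) h"]
      L2inner_cnj[of h "e n", symmetric] by simp
qed

lemma a_summable:
  "f \<in> H \<Longrightarrow> h \<in> H \<Longrightarrow> summable (\<lambda>n. L2inner f (e n) * L2inner (e n) h)"
  by (rule summable_norm_cancel[OF a_summable_norm])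

lemma a_sums:
  "f \<in> H \<Longrightarrow> h \<in> H \<Longrightarrow> (\<lambda>n. L2inner f (e n) * L2inner (e n) h) sums a f h"
  unfolding a_def by (rule summable_sums[OF a_summable])

lemma inner_self_term: "L2inner f (e n) * L2inner (e n) f = complex_of_real ((cmod (L2inner f (e n)))^2)"
  by (metis L2inner_cnj complex_norm_square)

lemma a_self:
  assumes "f \<in> H"
  shows "a f f = complex_of_real (N f)"
  unfolding a_def N_def inner_self_term
  by (rule suminf_of_real[OF H_summable[OF assms], symmetric])

lemma N_add:
  assumes "f \<in> H" "h \<in> H"
  shows "N (\<lambda>x. f x + h x) = N f + 2 * Re (a f h) + N h"
proof -
  have fs: "(\<lambda>n. (cmod (L2inner f (e n)))^2) sums N f" "(\<lambda>n. (cmod (L2inner h (e n)))^2) sums N h"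
    unfolding N_def by (intro summable_sums H_summable assms)+
  have "(\<lambda>n. (cmod (L2inner f (e n)))^2 + 2 * Re (L2inner f (e n) * L2inner (e n) h) + (cmod (L2inner h (e n)))^2)
     sums (N f + 2 * Re (a f h) + N h)"
    by (intro sums_add sums_mult sums_Re a_sums fs assms)
  moreover have "(cmod (L2inner f (e n)))^2 + 2 * Re (L2inner f (e n) * L2inner (e n) h) + (cmod (L2inner h (e n)))^2
      = (cmod (L2inner (\<lambda>x. f x + h x) (e n)))^2" for n
  proof -
    have "L2inner (e n) h = cnj (L2inner h (e n))" by (simp add: L2inner_cnj)
    then show ?thesis
      using assms H_L2 e_L2
      by (simp only: L2inner_add_left cmod_power2)
        (simp add: power2_eq_square algebra_simps)
  qed
  ultimately show ?thesis by (simp add: N_def sums_iff)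
qed

lemma N_scale: "f \<in> H \<Longrightarrow> N (\<lambda>x. c * f x) = (cmod c)^2 * N f"
  unfolding N_def L2inner_scale_left norm_mult power_mult_distrib
  by (rule suminf_mult[OF H_summable])

lemma a_scale_right: "f \<in> H \<Longrightarrow> h \<in> H \<Longrightarrow> a f (\<lambda>x. c * h x) = cnj c * a f h"
  unfolding a_def L2inner_scale_right
  by (subst suminf_mult[OF a_summable, symmetric]) (auto simp: mult_ac)

lemma a_diff_left:
  assumes "f \<in> H" "f' \<in> H" "h \<in> H"
  shows "a (\<lambda>x. f x - f' x) h = a f h - a f' h"
  unfolding a_def
  by (subst suminf_diff[OF a_summable a_summable])
    (use assms in \<open>auto simp: L2inner_diff_left H_L2 e_L2 algebra_simps\<close>)

lemma N_zero_imp: "f \<in> H \<Longrightarrow> N f = 0 \<Longrightarrow> L2norm f = 0"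
  using H_lower[of f] A_pos by (auto simp: mult_le_0_iff)

lemma frame_operator_unique:
  assumes "f \<in> H" "f' \<in> H" "\<And>h. h \<in> H \<Longrightarrow> a f h = a f' h"
  shows "L2norm (\<lambda>x. f x - f' x) = 0"
proof (rule N_zero_imp)
  show d: "(\<lambda>x. f x - f' x) \<in> H" by (intro H_diff assms)
  have "a (\<lambda>x. f x - f' x) (\<lambda>x. f x - f' x) = 0"
    by (subst a_diff_left[OF assms(1,2) d]) (simp add: assms(3)[OF d])
  then show "N (\<lambda>x. f x - f' x) = 0" by (simp add: a_self[OF d])
qed

text \<open>Existence is the Lax-Milgram argument: minimise the quadratic functional whose
  Euler-Lagrange equation is the weak equation.\<close>

lemma frame_operator_exists:
  assumes u: "L2 u"
  shows "\<exists>f\<in>H. \<forall>h\<in>H. a f h = L2inner u h"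
proof -
  define Q where "Q f = N f - 2 * Re (L2inner u f)" for f
  have cs: "Re (L2inner u f) \<le> L2norm u * L2norm f" if "f \<in> H" for f
    using L2_Cauchy_Schwarz[OF u H_L2[OF that]] complex_Re_le_cmod order_trans by blast
  \<comment> \<open>Complete the square: A/2 x^2 - 2 v x is smallest at x = 2 v / A, with value -2
    v^2 / A.\<close>
  have lowb: "- 2 * (L2norm u)^2 / A \<le> Q f" if "f \<in> H" for f
  proof -
    define x where "x = L2norm f"
    define v where "v = L2norm u"
    have "2 * (v * x) \<le> A / 2 * x^2 + 2 * v^2 / A"
    proof -
      have "0 \<le> (A * x - 2 * v)^2 / (2 * A)" using A_pos by simp
      also have "\<dots> = A / 2 * x^2 + 2 * v^2 / A - 2 * (v * x)"
        using A_pos by (simp add: field_simps power2_eq_square)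
      finally show ?thesis by simp
    qed
    with H_lower[OF that] cs[OF that] show ?thesis
      unfolding Q_def x_def v_def by simp
  qed
  define m where "m = (INF f\<in>H. Q f)"
  have bdd: "bdd_below (Q ` H)" using lowb by (intro bdd_belowI2)
  have ne: "H \<noteq> {}" using V_H[OF V_zero] by blast
  have m_le: "m \<le> Q f" if "f \<in> H" for f
    unfolding m_def by (rule cINF_lower[OF bdd that])
  have "\<exists>f\<in>H. Q f < m + inverse (real (Suc k))" for k
    using cINF_less_iff[OF ne bdd, of "m + inverse (real (Suc k))"] by (simp add: m_def)
  then obtain s where s: "\<And>k. s k \<in> H" "\<And>k. Q (s k) < m + inverse (real (Suc k))" by metis
  have sL: "L2 (s k)" for k by (intro H_L2 s)
  \<comment> \<open>Parallelogram law at the midpoint \<open>z\<close>: N(s_j - s_k) = 2 Q(s_j) + 2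
    Q(s_k) - 4 Q(z), and Q(z) is at least \<open>m\<close>. So a minimising sequence is Cauchy for
    \<open>N\<close>, hence in L2 by \<open>H_lower\<close>.\<close>
  have key: "N (\<lambda>x. s j x - s k x) \<le> 2 * inverse (real (Suc j)) + 2 * inverse (real (Suc k))" for j k
  proof -
    have mk: "(\<lambda>x. (-1) * s k x) \<in> H" by (intro H_scale s)
    have 1: "N (\<lambda>x. s j x - s k x) = N (s j) - 2 * Re (a (s j) (s k)) + N (s k)"
      using N_add[OF s(1)[of j] mk] by (simp only: a_scale_right[OF s(1) s(1)] N_scale[OF s(1)]) simp
    define z where "z = (\<lambda>x. (1/2) * (s j x + s k x))"
    have z: "z \<in> H" unfolding z_def by (intro H_scale H_add s)
    have Nz: "4 * N z = N (s j) + 2 * Re (a (s j) (s k)) + N (s k)"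
      unfolding z_def
      by (simp only: N_scale[OF H_add[OF s(1) s(1)]] N_add[OF s(1) s(1)]) (simp add: power2_eq_square)
    have uz: "2 * Re (L2inner u z) = Re (L2inner u (s j)) + Re (L2inner u (s k))"
      unfolding z_def L2inner_scale_right by (simp add: L2inner_add_right[OF sL sL u])
    have "m \<le> Q z" by (rule m_le[OF z])
    then show ?thesis
      using s(2)[of j] s(2)[of k] 1 Nz uz unfolding Q_def by linarith
  qed
  have "\<exists>h. L2 h \<and> (\<lambda>k. L2norm (\<lambda>x. h x - s k x)) \<longlonglongrightarrow> 0"
  proof (rule L2_complete[OF sL])
    fix d :: real assume d: "d > 0"
    obtain M where M: "inverse (real (Suc M)) < A * d^2 / 8"
      using reals_Archimedean[of "A * d^2 / 8"] d A_pos by auto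
    show "\<exists>M. \<forall>m\<ge>M. \<forall>n\<ge>M. L2norm (\<lambda>x. s m x - s n x) < d"
    proof (intro exI allI impI)
      fix j k assume jk: "j \<ge> M" "k \<ge> M"
      have "inverse (real (Suc j)) \<le> inverse (real (Suc M))" "inverse (real (Suc k)) \<le> inverse (real (Suc M))"
        using jk by (auto intro!: le_imp_inverse_le)
      then have "N (\<lambda>x. s j x - s k x) < A / 2 * d^2" using key[of j k] M by linarith
      then have "A / 2 * (L2norm (\<lambda>x. s j x - s k x))^2 < A / 2 * d^2"
        using H_lower[OF H_diff[OF s(1) s(1)], of j k] by linarith
      then have "(L2norm (\<lambda>x. s j x - s k x))^2 < d^2" using A_pos by simp
      then show "L2norm (\<lambda>x. s j x - s k x) < d" using d by (rule power2_less_imp_less[OF _ less_imp_le])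
    qed
  qed
  then obtain f where f: "L2 f" "(\<lambda>k. L2norm (\<lambda>x. f x - s k x)) \<longlonglongrightarrow> 0" by blast
  have fH: "f \<in> H" by (rule H_closed[OF s(1) f])
  \<comment> \<open>Lower semicontinuity is enough: the finite partial sums of \<open>N\<close> pass
    to the limit, and \<open>N f\<close> is their supremum.\<close>
  have "Q f \<le> m"
  proof -
    have ur: "(\<lambda>k. Re (L2inner u (s k))) \<longlonglongrightarrow> Re (L2inner u f)"
    proof -
      have "(\<lambda>k. Re (cnj (L2inner (s k) u))) \<longlonglongrightarrow> Re (cnj (L2inner f u))"
        by (intro tendsto_intros L2inner_tendsto sL f u)
      then show ?thesis by (simp only: L2inner_cnj)
    qed
    have "(\<Sum>n<j. (cmod (L2inner f (e n)))^2) \<le> m + 0 + 2 * Re (L2inner u f)" for j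
    proof (rule LIMSEQ_le[OF partial_sum_tendsto[OF sL f]])
      show "(\<lambda>k. m + inverse (real (Suc k)) + 2 * Re (L2inner u (s k))) \<longlonglongrightarrow> m + 0 + 2 * Re (L2inner u f)"
        by (intro tendsto_intros ur LIMSEQ_inverse_real_of_nat)
      have "(\<Sum>n<j. (cmod (L2inner (s k) (e n)))^2) \<le> m + inverse (real (Suc k)) + 2 * Re (L2inner u (s k))" for k
      proof -
        have "(\<Sum>n<j. (cmod (L2inner (s k) (e n)))^2) \<le> N (s k)"
          unfolding N_def by (intro sum_le_suminf H_summable s) auto
        with s(2)[of k] show ?thesis unfolding Q_def by linarith
      qed
      then show "\<exists>M. \<forall>k\<ge>M. (\<Sum>n<j. (cmod (L2inner (s k) (e n)))\<^sup>2) \<le> m + inverse (real (Suc k)) + 2 * Re (L2inner u (s k))"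
        by blast
    qed
    then have "N f \<le> m + 0 + 2 * Re (L2inner u f)"
      unfolding N_def by (intro suminf_le_const H_summable fH)
    then show ?thesis by (simp add: Q_def)
  qed
  then have Qmin: "Q f \<le> Q h" if "h \<in> H" for h using m_le[OF that] by linarith
  have re: "Re (a f h) = Re (L2inner u h)" if h: "h \<in> H" for h
  proof -
    define c where "c = Re (a f h) - Re (L2inner u h)"
    have ineq: "0 \<le> 2 * t * c + t^2 * N h" for t
    proof -
      have th: "(\<lambda>x. complex_of_real t * h x) \<in> H" by (intro H_scale h)
      have "Q (\<lambda>x. f x + complex_of_real t * h x) = Q f + 2 * t * c + t^2 * N h"
        unfolding Q_def c_def N_add[OF fH th] a_scale_right[OF fH h] N_scale[OF h]
          L2inner_add_right[OF f(1) H_L2[OF th] u] L2inner_scale_right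
        by (simp add: algebra_simps)
      with Qmin[OF H_add[OF fH th]] show ?thesis by simp
    qed
    have "c = 0"
    proof (rule ccontr)
      assume c: "c \<noteq> 0"
      \<comment> \<open>The natural choice t = -c / N h could divide by 0. With 1 added the
        denominator is positive, and the value c^2 (N h - 2 k) / k^2 is still negative.\<close>
      define k where "k = N h + 1"
      have k: "k > 0" using N_nonneg[OF h] by (simp add: k_def)
      have "0 \<le> 2 * (- c / k) * c + (- c / k)^2 * N h" by (rule ineq)
      also have "\<dots> = c^2 * (N h - 2 * k) / k^2"
        using k by (simp add: field_simps power2_eq_square)
      also have "\<dots> < 0"
        using c k N_nonneg[OF h] by (intro divide_neg_pos mult_pos_neg) (auto simp: k_def)
      finally show False by simp
    qed
    then show ?thesis by (simp add: c_def)
  qed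
  have "a f h = L2inner u h" if h: "h \<in> H" for h
  proof (rule complex_eqI[OF re[OF h]])
    \<comment> \<open>Both sides are conjugate-linear in the second argument, so the real parts at
      \<i> h are the imaginary parts at h.\<close>
    have ih: "(\<lambda>x. \<i> * h x) \<in> H" by (intro H_scale h)
    show "Im (a f h) = Im (L2inner u h)"
      using re[OF ih] by (simp add: a_scale_right[OF fH h] L2inner_scale_right)
  qed
  with fH show ?thesis by blast
qed

text \<open>The error \<open>p\<close> of a finite sum over \<open>F\<close> lies in
  \<open>H\<close>, and testing with \<open>p\<close> itself gives N(p) as the sum of c_n <e_n, p>
  over n outside F. Hence N(p) is at most the sum of |c_n|^2 over those n, which is small as soon as
  \<open>F\<close> contains a long initial segment, whatever else it contains; this is unconditional
  convergence.\<close>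

lemma dual_frame_expansion:
  assumes f: "f \<in> H" and g: "\<And>n. g n \<in> H" and dual: "\<And>n h. h \<in> H \<Longrightarrow> a (g n) h = L2inner (e n) h"
  shows "L2_uncond_sum (\<lambda>n t. L2inner f (e n) * g n t) f"
  unfolding L2_uncond_sum_def
proof (intro allI impI)
  fix d :: real assume d: "d > 0"
  define c where "c n = L2inner f (e n)" for n
  have sc: "summable (\<lambda>n. (cmod (c n))^2)" unfolding c_def by (rule H_summable[OF f])
  \<comment> \<open>The threshold is A/2 times d^2 because the lower bound on \<open>H\<close> holds
    with A/2.\<close>
  obtain M where M: "norm (\<Sum>n. (cmod (c (n + M)))^2) < A / 2 * d^2"
    using suminf_exist_split[OF _ sc, of "A / 2 * d^2"] d A_pos by auto
  show "\<exists>F0. finite F0 \<and> (\<forall>F. finite F \<and> F0 \<subseteq> F \<longrightarrow>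
             L2norm (\<lambda>t. f t - (\<Sum>n\<in>F. L2inner f (e n) * g n t)) < d)"
  proof (intro exI[of _ "{..<M}"] conjI allI impI)
    fix F assume F: "finite F \<and> {..<M} \<subseteq> F"
    define s where "s t = (\<Sum>n\<in>F. c n * g n t)" for t
    define p where "p t = f t - s t" for t
    have sH: "s \<in> H" unfolding s_def by (intro H_sum H_scale g)
    have pH: "p \<in> H" unfolding p_def by (intro H_diff f sH)
    define r where "r n = (if n \<in> F then 0 else c n)" for n
    have as: "a s p = (\<Sum>n\<in>F. c n * L2inner (e n) p)"
    proof -
      have "L2inner s (e m) = (\<Sum>n\<in>F. c n * L2inner (g n) (e m))" for m
        unfolding s_def
        by (subst L2inner_sum_left) (auto simp: L2inner_scale_left intro!: L2_scale[OF H_L2[OF g]] e_L2)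
      then have "(\<lambda>m. L2inner s (e m) * L2inner (e m) p) =
          (\<lambda>m. \<Sum>n\<in>F. c n * (L2inner (g n) (e m) * L2inner (e m) p))"
        by (simp add: sum_distrib_right mult.assoc)
      moreover have "(\<lambda>m. \<Sum>n\<in>F. c n * (L2inner (g n) (e m) * L2inner (e m) p)) sums (\<Sum>n\<in>F. c n * a (g n) p)"
        by (intro sums_sum sums_mult a_sums g pH)
      ultimately show ?thesis
        using a_sums[OF sH pH] by (simp add: dual[OF pH] sums_iff)
    qed
    have "(\<lambda>n. c n * L2inner (e n) p - (if n \<in> F then c n * L2inner (e n) p else 0)) sums (a f p - a s p)"
      unfolding as
      by (intro sums_diff sums_If_finite_set) (use a_sums[OF f pH] F in \<open>auto simp: c_def\<close>)
    moreover have "(\<lambda>n. c n * L2inner (e n) p - (if n \<in> F then c n * L2inner (e n) p else 0)) =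
        (\<lambda>n. r n * L2inner (e n) p)"
      by (auto simp: r_def)
    moreover have "a f p - a s p = complex_of_real (N p)"
      using a_diff_left[OF f sH pH] a_self[OF pH] by (simp add: p_def[abs_def])
    ultimately have rs: "(\<lambda>n. r n * L2inner (e n) p) sums complex_of_real (N p)" by simp
    have sr: "summable (\<lambda>n. (cmod (r n))^2)"
      by (rule summable_comparison_test'[OF sc, of 0]) (auto simp: r_def)
    have sp: "summable (\<lambda>n. (cmod (L2inner p (e n)))^2)" by (rule H_summable[OF pH])
    have tb: "cmod (r n * L2inner (e n) p) \<le> (cmod (r n))^2 / 2 + (cmod (L2inner p (e n)))^2 / 2" for n
      using prod_le_half_squares[of "r n" "L2inner (e n) p"] L2inner_cnj[of p "e n", symmetric] by simp
    have ss: "summable (\<lambda>n. (cmod (r n))^2 / 2 + (cmod (L2inner p (e n)))^2 / 2)"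
      by (intro summable_add summable_divide sr sp)
    have sn: "summable (\<lambda>n. cmod (r n * L2inner (e n) p))"
      by (rule summable_comparison_test'[OF ss]) (use tb in simp)
    have "N p = norm (complex_of_real (N p))" using N_nonneg[OF pH] by simp
    also have "\<dots> = norm (\<Sum>n. r n * L2inner (e n) p)" using rs by (simp add: sums_iff)
    also have "\<dots> \<le> (\<Sum>n. cmod (r n * L2inner (e n) p))" by (rule summable_norm[OF sn])
    also have "\<dots> \<le> (\<Sum>n. (cmod (r n))^2 / 2 + (cmod (L2inner p (e n)))^2 / 2)"
      by (rule suminf_le[OF tb sn ss])
    also have "\<dots> = (\<Sum>n. (cmod (r n))^2) / 2 + N p / 2"
      unfolding N_def by (simp only: suminf_add[symmetric] suminf_divide summable_divide sr sp)
    \<comment> \<open>The term \<open>N p / 2\<close> on the right is absorbed by the left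
      side.\<close>
    finally have Np: "N p \<le> (\<Sum>n. (cmod (r n))^2)" by simp
    also have "\<dots> = (\<Sum>n. (cmod (r (n + M)))^2) + (\<Sum>n<M. (cmod (r n))^2)"
      by (rule suminf_split_initial_segment[OF sr])
    also have "(\<Sum>n<M. (cmod (r n))^2) = 0" using F by (intro sum.neutral) (auto simp: r_def)
    also have "(\<Sum>n. (cmod (r (n + M)))^2) \<le> (\<Sum>n. (cmod (c (n + M)))^2)"
    proof (rule suminf_le)
      show "summable (\<lambda>n. (cmod (r (n + M)))\<^sup>2)" "summable (\<lambda>n. (cmod (c (n + M)))\<^sup>2)"
        by (rule summable_ignore_initial_segment[OF sr], rule summable_ignore_initial_segment[OF sc])
    qed (simp add: r_def)
    finally have "N p < A / 2 * d^2" using M by simp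
    then have "A / 2 * (L2norm p)^2 < A / 2 * d^2" using H_lower[OF pH] by linarith
    then have "(L2norm p)^2 < d^2" using A_pos by simp
    then have "L2norm p < d" using d by (rule power2_less_imp_less[OF _ less_imp_le])
    then show "L2norm (\<lambda>t. f t - (\<Sum>n\<in>F. L2inner f (e n) * g n t)) < d"
      by (simp add: p_def[abs_def] s_def c_def)
  qed simp
qed

end

section \<open>Test functions\<close>

lemma frechet_derivative_eq: "(f has_derivative D) (at x) \<Longrightarrow> frechet_derivative f (at x) = D"
  by (rule frechet_derivative_at[symmetric])

lemma Ck_SucI:
  assumes "\<And>x. (f has_derivative D x) (at x)" "\<And>b. b \<in> Basis \<Longrightarrow> Ck k (\<lambda>x. D x b)"
  shows "Ck (Suc k) f"
proof -
  have "frechet_derivative f (at x) = D x" for x by (rule frechet_derivative_eq[OF assms(1)])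
  with assms show ?thesis by (auto simp: differentiable_def)
qed

lemma Ck_Suc_has_derivative: "Ck (Suc k) f \<Longrightarrow> (f has_derivative frechet_derivative f (at x)) (at x)"
  by (simp add: frechet_derivative_works[symmetric])

lemma Ck_Suc_imp_Ck: "Ck (Suc k) f \<Longrightarrow> Ck k f"
proof (induction k arbitrary: f)
  case 0
  then show ?case
    by (auto intro!: differentiable_imp_continuous_on simp: differentiable_on_def differentiable_at_withinI)
next
  case (Suc k)
  then show ?case by (auto simp del: Ck.simps(1))
qed

lemma Ck_const: "Ck k (\<lambda>x. c)"
proof (induction k arbitrary: c)
  case (Suc k)
  show ?case by (rule Ck_SucI[of _ "\<lambda>x h. 0"]) (auto simp: Suc)
qed simp

lemma Ck_add: "Ck k f \<Longrightarrow> Ck k h \<Longrightarrow> Ck k (\<lambda>x. f x + h x)"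
proof (induction k arbitrary: f h)
  case 0 then show ?case by (auto intro!: continuous_intros)
next
  case (Suc k)
  show ?case
  proof (rule Ck_SucI)
    show "((\<lambda>x. f x + h x) has_derivative
       (\<lambda>t. frechet_derivative f (at x) t + frechet_derivative h (at x) t)) (at x)" for x
      by (intro has_derivative_add Ck_Suc_has_derivative[OF Suc.prems(1)] Ck_Suc_has_derivative[OF Suc.prems(2)])
  qed (use Suc in auto)
qed

lemma Ck_mult: "Ck k f \<Longrightarrow> Ck k h \<Longrightarrow> Ck k (\<lambda>x. f x * h x)"
proof (induction k arbitrary: f h)
  case 0 then show ?case by (auto intro!: continuous_intros)
next
  case (Suc k)
  show ?case
  proof (rule Ck_SucI)
    show "((\<lambda>x. f x * h x) has_derivative
       (\<lambda>t. f x * frechet_derivative h (at x) t + frechet_derivative f (at x) t * h x)) (at x)" for x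
      by (intro has_derivative_mult Ck_Suc_has_derivative[OF Suc.prems(1)] Ck_Suc_has_derivative[OF Suc.prems(2)])
  next
    fix b :: 'a assume b: "b \<in> Basis"
    show "Ck k (\<lambda>x. f x * frechet_derivative h (at x) b + frechet_derivative f (at x) b * h x)"
      using Suc.prems b Ck_Suc_imp_Ck[OF Suc.prems(1)] Ck_Suc_imp_Ck[OF Suc.prems(2)]
      by (intro Ck_add Suc.IH) (auto simp del: Ck.simps(1))
  qed
qed

lemma Ck_prod: "(\<And>i. i \<in> I \<Longrightarrow> Ck k (u i)) \<Longrightarrow> Ck k (\<lambda>x. \<Prod>i\<in>I. u i x)"
proof (induction I rule: infinite_finite_induct)
  case (insert i I)
  then show ?case using Ck_mult[of k "u i" "\<lambda>x. \<Prod>i\<in>I. u i x"] by simp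
qed (auto intro: Ck_const)

lemma Ck_affine: "Ck k f \<Longrightarrow> Ck k (\<lambda>x. f (r *\<^sub>R x + p))"
proof (induction k arbitrary: f)
  case 0 then show ?case
    by (auto intro!: continuous_on_compose2[of UNIV f UNIV "\<lambda>x. r *\<^sub>R x + p"] continuous_intros)
next
  case (Suc k)
  show ?case
  proof (rule Ck_SucI)
    show "((\<lambda>x. f (r *\<^sub>R x + p)) has_derivative
       (\<lambda>t. frechet_derivative f (at (r *\<^sub>R x + p)) (r *\<^sub>R t))) (at x)" for x
    proof -
      have "((\<lambda>x. r *\<^sub>R x + p) has_derivative (\<lambda>t. r *\<^sub>R t)) (at x)"
        by (auto intro!: derivative_eq_intros)
      from has_derivative_compose[OF this Ck_Suc_has_derivative[OF Suc.prems]] show ?thesis .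
    qed
  next
    fix b :: 'a assume b: "b \<in> Basis"
    have "frechet_derivative f (at y) (r *\<^sub>R b) = complex_of_real r * frechet_derivative f (at y) b" for y
      using linear_scale[OF linear_frechet_derivative, of f "at y" r b] Suc.prems
      by (simp add: scaleR_conv_of_real)
    then show "Ck k (\<lambda>x. frechet_derivative f (at (r *\<^sub>R x + p)) (r *\<^sub>R b))"
      using Suc.prems b by (auto intro!: Ck_mult Ck_const Suc.IH)
  qed
qed

lemma Ck_ridge:
  fixes f :: "real \<Rightarrow> complex" and v :: "'a::euclidean_space"
  shows "Ck k f \<Longrightarrow> Ck k (\<lambda>x. f (x \<bullet> v))"
proof (induction k arbitrary: f)
  case 0 then show ?case
    by (auto intro!: continuous_on_compose2[of UNIV f UNIV "\<lambda>x. x \<bullet> v"] continuous_intros)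
next
  case (Suc k)
  show ?case
  proof (rule Ck_SucI)
    show "((\<lambda>x. f (x \<bullet> v)) has_derivative (\<lambda>t. frechet_derivative f (at (x \<bullet> v)) (t \<bullet> v))) (at x)" for x
    proof -
      have "((\<lambda>x. x \<bullet> v) has_derivative (\<lambda>t. t \<bullet> v)) (at x)"
        by (auto intro!: derivative_eq_intros)
      from has_derivative_compose[OF this Ck_Suc_has_derivative[OF Suc.prems]] show ?thesis .
    qed
  next
    fix b :: 'a assume b: "b \<in> Basis"
    have "frechet_derivative f (at y) (b \<bullet> v) = complex_of_real (b \<bullet> v) * frechet_derivative f (at y) 1" for y
      using linear_scale[OF linear_frechet_derivative, of f "at y" "b \<bullet> v" 1] Suc.prems
      by (simp add: scaleR_conv_of_real)
    then show "Ck k (\<lambda>x. frechet_derivative f (at (x \<bullet> v)) (b \<bullet> v))"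
      using Suc.prems by (auto intro!: Ck_mult Ck_const Suc.IH)
  qed
qed

lemma Ck_real_SucI:
  fixes f :: "real \<Rightarrow> complex"
  assumes "\<And>x. (f has_vector_derivative f' x) (at x)" "Ck k f'"
  shows "Ck (Suc k) f"
  by (rule Ck_SucI[of _ "\<lambda>x t. t *\<^sub>R f' x"]) (use assms in \<open>auto simp: has_vector_derivative_def\<close>)

lemma Ck_cis: "Ck k cis"
proof (induction k)
  case (Suc k)
  have "Ck k (\<lambda>x. \<i> * cis x)" by (intro Ck_mult Ck_const Suc)
  moreover have "(cis has_vector_derivative \<i> * cis x) (at x)" for x
    unfolding has_vector_derivative_complex_iff by (auto intro!: derivative_eq_intros)
  ultimately show ?case by (rule Ck_real_SucI[rotated])
qed (auto intro!: continuous_intros)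

lemma Ck_cis_inner:
  fixes v :: "'a::euclidean_space"
  shows "Ck k (\<lambda>x. cis (x \<bullet> v))"
  by (rule Ck_ridge[OF Ck_cis])

section \<open>Smooth cutoffs\<close>

text \<open>\<open>flat 1\<close> is the classical function exp(-1/x) extended by 0. The polynomial
  factors are carried along because they make the family closed under differentiation, so that
  smoothness follows by induction over the whole family.\<close>

definition flat :: "real poly \<Rightarrow> real \<Rightarrow> real" where
  "flat p x = (if x > 0 then poly p (1 / x) * exp (- 1 / x) else 0)"

lemma poly_exp_tendsto_0: "((\<lambda>x. poly p x * exp (- x)) \<longlongrightarrow> 0) at_top" for p :: "real poly"
proof -
  have "((\<lambda>x. \<Sum>i\<le>degree p. coeff p i * (x ^ i / exp x)) \<longlongrightarrow> (\<Sum>i\<le>degree p. coeff p i * 0)) at_top"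
    by (intro tendsto_intros tendsto_power_div_exp_0)
  moreover have "(\<Sum>i\<le>degree p. coeff p i * (x ^ i / exp x)) = poly p x * exp (- x)" for x
    by (simp add: poly_altdef sum_distrib_left exp_minus divide_inverse mult_ac)
  ultimately show ?thesis by simp
qed

text \<open>Away from 0 this is the chain rule for t = 1/x, dt/dx = -t^2, which explains the
  polynomial t^2 (p - p'). At 0 the right difference quotient is t p(t) exp(-t) with t tending to
  infinity.\<close>

lemma flat_deriv:
  "(flat p has_real_derivative flat ([:0, 0, 1:] * (p - pderiv p)) x) (at x)"
proof -
  let ?q = "[:0, 0, 1:] * (p - pderiv p)"
  consider "x > 0" | "x < 0" | "x = 0" by linarith
  then show ?thesis
  proof cases
    case 1
    have "((\<lambda>x. poly p (1 / x) * exp (- 1 / x)) has_real_derivative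
        poly ?q (1 / x) * exp (- 1 / x)) (at x)"
      using 1 by (auto intro!: derivative_eq_intros simp: field_simps power2_eq_square)
    then have "(flat p has_real_derivative poly ?q (1 / x) * exp (- 1 / x)) (at x)"
      by (rule DERIV_cong_ev[THEN iffD1, rotated -1])
        (use 1 eventually_nhds_in_open[of "{0<..}" x] in \<open>auto simp: flat_def elim!: eventually_mono\<close>)
    then show ?thesis using 1 by (simp add: flat_def)
  next
    case 2
    have "((\<lambda>x. 0) has_real_derivative 0) (at x)" by simp
    then have "(flat p has_real_derivative 0) (at x)"
      by (rule DERIV_cong_ev[THEN iffD1, rotated -1])
        (use 2 eventually_nhds_in_open[of "{..<0}" x] in \<open>auto simp: flat_def elim!: eventually_mono\<close>)
    then show ?thesis using 2 by (simp add: flat_def)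
  next
    case 3
    have "((\<lambda>h. (flat p (0 + h) - flat p 0) / h) \<longlongrightarrow> 0) (at 0)"
      unfolding filterlim_at_split
    proof
      show "((\<lambda>h. (flat p (0 + h) - flat p 0) / h) \<longlongrightarrow> 0) (at_left 0)"
        by (rule tendsto_eventually)
          (auto simp: eventually_at_filter flat_def)
      have "((\<lambda>x. poly (p * [:0, 1:]) (inverse x) * exp (- inverse x)) \<longlongrightarrow> 0) (at_right 0)"
        using poly_exp_tendsto_0[of "p * [:0, 1:]"] unfolding filterlim_at_top_to_right .
      moreover have "\<forall>\<^sub>F x in at_right 0. poly (p * [:0, 1:]) (inverse x) * exp (- inverse x) =
          (flat p (0 + x) - flat p 0) / x"
        by (auto simp: eventually_at_filter flat_def field_simps)
      ultimately show "((\<lambda>h. (flat p (0 + h) - flat p 0) / h) \<longlongrightarrow> 0) (at_right 0)"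
        by (rule Lim_transform_eventually)
    qed
    then have "(flat p has_real_derivative 0) (at 0)" by (simp add: DERIV_def)
    with 3 show ?thesis by (simp add: flat_def)
  qed
qed

lemma Ck_flat: "Ck k (\<lambda>x. complex_of_real (flat p x))"
proof (induction k arbitrary: p)
  case 0
  have "continuous_on UNIV (flat p)"
    using flat_deriv by (intro continuous_at_imp_continuous_on ballI DERIV_isCont)
  then show ?case by (auto intro!: continuous_intros)
next
  case (Suc k)
  show ?case
    by (rule Ck_real_SucI[OF _ Suc.IH])
      (use flat_deriv has_real_derivative_iff_has_vector_derivative has_vector_derivative_of_real in blast)
qed

definition bump0 :: "real \<Rightarrow> real" where
  "bump0 x = flat 1 (x + 1) * flat 1 (1 - x)"

lemma bump0_pos: "\<bar>x\<bar> < 1 \<Longrightarrow> bump0 x > 0"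
  and bump0_zero: "1 \<le> \<bar>x\<bar> \<Longrightarrow> bump0 x = 0"
  and bump0_nonneg: "0 \<le> bump0 x"
  by (auto simp: bump0_def flat_def)

lemma Ck_bump0: "Ck k (\<lambda>x. complex_of_real (bump0 x))"
proof -
  have "Ck k (\<lambda>x. complex_of_real (flat 1 (1 *\<^sub>R x + 1)) * complex_of_real (flat 1 ((-1) *\<^sub>R x + 1)))"
    by (intro Ck_mult Ck_affine[OF Ck_flat])
  then show ?thesis by (simp add: bump0_def add.commute)
qed

lemma continuous_bump0: "continuous_on A bump0"
proof -
  have "continuous_on UNIV (\<lambda>x. Re (complex_of_real (bump0 x)))"
    using Ck_bump0[of 0] by (intro continuous_intros) simp
  then show ?thesis using continuous_on_subset[OF _ subset_UNIV] by simp
qed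

text \<open>The lower limit -2 lies strictly left of the support of \<open>bump0\<close>. The two
  cases x > -2, where the integral is differentiated, and x \<le> -2, where the function is locally
  0, then never meet an endpoint of the support.\<close>

definition step0 :: "real \<Rightarrow> real" where
  "step0 x = integral {-2..x} bump0"

lemma step0_eq_0: "x \<le> -1 \<Longrightarrow> step0 x = 0"
  unfolding step0_def
  using integral_cong[of "{-2..x}" bump0 "\<lambda>_. 0"] by (simp add: bump0_zero)

lemma step0_deriv: "(step0 has_real_derivative bump0 x) (at x)"
proof (cases "x > -2")
  case True
  have "((\<lambda>u. integral {-2..u} bump0) has_vector_derivative bump0 x) (at x within {-2..x+1})"
    by (rule integral_has_vector_derivative[OF continuous_bump0]) (use True in auto)
  moreover have "at x within {-2..x+1} = at x"
    by (rule at_within_interior) (use True in auto)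
  ultimately show ?thesis
    by (simp add: has_real_derivative_iff_has_vector_derivative step0_def[abs_def])
next
  case False
  have "((\<lambda>x. 0) has_real_derivative 0) (at x)" by simp
  then have "(step0 has_real_derivative 0) (at x)"
    by (rule DERIV_cong_ev[THEN iffD1, rotated -1])
      (use False eventually_nhds_in_open[of "{..<-1}" x] in \<open>auto simp: step0_eq_0 elim!: eventually_mono\<close>)
  then show ?thesis using False by (simp add: bump0_zero)
qed

lemma step0_mono: "x \<le> y \<Longrightarrow> step0 x \<le> step0 y"
  by (rule DERIV_nonneg_imp_nondecreasing) (use step0_deriv bump0_nonneg in blast)+

lemma step0_nonneg: "0 \<le> step0 x"
  using step0_mono[of "-1" x] step0_eq_0[of "-1"] step0_eq_0[of x] by (cases "x \<le> -1") auto

lemma step0_1_pos: "0 < step0 1"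
proof -
  have "step0 (-1) < step0 1"
  proof (rule DERIV_pos_imp_increasing_open[of "-1" 1 step0])
    show "\<exists>y. (step0 has_real_derivative y) (at x) \<and> y > 0" if "-1 < x" "x < 1" for x
      using that step0_deriv[of x] bump0_pos[of x] by (intro exI[of _ "bump0 x"]) auto
    show "continuous_on {-1..1} step0"
      using step0_deriv by (intro continuous_at_imp_continuous_on ballI DERIV_isCont)
  qed simp
  then show ?thesis by (simp add: step0_eq_0)
qed

lemma step0_eq_1: "1 \<le> x \<Longrightarrow> step0 x = step0 1"
proof (rule antisym[OF _ step0_mono])
  assume x: "1 \<le> x"
  show "step0 x \<le> step0 1"
  proof (rule DERIV_nonpos_imp_nonincreasing[of 1 x step0, OF x])
    show "\<exists>D. DERIV step0 y :> D \<and> D \<le> 0" if "1 \<le> y" "y \<le> x" for y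
      using step0_deriv[of y] bump0_zero[of y] that by (intro exI[of _ "bump0 y"]) auto
  qed
qed

lemma Ck_step0: "Ck k (\<lambda>x. complex_of_real (step0 x))"
proof -
  have "Ck (Suc k) (\<lambda>x. complex_of_real (step0 x))"
    by (rule Ck_real_SucI[OF _ Ck_bump0])
      (use step0_deriv has_real_derivative_iff_has_vector_derivative has_vector_derivative_of_real in blast)
  then show ?thesis by (rule Ck_Suc_imp_Ck)
qed

definition bump1 :: "real \<Rightarrow> real" where
  "bump1 x = (step0 (x + 3) / step0 1) * (step0 (3 - x) / step0 1)"

lemma bump1_nonneg: "0 \<le> bump1 x"
  by (simp add: bump1_def step0_nonneg)

lemma bump1_le_1: "bump1 x \<le> 1"
proof -
  have "step0 y \<le> step0 1" for y
    using step0_mono[of y 1] step0_eq_1[of y] by (cases "y \<le> 1") auto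
  then show ?thesis
    unfolding bump1_def using step0_1_pos
    by (intro mult_le_one) (auto simp: step0_nonneg)
qed

lemma bump1_eq_1: "\<bar>x\<bar> \<le> 2 \<Longrightarrow> bump1 x = 1"
  using step0_eq_1[of "x + 3"] step0_eq_1[of "3 - x"] step0_1_pos by (simp add: bump1_def)

lemma bump1_eq_0: "4 \<le> \<bar>x\<bar> \<Longrightarrow> bump1 x = 0"
  using step0_eq_0[of "x + 3"] step0_eq_0[of "3 - x"] by (cases "x \<ge> 0") (auto simp: bump1_def)

lemma Ck_bump1: "Ck k (\<lambda>x. complex_of_real (bump1 x))"
proof -
  have "Ck k (\<lambda>x. inverse (of_real (step0 1)) ^ 2 *
      (complex_of_real (step0 (1 *\<^sub>R x + 3)) * complex_of_real (step0 ((-1) *\<^sub>R x + 3))))"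
    by (intro Ck_mult Ck_const Ck_affine[OF Ck_step0])
  moreover have "(\<lambda>x. inverse (of_real (step0 1)) ^ 2 *
      (complex_of_real (step0 (1 *\<^sub>R x + 3)) * complex_of_real (step0 ((-1) *\<^sub>R x + 3)))) =
      (\<lambda>x. complex_of_real (bump1 x))"
    by (auto simp: bump1_def field_simps power2_eq_square)
  ultimately show ?thesis by simp
qed

text \<open>The plateau is the cube of half-width 2R, the support lies in the one of half-width 4R.
  Thus \<open>bump R\<close> is 1 near a cube of half-width R, and a bump of scale at least 2R is 1
  on the whole support of \<open>bump R\<close>; the reproducing formula uses both margins.\<close>

definition bump :: "real \<Rightarrow> 'a::euclidean_space \<Rightarrow> real" where
  "bump R x = (\<Prod>b\<in>Basis. bump1 (x \<bullet> b / R))"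

lemma bump_nonneg: "0 \<le> bump R x"
  by (simp add: bump_def prod_nonneg bump1_nonneg)

lemma bump_le_1: "bump R x \<le> 1"
  unfolding bump_def by (intro prod_le_1) (auto simp: bump1_nonneg bump1_le_1)

lemma bump_eq_1: "(\<And>b. b \<in> Basis \<Longrightarrow> \<bar>x \<bullet> b\<bar> \<le> 2 * R) \<Longrightarrow> R > 0 \<Longrightarrow> bump R x = 1"
  unfolding bump_def by (intro prod.neutral ballI bump1_eq_1) (simp add: divide_le_eq)

lemma bump_neq_0D:
  assumes "bump R x \<noteq> 0" "b \<in> Basis" "R > 0"
  shows "\<bar>x \<bullet> b\<bar> < 4 * R"
proof (rule ccontr)
  assume "\<not> \<bar>x \<bullet> b\<bar> < 4 * R"
  then have "bump1 (x \<bullet> b / R) = 0" using assms by (intro bump1_eq_0) (simp add: le_divide_eq)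
  then have "bump R x = 0" using assms(2) by (auto simp: bump_def)
  with assms show False by simp
qed

lemma bump_scale: "bump (c * R) x = bump R (x /\<^sub>R c)"
  by (simp add: bump_def field_simps)

lemma Ck_bump: "Ck k (\<lambda>x. complex_of_real (bump R x))"
proof -
  have "Ck k (\<lambda>x. \<Prod>b\<in>Basis. complex_of_real (bump1 (x \<bullet> (b /\<^sub>R R))))"
    by (intro Ck_prod Ck_ridge Ck_bump1)
  then show ?thesis by (simp add: bump_def field_simps)
qed

lemma bounded_coords:
  assumes "\<And>x b. x \<in> S \<Longrightarrow> b \<in> Basis \<Longrightarrow> \<bar>x \<bullet> b\<bar> \<le> c"
  shows "bounded S"
proof (rule boundedI)
  fix x assume "x \<in> S"
  then show "norm x \<le> (\<Sum>b\<in>(Basis::'a::euclidean_space set). c)"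
    using norm_le_l1[of x] assms by (intro order_trans[OF norm_le_l1] sum_mono) auto
qed

section \<open>Closure properties of test functions\<close>

lemma test_function_iff: "test_function \<phi> \<longleftrightarrow> (\<forall>k. Ck k \<phi>) \<and> bounded {x. \<phi> x \<noteq> 0}"
  by (simp add: test_function_def smooth_fun_def tsupport_def compact_closure)

lemma test_function_bump:
  assumes "R > 0"
  shows "test_function (\<lambda>x. complex_of_real (bump R x))"
  unfolding test_function_iff
proof (intro conjI allI Ck_bump)
  show "bounded {x::'a. complex_of_real (bump R x) \<noteq> 0}"
    using bump_neq_0D[OF _ _ assms] by (intro bounded_coords[of _ "4 * R"]) (auto intro: less_imp_le)
qed

lemma test_function_mult_left:
  assumes "test_function \<phi>" "\<And>k. Ck k h"
  shows "test_function (\<lambda>x. h x * \<phi> x)"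
  unfolding test_function_iff
proof (intro conjI allI)
  show "Ck k (\<lambda>x. h x * \<phi> x)" for k
    by (rule Ck_mult[OF assms(2)]) (use assms(1) in \<open>simp only: test_function_iff\<close>)
  show "bounded {x. h x * \<phi> x \<noteq> 0}"
    by (rule bounded_subset[of "{x. \<phi> x \<noteq> 0}"]) (use assms(1) in \<open>auto simp: test_function_iff\<close>)
qed

lemma test_function_add:
  assumes "test_function \<phi>" "test_function \<psi>"
  shows "test_function (\<lambda>x. \<phi> x + \<psi> x)"
  unfolding test_function_iff
proof (intro conjI allI)
  show "Ck k (\<lambda>x. \<phi> x + \<psi> x)" for k
    by (rule Ck_add) (use assms in \<open>simp_all only: test_function_iff\<close>)
  show "bounded {x. \<phi> x + \<psi> x \<noteq> 0}"
    by (rule bounded_subset[of "{x. \<phi> x \<noteq> 0} \<union> {x. \<psi> x \<noteq> 0}"])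
      (use assms in \<open>simp_all only: test_function_iff bounded_Un, auto\<close>)
qed

lemma test_function_cmult: "test_function \<phi> \<Longrightarrow> test_function (\<lambda>x. c * \<phi> x)"
  by (rule test_function_mult_left[OF _ Ck_const])

lemma in_tsupport: "\<phi> x \<noteq> 0 \<Longrightarrow> x \<in> tsupport \<phi>"
  unfolding tsupport_def by (rule subsetD[OF closure_subset]) simp

lemma tsupport_subset: "closed S \<Longrightarrow> (\<And>x. \<phi> x \<noteq> 0 \<Longrightarrow> x \<in> S) \<Longrightarrow> tsupport \<phi> \<subseteq> S"
  unfolding tsupport_def by (rule closure_minimal) auto

lemma test_function_affine:
  assumes "test_function \<phi>" "r \<noteq> 0"
  shows "test_function (\<lambda>x. \<phi> (r *\<^sub>R x + p))"
  unfolding test_function_iff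
proof (intro conjI allI)
  show "Ck k (\<lambda>x. \<phi> (r *\<^sub>R x + p))" for k
    using assms by (intro Ck_affine) (auto simp: test_function_iff)
  have "{x. \<phi> (r *\<^sub>R x + p) \<noteq> 0} = (\<lambda>y. (y - p) /\<^sub>R r) ` {x. \<phi> x \<noteq> 0}"
  proof (intro equalityI subsetI)
    fix x assume "x \<in> {x. \<phi> (r *\<^sub>R x + p) \<noteq> 0}"
    then show "x \<in> (\<lambda>y. (y - p) /\<^sub>R r) ` {x. \<phi> x \<noteq> 0}"
      using assms(2) by (intro image_eqI[of _ _ "r *\<^sub>R x + p"]) auto
  qed (use assms(2) in auto)
  also have "bounded \<dots>"
  proof -
    have "bounded ((\<lambda>y. (1 / r) *\<^sub>R (y - p)) ` {x. \<phi> x \<noteq> 0})"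
      using assms(1) unfolding test_function_iff
      by (subst image_image[of "\<lambda>y. (1/r) *\<^sub>R y" "\<lambda>y. y - p", symmetric])
        (auto intro!: bounded_scaling bounded_translation_minus)
    then show ?thesis by (simp add: divide_inverse)
  qed
  finally show "bounded {x. \<phi> (r *\<^sub>R x + p) \<noteq> 0}" .
qed

lemma test_function_pderiv:
  assumes "test_function \<phi>" "b \<in> Basis"
  shows "test_function (\<lambda>x. frechet_derivative \<phi> (at x) b)"
  unfolding test_function_iff
proof (intro conjI allI)
  show "Ck k (\<lambda>x. frechet_derivative \<phi> (at x) b)" for k
    using assms Ck.simps(2)[of k \<phi>] by (auto simp: test_function_iff simp del: Ck.simps)
  have "frechet_derivative \<phi> (at x) b = 0" if "x \<notin> tsupport \<phi>" for x
  proof -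
    have "(\<phi> has_derivative (\<lambda>t. 0)) (at x)"
    proof (rule has_derivative_transform_within_open[of "\<lambda>x. 0" _ _ UNIV "- tsupport \<phi>"])
      show "open (- tsupport \<phi>)" by (simp add: tsupport_def open_Compl)
    qed (use that in_tsupport[of \<phi>] in auto)
    then show ?thesis by (simp add: frechet_derivative_eq)
  qed
  then have "{x. frechet_derivative \<phi> (at x) b \<noteq> 0} \<subseteq> tsupport \<phi>" by auto
  moreover have "bounded (tsupport \<phi>)"
    using assms by (simp add: test_function_def compact_imp_bounded)
  ultimately show "bounded {x. frechet_derivative \<phi> (at x) b \<noteq> 0}" by (rule bounded_subset[rotated])
qed

lemma test_function_has_derivative:
  "test_function \<phi> \<Longrightarrow> (\<phi> has_derivative frechet_derivative \<phi> (at x)) (at x)"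
  by (rule Ck_Suc_has_derivative[of 0]) (simp add: test_function_iff del: Ck.simps)

lemma test_function_continuous: "test_function \<phi> \<Longrightarrow> continuous_on A \<phi>"
  using Ck.simps(1)[of \<phi>] by (auto simp: test_function_iff simp del: Ck.simps intro: continuous_on_subset)

lemma test_function_bounded:
  assumes "test_function \<phi>"
  obtains C where "\<And>x. cmod (\<phi> x) \<le> C"
proof -
  have "compact (\<phi> ` tsupport \<phi>)"
    using assms by (intro compact_continuous_image test_function_continuous) (auto simp: test_function_def)
  then obtain C where C: "\<And>x. x \<in> tsupport \<phi> \<Longrightarrow> cmod (\<phi> x) \<le> C"
    using compact_imp_bounded bounded_iff by (metis imageI)
  have "cmod (\<phi> x) \<le> max C 0" for x
    using C[of x] in_tsupport[of \<phi> x] by (cases "\<phi> x = 0") auto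
  then show ?thesis by (rule that)
qed

lemma test_function_integrable:
  assumes "test_function \<phi>"
  shows "integrable lborel \<phi>"
proof -
  have "integrable lborel (\<lambda>x. indicator (tsupport \<phi>) x *\<^sub>R \<phi> x)"
    using assms by (intro borel_integrable_compact test_function_continuous) (auto simp: test_function_def)
  moreover have "indicator (tsupport \<phi>) x *\<^sub>R \<phi> x = \<phi> x" for x
    using in_tsupport[of \<phi> x] by (cases "\<phi> x = 0") auto
  ultimately show ?thesis by simp
qed

section \<open>Fourier transforms of test functions\<close>

lemma continuous_on_integral_dominated:
  fixes f :: "'b::{metric_space,second_countable_topology} \<Rightarrow> 'c \<Rightarrow> 'd::{banach,second_countable_topology}"
  assumes "\<And>y. f y \<in> borel_measurable M" "integrable M w"
    and "\<And>x y. x \<in> space M \<Longrightarrow> norm (f y x) \<le> w x"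
    and "\<And>x. x \<in> space M \<Longrightarrow> continuous_on UNIV (\<lambda>y. f y x)"
  shows "continuous_on UNIV (\<lambda>y. \<integral>x. f y x \<partial>M)"
proof (rule continuous_at_imp_continuous_on, intro ballI)
  fix y
  show "isCont (\<lambda>y. \<integral>x. f y x \<partial>M) y"
    unfolding continuous_at_sequentially
  proof (intro allI impI)
    fix s assume s: "s \<longlonglongrightarrow> y"
    have "(\<lambda>i. \<integral>x. f (s i) x \<partial>M) \<longlonglongrightarrow> (\<integral>x. f y x \<partial>M)"
    proof (rule integral_dominated_convergence)
      show "AE x in M. (\<lambda>i. f (s i) x) \<longlonglongrightarrow> f y x"
        by (intro AE_I2 continuous_on_tendsto_compose[OF assms(4) s]) auto
    qed (use assms in auto)
    then show "((\<lambda>y. \<integral>x. f y x \<partial>M) \<circ> s) \<longlonglongrightarrow> (\<integral>x. f y x \<partial>M)" by (simp add: o_def)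
  qed
qed

section \<open>Affine changes of variable and integrals of products\<close>

lemma nn_integral_lborel_affine:
  fixes f :: "'a::euclidean_space \<Rightarrow> ennreal"
  assumes [measurable]: "f \<in> borel_measurable borel" and c: "c \<noteq> 0"
  shows "(\<integral>\<^sup>+x. f x \<partial>lborel) = ennreal (\<bar>c\<bar> ^ DIM('a)) * (\<integral>\<^sup>+x. f (t + c *\<^sub>R x) \<partial>lborel)"
  by (subst lborel_affine[OF c, of t])
     (simp add: nn_integral_density nn_integral_distr nn_integral_cmult ennreal_power)

lemma integrable_lborel_affine:
  fixes f :: "'a::euclidean_space \<Rightarrow> 'b :: {banach, second_countable_topology}"
  assumes f: "integrable lborel f" and c: "c \<noteq> 0"
  shows "integrable lborel (\<lambda>x. f (t + c *\<^sub>R x))"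
  using f f[THEN borel_measurable_integrable] c unfolding integrable_iff_bounded
  by (subst (asm) nn_integral_lborel_affine[where c=c and t=t]) (auto simp: ennreal_mult_less_top)

lemma integrable_lborel_affine_iff:
  fixes f :: "'a::euclidean_space \<Rightarrow> 'b :: {banach, second_countable_topology}"
  assumes c: "c \<noteq> 0"
  shows "integrable lborel (\<lambda>x. f (t + c *\<^sub>R x)) \<longleftrightarrow> integrable lborel f"
proof
  assume "integrable lborel (\<lambda>x. f (t + c *\<^sub>R x))"
  from integrable_lborel_affine[OF this, of "1 / c" "- (1 / c) *\<^sub>R t"] c
  show "integrable lborel f" by (simp add: algebra_simps)
qed (rule integrable_lborel_affine[OF _ c])

lemma integral_lborel_affine:
  fixes f :: "'a::euclidean_space \<Rightarrow> 'b :: {banach, second_countable_topology}"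
  assumes c: "c \<noteq> 0"
  shows "(\<integral>x. f x \<partial>lborel) = \<bar>c\<bar> ^ DIM('a) *\<^sub>R (\<integral>x. f (t + c *\<^sub>R x) \<partial>lborel)"
proof (cases "integrable lborel f")
  case True
  then have [measurable]: "f \<in> borel_measurable borel"
    using borel_measurable_integrable by fastforce
  show ?thesis
    by (subst lborel_affine[OF c, of t]) (simp add: integral_density integral_distr)
next
  case False
  with c show ?thesis
    by (simp add: integrable_lborel_affine_iff not_integrable_integral_eq)
qed

lemma integral_lborel_translate:
  fixes f :: "'a::euclidean_space \<Rightarrow> 'b :: {banach, second_countable_topology}"
  shows "(\<integral>x. f (x + t) \<partial>lborel) = (\<integral>x. f x \<partial>lborel)"
  using integral_lborel_affine[of 1 f t] by (simp add: add.commute)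

lemma integrable_lborel_translate:
  fixes f :: "'a::euclidean_space \<Rightarrow> 'b :: {banach, second_countable_topology}"
  shows "integrable lborel (\<lambda>x. f (x + t)) \<longleftrightarrow> integrable lborel f"
  using integrable_lborel_affine_iff[of 1 f t] by (simp add: add.commute)

lemma nn_integral_lborel_translate:
  fixes f :: "'a::euclidean_space \<Rightarrow> ennreal"
  assumes "f \<in> borel_measurable borel"
  shows "(\<integral>\<^sup>+x. f (x + t) \<partial>lborel) = (\<integral>\<^sup>+x. f x \<partial>lborel)"
  using nn_integral_lborel_affine[OF assms, of 1 t] by (simp add: add.commute)

lemma nn_integral_lborel_reflect:
  fixes f :: "'a::euclidean_space \<Rightarrow> ennreal"
  assumes "f \<in> borel_measurable borel"
  shows "(\<integral>\<^sup>+x. f (t - x) \<partial>lborel) = (\<integral>\<^sup>+x. f x \<partial>lborel)"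
  using nn_integral_lborel_affine[OF assms, of "-1" t] by simp

context
begin

interpretation product_sigma_finite "\<lambda>_::'a::euclidean_space. lborel :: real measure" ..

lemma integrable_lborel_prod:
  fixes f :: "'a::euclidean_space \<Rightarrow> real \<Rightarrow> 'b::{real_normed_field,banach,second_countable_topology}"
  assumes f: "\<And>b. b \<in> Basis \<Longrightarrow> integrable lborel (f b)"
  shows "integrable lborel (\<lambda>x::'a. \<Prod>b\<in>Basis. f b (x \<bullet> b))"
    and "(\<integral>x. (\<Prod>b\<in>Basis. f b (x \<bullet> b)) \<partial>(lborel :: 'a measure)) = (\<Prod>b\<in>Basis. \<integral>t. f b t \<partial>lborel)"
proof -
  have [measurable]: "f b \<in> borel_measurable borel" if "b \<in> Basis" for b
    using borel_measurable_integrable[OF f[OF that]] by simp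
  have [measurable]: "(\<lambda>x::'a. \<Prod>b\<in>Basis. f b (x \<bullet> b)) \<in> borel_measurable borel"
    by measurable
  have eq: "(\<Prod>b\<in>Basis. f b ((\<Sum>b'\<in>Basis. y b' *\<^sub>R b') \<bullet> b)) = (\<Prod>b\<in>Basis. f b (y b))" for y
    by (intro prod.cong refl) (simp add: inner_sum_left_Basis)
  show "integrable lborel (\<lambda>x::'a. \<Prod>b\<in>Basis. f b (x \<bullet> b))"
    by (subst lborel_eq, subst integrable_distr_eq)
      (simp_all add: eq product_integrable_prod f)
  show "(\<integral>x. (\<Prod>b\<in>Basis. f b (x \<bullet> b)) \<partial>(lborel :: 'a measure)) = (\<Prod>b\<in>Basis. \<integral>t. f b t \<partial>lborel)"
    by (subst lborel_eq, subst integral_distr)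
      (simp_all add: eq product_integral_prod f)
qed

end

text \<open>An integrable majorant for transforms of test functions. The inverse of 1 + |x|^2 fails
  to be integrable from dimension 2 on; one factor per coordinate makes the integral a product, and
  matches one operator 1 - d_b^2 per coordinate in the decay estimate.\<close>

definition weight :: "'a::euclidean_space \<Rightarrow> real" where
  "weight x = (\<Prod>b\<in>Basis. inverse (1 + (x \<bullet> b)^2))"

lemma weight_eq: "weight x = inverse (\<Prod>b\<in>Basis. 1 + (x \<bullet> b)^2)"
  using prod_inversef[of "\<lambda>b. 1 + (x \<bullet> b)^2" Basis] by (simp add: weight_def o_def)

lemma weight_pos: "0 < weight x"
  unfolding weight_def by (intro prod_pos) (auto intro: add_pos_nonneg)

lemma weight_nonneg: "0 \<le> weight x"
  using weight_pos[of x] by simp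

lemma integrable_weight: "integrable lborel weight"
proof -
  have "integrable lborel (\<lambda>x::real. inverse (1 + x^2))"
    using integrable_inverse_1_plus_square by (simp add: set_integrable_def)
  then show ?thesis
    unfolding weight_def by (intro integrable_lborel_prod(1))
qed

lemma continuous_weight: "continuous_on A weight"
proof -
  have "1 + (x::real)^2 \<noteq> 0" for x by (smt (verit) zero_le_power2)
  then show ?thesis unfolding weight_def by (auto intro!: continuous_intros)
qed

lemma weight_measurable [measurable]: "weight \<in> borel_measurable borel"
  using continuous_weight by (rule borel_measurable_continuous_onI)

text \<open>Multiplying out the product leaves 1 plus the sum of the squares, all further terms
  being nonnegative.\<close>

lemma weight_le: "weight x \<le> inverse (1 + (norm x)^2)"
proof -
  have "1 + (\<Sum>b\<in>B. (x \<bullet> b)^2) \<le> (\<Prod>b\<in>B. 1 + (x \<bullet> b)^2)" if "finite B" for B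
    using that
  proof induction
    case (insert b B)
    have "1 + (\<Sum>b\<in>insert b B. (x \<bullet> b)^2) = (1 + (\<Sum>b\<in>B. (x \<bullet> b)^2)) + (x \<bullet> b)^2 * 1"
      using insert by simp
    also have "\<dots> \<le> (1 + (\<Sum>b\<in>B. (x \<bullet> b)^2)) + (x \<bullet> b)^2 * (1 + (\<Sum>b\<in>B. (x \<bullet> b)^2))"
      by (intro add_left_mono mult_left_mono) (auto intro: sum_nonneg)
    also have "\<dots> = (1 + (x \<bullet> b)^2) * (1 + (\<Sum>b\<in>B. (x \<bullet> b)^2))" by (simp add: algebra_simps)
    also have "\<dots> \<le> (1 + (x \<bullet> b)^2) * (\<Prod>b\<in>B. 1 + (x \<bullet> b)^2)"
      using insert by (intro mult_left_mono) auto
    finally show ?case using insert by simp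
  qed simp
  from this[of Basis] have "1 + (norm x)^2 \<le> (\<Prod>b\<in>Basis. 1 + (x \<bullet> b)^2)"
    unfolding power2_norm_eq_inner euclidean_inner[of x x] by (simp add: power2_eq_square)
  then have "inverse (\<Prod>b\<in>Basis. 1 + (x \<bullet> b)^2) \<le> inverse (1 + (norm x)^2)"
    by (intro le_imp_inverse_le) (auto intro: add_pos_nonneg)
  then show ?thesis by (simp add: weight_eq)
qed

text \<open>In each coordinate, 1 + x^2 \<le> 1 + 2 (x + t)^2 + 2 t^2 \<le> 3 (1 + (x + t)^2) since
  |t| \<le> 1.\<close>

lemma weight_shift:
  fixes x t :: "'a::euclidean_space"
  assumes "norm t \<le> 1"
  shows "weight (x + t) \<le> 3 ^ DIM('a) * weight x"
proof -
  have "inverse (1 + ((x + t) \<bullet> b)^2) \<le> 3 * inverse (1 + (x \<bullet> b)^2)" if "b \<in> Basis" for b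
  proof -
    have "\<bar>t \<bullet> b\<bar> \<le> 1" using Basis_le_norm[OF that, of t] assms by linarith
    then have t: "(t \<bullet> b)^2 \<le> 1" by (simp add: abs_square_le_1)
    have "(x \<bullet> b)^2 \<le> 2 * ((x + t) \<bullet> b)^2 + 2 * (t \<bullet> b)^2"
      using norm_add_sq_le[of "(x + t) \<bullet> b" "- (t \<bullet> b)"] by (simp add: inner_add_left)
    with t have "1 + (x \<bullet> b)^2 \<le> 3 * (1 + ((x + t) \<bullet> b)^2)" by (smt (verit) zero_le_power2)
    moreover have "1 + (x \<bullet> b)^2 > 0" "1 + ((x + t) \<bullet> b)^2 > 0" by (auto intro: add_pos_nonneg)
    ultimately show ?thesis by (simp add: field_simps)
  qed
  then have "weight (x + t) \<le> (\<Prod>b\<in>(Basis::'a set). 3 * inverse (1 + (x \<bullet> b)^2))"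
    unfolding weight_def by (intro prod_mono) auto
  then show ?thesis by (simp add: weight_def prod.distrib)
qed

section \<open>Rules for the Fourier transform\<close>

lemma borel_measurable_test: "test_function \<phi> \<Longrightarrow> \<phi> \<in> borel_measurable borel"
  by (intro borel_measurable_continuous_onI test_function_continuous)

lemma fourier_lborel:
  assumes [measurable]: "f \<in> borel_measurable borel"
  shows "fourier f \<gamma> = (\<integral>x. f x * cis (- 2 * pi * (x \<bullet> \<gamma>)) \<partial>lborel)"
proof -
  have "(\<lambda>x. cis (- 2 * pi * (x \<bullet> \<gamma>))) \<in> borel_measurable borel"
    by (intro borel_measurable_continuous_onI continuous_intros)
  then have "(\<lambda>x. f x * cis (- 2 * pi * (x \<bullet> \<gamma>))) \<in> borel_measurable lborel" by measurable
  then show ?thesis unfolding fourier_def by (rule integral_completion)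
qed

lemma cis_measurable [measurable]: "cis \<in> borel_measurable borel"
  by (intro borel_measurable_continuous_onI continuous_intros)

lemma integrable_cis:
  assumes "integrable lborel f" "h \<in> borel_measurable lborel"
  shows "integrable lborel (\<lambda>x. f x * cis (h x))"
  by (rule Bochner_Integration.integrable_bound[OF assms(1)])
    (use assms in \<open>auto simp: norm_mult intro!: measurable_compose[OF _ cis_measurable]\<close>)

lemma norm_fourier_le:
  assumes "integrable lborel f"
  shows "cmod (fourier f \<gamma>) \<le> (\<integral>x. cmod (f x) \<partial>lborel)"
proof -
  have "f \<in> borel_measurable borel" using borel_measurable_integrable[OF assms] by simp
  then have "cmod (fourier f \<gamma>) \<le> (\<integral>x. norm (f x * cis (- 2 * pi * (x \<bullet> \<gamma>))) \<partial>lborel)"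
    by (subst fourier_lborel) (auto intro: integral_norm_bound)
  then show ?thesis by (simp add: norm_mult)
qed

lemma continuous_fourier:
  assumes "integrable lborel f"
  shows "continuous_on UNIV (fourier f)"
proof -
  have [measurable]: "f \<in> borel_measurable borel" using borel_measurable_integrable[OF assms] by simp
  have "continuous_on UNIV (\<lambda>\<gamma>. \<integral>x. f x * cis (- 2 * pi * (x \<bullet> \<gamma>)) \<partial>lborel)"
  proof (rule continuous_on_integral_dominated[of _ _ "\<lambda>x. cmod (f x)"])
    show "integrable lborel (\<lambda>x. cmod (f x))" using assms by simp
  qed (auto simp: norm_mult intro!: continuous_intros)
  moreover have "fourier f = (\<lambda>\<gamma>. \<integral>x. f x * cis (- 2 * pi * (x \<bullet> \<gamma>)) \<partial>lborel)"
    by (intro ext fourier_lborel) measurable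
  ultimately show ?thesis by simp
qed

lemma fourier_measurable: "integrable lborel f \<Longrightarrow> fourier f \<in> borel_measurable borel"
  by (intro borel_measurable_continuous_onI continuous_fourier)

lemma fourier_translate:
  assumes f: "f \<in> borel_measurable borel"
  shows "fourier (\<lambda>x. f (x + p)) \<gamma> = cis (2 * pi * (p \<bullet> \<gamma>)) * fourier f \<gamma>"
proof -
  have [measurable]: "f \<in> borel_measurable borel" by fact
  have "fourier (\<lambda>x. f (x + p)) \<gamma> = (\<integral>x. f (x + p) * cis (- 2 * pi * (x \<bullet> \<gamma>)) \<partial>lborel)"
    by (rule fourier_lborel) measurable
  also have "\<dots> = (\<integral>x. cis (2 * pi * (p \<bullet> \<gamma>)) * (f (x + p) * cis (- 2 * pi * ((x + p) \<bullet> \<gamma>))) \<partial>lborel)"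
    by (rule Bochner_Integration.integral_cong) (auto simp: cis_mult inner_add_left algebra_simps)
  also have "\<dots> = cis (2 * pi * (p \<bullet> \<gamma>)) * (\<integral>x. f (x + p) * cis (- 2 * pi * ((x + p) \<bullet> \<gamma>)) \<partial>lborel)"
    by simp
  also have "(\<integral>x. f (x + p) * cis (- 2 * pi * ((x + p) \<bullet> \<gamma>)) \<partial>lborel) = fourier f \<gamma>"
    unfolding fourier_lborel[OF f] by (rule integral_lborel_translate)
  finally show ?thesis .
qed

lemma fourier_modulate:
  "fourier (\<lambda>x. cis (2 * pi * (x \<bullet> p)) * f x) \<gamma> = fourier f (\<gamma> - p)"
  unfolding fourier_def
  by (intro Bochner_Integration.integral_cong) (auto simp: cis_mult inner_diff_right algebra_simps)

lemma fourier_dilate: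
  fixes f :: "'a::euclidean_space \<Rightarrow> complex"
  assumes f: "f \<in> borel_measurable borel" and r: "r > 0"
  shows "fourier (\<lambda>x. f (r *\<^sub>R x)) \<gamma> = of_real (1 / r ^ DIM('a)) * fourier f (\<gamma> /\<^sub>R r)"
proof -
  have [measurable]: "f \<in> borel_measurable borel" by fact
  have "fourier f (\<gamma> /\<^sub>R r) = r ^ DIM('a) *\<^sub>R (\<integral>x. f (r *\<^sub>R x) * cis (- 2 * pi * ((r *\<^sub>R x) \<bullet> (\<gamma> /\<^sub>R r))) \<partial>lborel)"
    unfolding fourier_lborel[OF f]
    using r by (subst integral_lborel_affine[of r _ 0]) auto
  also have "(\<integral>x. f (r *\<^sub>R x) * cis (- 2 * pi * ((r *\<^sub>R x) \<bullet> (\<gamma> /\<^sub>R r))) \<partial>lborel) = fourier (\<lambda>x. f (r *\<^sub>R x)) \<gamma>"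
  proof -
    have "(r *\<^sub>R x) \<bullet> (\<gamma> /\<^sub>R r) = x \<bullet> \<gamma>" for x using r by simp
    then show ?thesis by (subst fourier_lborel) (measurable, simp only:)
  qed
  finally show ?thesis using r by (simp add: scaleR_conv_of_real)
qed

lemma fourier_cmult: "fourier (\<lambda>x. c * f x) \<gamma> = c * fourier f \<gamma>"
  unfolding fourier_def by (simp add: mult.assoc)

lemma fourier_diff:
  assumes "integrable lborel f" "integrable lborel h"
  shows "fourier (\<lambda>x. f x - h x) \<gamma> = fourier f \<gamma> - fourier h \<gamma>"
proof -
  have [measurable]: "f \<in> borel_measurable borel" "h \<in> borel_measurable borel"
    using assms[THEN borel_measurable_integrable] by auto
  show ?thesis
    by (simp add: fourier_lborel left_diff_distrib integrable_cis assms)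
qed

lemma vector_derivative_quotient_seq:
  fixes f :: "real \<Rightarrow> complex"
  assumes "(f has_vector_derivative D) (at 0)"
  shows "(\<lambda>n. of_nat (Suc n) * (f (1 / real (Suc n)) - f 0)) \<longlonglongrightarrow> D"
proof -
  have fl: "filterlim (\<lambda>n. 1 / real (Suc n)) (at 0) sequentially"
    unfolding filterlim_at using LIMSEQ_inverse_real_of_nat by (auto simp: divide_inverse)
  have q: "(\<lambda>n. real (Suc n) * (h (1 / real (Suc n)) - h 0)) \<longlonglongrightarrow> d"
    if "(h has_real_derivative d) (at 0)" for h d
    using filterlim_compose[OF that[unfolded DERIV_def] fl] by (simp add: mult.commute)
  have "((\<lambda>t. Re (f t)) has_real_derivative Re D) (at 0)" "((\<lambda>t. Im (f t)) has_real_derivative Im D) (at 0)"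
    using assms by (auto simp: has_vector_derivative_complex_iff)
  from q[OF this(1)] q[OF this(2)] show ?thesis
    by (simp add: tendsto_complex_iff)
qed

text \<open>Difference quotients replace integration by parts: translation becomes multiplication by
  a character, exactly, and both sides of the resulting identity converge as the step tends to
  0.\<close>

lemma fourier_pderiv:
  assumes \<phi>: "test_function \<phi>" and b: "b \<in> Basis"
  shows "fourier (\<lambda>x. frechet_derivative \<phi> (at x) b) \<gamma> = 2 * pi * \<i> * (\<gamma> \<bullet> b) * fourier \<phi> \<gamma>"
proof -
  define D where "D x = frechet_derivative \<phi> (at x) b" for x
  have tD: "test_function D" unfolding D_def by (rule test_function_pderiv[OF \<phi> b])
  note [measurable] = borel_measurable_test[OF \<phi>] borel_measurable_test[OF tD]
  obtain C where C: "\<And>x. cmod (D x) \<le> C" using test_function_bounded[OF tD] by blast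
  have C0: "0 \<le> C" using C[of 0] norm_ge_zero order_trans by blast
  \<comment> \<open>A compact set outside which all difference quotients with step at most 1 vanish;
    a constant times its indicator dominates them.\<close>
  define K where "K = {x + t *\<^sub>R b |x t. x \<in> tsupport \<phi> \<and> t \<in> {-1..1}}"
  have "K = (\<lambda>(x, t). x + t *\<^sub>R b) ` (tsupport \<phi> \<times> {-1..1})" by (fastforce simp: K_def image_iff)
  moreover have "compact \<dots>"
    using \<phi> by (intro compact_continuous_image compact_Times)
      (auto simp: test_function_def case_prod_beta intro!: continuous_intros)
  ultimately have K: "compact K" by simp
  have line: "((\<lambda>t. \<phi> (x + t *\<^sub>R b)) has_vector_derivative D (x + t *\<^sub>R b)) (at t)" for x t
  proof -
    have "((\<lambda>t. x + t *\<^sub>R b) has_derivative (\<lambda>h. h *\<^sub>R b)) (at t)"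
      by (auto intro!: derivative_eq_intros)
    from has_derivative_compose[OF this test_function_has_derivative[OF \<phi>]]
    have "((\<lambda>t. \<phi> (x + t *\<^sub>R b)) has_derivative (\<lambda>h. frechet_derivative \<phi> (at (x + t *\<^sub>R b)) (h *\<^sub>R b))) (at t)" .
    then show ?thesis
      unfolding has_vector_derivative_def D_def
      by (simp add: linear_scale[OF linear_frechet_derivative[OF differentiableI[OF test_function_has_derivative[OF \<phi>]]]])
  qed
  define q where "q n x = of_nat (Suc n) * (\<phi> (x + (1 / real (Suc n)) *\<^sub>R b) - \<phi> x)" for n x
  have qD: "(\<lambda>n. q n x) \<longlonglongrightarrow> D x" for x
    using vector_derivative_quotient_seq[of "\<lambda>t. \<phi> (x + t *\<^sub>R b)" "D x"] line[of x 0] by (simp add: q_def)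
  have qK: "cmod (q n x) \<le> C * indicator K x" for n x
  proof (cases "x \<in> K")
    case True
    define s where "s = 1 / real (Suc n)"
    have s: "s > 0" by (simp add: s_def)
    have "norm (\<phi> (x + s *\<^sub>R b) - \<phi> (x + 0 *\<^sub>R b)) \<le> C * norm (s - 0)"
    proof (rule differentiable_bound[of UNIV "\<lambda>t. \<phi> (x + t *\<^sub>R b)" "\<lambda>t h. h *\<^sub>R D (x + t *\<^sub>R b)"])
      show "onorm (\<lambda>h. h *\<^sub>R D (x + t *\<^sub>R b)) \<le> C" for t
        by (rule onorm_bound) (use C0 C in \<open>auto simp: mult.commute[of C] intro!: mult_left_mono\<close>)
    qed (use line in \<open>auto simp: has_vector_derivative_def\<close>)
    then have "cmod (q n x) \<le> real (Suc n) * (C * s)"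
      using s unfolding q_def s_def[symmetric] norm_mult norm_of_nat by (intro mult_left_mono) auto
    then show ?thesis using True by (simp add: s_def)
  next
    case False
    have "\<phi> x = 0"
    proof (rule ccontr)
      assume "\<phi> x \<noteq> 0"
      then have "x = x + 0 *\<^sub>R b \<and> x \<in> tsupport \<phi> \<and> (0::real) \<in> {-1..1}" by (simp add: in_tsupport)
      then have "x \<in> K" unfolding K_def by blast
      with False show False by simp
    qed
    moreover have "\<phi> (x + (1 / real (Suc n)) *\<^sub>R b) = 0"
    proof (rule ccontr)
      assume "\<phi> (x + (1 / real (Suc n)) *\<^sub>R b) \<noteq> 0"
      then have "x = (x + (1 / real (Suc n)) *\<^sub>R b) + (- (1 / real (Suc n))) *\<^sub>R b \<and>
          x + (1 / real (Suc n)) *\<^sub>R b \<in> tsupport \<phi> \<and> - (1 / real (Suc n)) \<in> {-1..1}"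
        by (auto simp: in_tsupport intro: order_trans[of "-1" 0])
      then have "x \<in> K" unfolding K_def by blast
      with False show False by simp
    qed
    ultimately show ?thesis using False by (simp add: q_def)
  qed
  have Fq: "fourier (q n) \<gamma> = of_nat (Suc n) * (cis (2 * pi * (\<gamma> \<bullet> b) * (1 / real (Suc n))) - 1) * fourier \<phi> \<gamma>" for n
  proof -
    have i1: "integrable lborel (\<lambda>x. \<phi> (x + (1 / real (Suc n)) *\<^sub>R b))"
      using test_function_integrable[OF \<phi>] by (simp only: integrable_lborel_translate)
    show ?thesis
      unfolding q_def[abs_def] fourier_cmult fourier_diff[OF i1 test_function_integrable[OF \<phi>]]
        fourier_translate[OF borel_measurable_test[OF \<phi>]]
      by (simp add: inner_commute algebra_simps)
  qed
  have "(\<lambda>n. fourier (q n) \<gamma>) \<longlonglongrightarrow> fourier D \<gamma>"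
  proof -
    have [measurable]: "q n \<in> borel_measurable borel" for n unfolding q_def by measurable
    have "(\<lambda>n. \<integral>x. q n x * cis (- 2 * pi * (x \<bullet> \<gamma>)) \<partial>lborel) \<longlonglongrightarrow> (\<integral>x. D x * cis (- 2 * pi * (x \<bullet> \<gamma>)) \<partial>lborel)"
    proof (rule integral_dominated_convergence[where w = "\<lambda>x. C * indicator K x"])
      show "integrable lborel (\<lambda>x. C * indicator K x)"
        using emeasure_compact_finite[OF K] K
        by (intro integrable_mult_right) (simp add: integrable_indicator_iff compact_imp_closed borel_closed)
      show "AE x in lborel. (\<lambda>n. q n x * cis (- 2 * pi * (x \<bullet> \<gamma>))) \<longlonglongrightarrow> D x * cis (- 2 * pi * (x \<bullet> \<gamma>))"
        by (intro AE_I2 tendsto_intros qD)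
    qed (use qK in \<open>auto simp: norm_mult\<close>)
    then show ?thesis by (simp add: fourier_lborel)
  qed
  moreover have "(\<lambda>n. of_nat (Suc n) * (cis (2 * pi * (\<gamma> \<bullet> b) * (1 / real (Suc n))) - 1) * fourier \<phi> \<gamma>)
      \<longlonglongrightarrow> (2 * pi * (\<gamma> \<bullet> b) * \<i>) * fourier \<phi> \<gamma>"
  proof (rule tendsto_mult[OF _ tendsto_const])
    have "((\<lambda>t. cis (2 * pi * (\<gamma> \<bullet> b) * t)) has_vector_derivative (2 * pi * (\<gamma> \<bullet> b)) * \<i>) (at 0)"
      unfolding has_vector_derivative_complex_iff by (auto intro!: derivative_eq_intros)
    from vector_derivative_quotient_seq[OF this]
    show "(\<lambda>n. of_nat (Suc n) * (cis (2 * pi * (\<gamma> \<bullet> b) * (1 / real (Suc n))) - 1)) \<longlonglongrightarrow> complex_of_real (2 * pi * (\<gamma> \<bullet> b)) * \<i>"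
      by simp
  qed
  ultimately have "fourier D \<gamma> = (2 * pi * (\<gamma> \<bullet> b) * \<i>) * fourier \<phi> \<gamma>"
    unfolding Fq by (rule LIMSEQ_unique)
  then show ?thesis by (simp add: D_def[abs_def] mult_ac)
qed

text \<open>Apply 1 - d_b^2 once for every coordinate. This multiplies the transform by the factors
  1 + (2 pi x_b)^2, yet the result is still the transform of a test function and so bounded by an L1
  norm.\<close>

lemma fourier_test_decay:
  assumes \<phi>: "test_function \<phi>"
  obtains C where "\<And>x. cmod (fourier \<phi> x) \<le> C * weight x" "C > 0"
proof -
  have "\<exists>\<psi>. test_function \<psi> \<and> (\<forall>x. fourier \<psi> x = of_real (\<Prod>b\<in>B. 1 + (2 * pi * (x \<bullet> b))^2) * fourier \<phi> x)"
    if "finite B" "B \<subseteq> Basis" for B :: "'a set"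
    using that
  proof (induction B rule: finite_subset_induct')
    case empty
    then show ?case using \<phi> by auto
  next
    case (insert b B)
    then obtain \<psi> where \<psi>: "test_function \<psi>"
      "\<And>x. fourier \<psi> x = of_real (\<Prod>b\<in>B. 1 + (2 * pi * (x \<bullet> b))^2) * fourier \<phi> x" by blast
    define \<psi>1 where "\<psi>1 x = frechet_derivative \<psi> (at x) b" for x
    define \<psi>2 where "\<psi>2 x = frechet_derivative \<psi>1 (at x) b" for x
    have t1: "test_function \<psi>1" unfolding \<psi>1_def by (rule test_function_pderiv) (use \<psi> insert in auto)
    have t2: "test_function \<psi>2" unfolding \<psi>2_def by (rule test_function_pderiv) (use t1 insert in auto)
    have "fourier (\<lambda>x. \<psi> x - \<psi>2 x) x = of_real (\<Prod>b\<in>insert b B. 1 + (2 * pi * (x \<bullet> b))^2) * fourier \<phi> x" for x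
    proof -
      have "fourier (\<lambda>x. \<psi> x - \<psi>2 x) x = fourier \<psi> x - fourier \<psi>2 x"
        by (intro fourier_diff test_function_integrable \<psi> t2)
      also have "fourier \<psi>2 x = (2 * pi * \<i> * (x \<bullet> b)) * ((2 * pi * \<i> * (x \<bullet> b)) * fourier \<psi> x)"
        unfolding \<psi>2_def using insert fourier_pderiv[OF t1, of b x] fourier_pderiv[OF \<psi>(1), of b x]
        by (simp add: \<psi>1_def[abs_def])
      also have "fourier \<psi> x - (2 * pi * \<i> * (x \<bullet> b)) * ((2 * pi * \<i> * (x \<bullet> b)) * fourier \<psi> x) =
          of_real (1 + (2 * pi * (x \<bullet> b))^2) * fourier \<psi> x"
        by (simp add: algebra_simps power2_eq_square)
      finally show ?thesis using insert \<psi>(2) by simp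
    qed
    moreover have "test_function (\<lambda>x. \<psi> x - \<psi>2 x)"
      using test_function_add[OF \<psi>(1) test_function_cmult[OF t2, of "-1"]] by simp
    ultimately show ?case by blast
  qed
  from this[of Basis] obtain \<psi> where \<psi>: "test_function \<psi>"
    "\<And>x. fourier \<psi> x = of_real (\<Prod>b\<in>Basis. 1 + (2 * pi * (x \<bullet> b))^2) * fourier \<phi> x"
    by auto
  define C where "C = (\<integral>x. cmod (\<psi> x) \<partial>lborel)"
  have "cmod (fourier \<phi> x) \<le> (C + 1) * weight x" for x
  proof -
    define P where "P = (\<Prod>b\<in>(Basis::'a set). 1 + (x \<bullet> b)^2)"
    have P: "P > 0" unfolding P_def by (intro prod_pos) (auto intro: add_pos_nonneg)
    have "P \<le> (\<Prod>b\<in>Basis. 1 + (2 * pi * (x \<bullet> b))^2)"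
      unfolding P_def
    proof (intro prod_mono conjI add_left_mono)
      fix b :: 'a assume "b \<in> Basis"
      have "1 \<le> 2 * pi" using pi_gt3 by simp
      then have "1 * \<bar>x \<bullet> b\<bar> \<le> 2 * pi * \<bar>x \<bullet> b\<bar>" by (intro mult_right_mono) auto
      then have "\<bar>x \<bullet> b\<bar> \<le> \<bar>2 * pi * (x \<bullet> b)\<bar>" by (simp add: abs_mult)
      then show "(x \<bullet> b)^2 \<le> (2 * pi * (x \<bullet> b))^2" by (simp add: abs_le_square_iff)
    qed simp
    then have "P * cmod (fourier \<phi> x) \<le> \<bar>\<Prod>b\<in>Basis. 1 + (2 * pi * (x \<bullet> b))^2\<bar> * cmod (fourier \<phi> x)"
      by (intro mult_right_mono) auto
    also have "\<dots> = cmod (fourier \<psi> x)" by (simp only: \<psi>(2) norm_mult norm_of_real)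
    also have "\<dots> \<le> C + 1"
      using norm_fourier_le[OF test_function_integrable[OF \<psi>(1)], of x] by (simp add: C_def)
    finally show ?thesis
      using P by (simp add: weight_eq P_def[symmetric] field_simps)
  qed
  moreover have "C + 1 > 0" unfolding C_def by (intro add_nonneg_pos integral_nonneg) auto
  ultimately show ?thesis by (rule that)
qed

lemma fourier_test_integrable:
  assumes "test_function \<phi>"
  shows "integrable lborel (fourier \<phi>)"
proof -
  obtain C where C: "\<And>x. cmod (fourier \<phi> x) \<le> C * weight x" "C > 0" using fourier_test_decay[OF assms] by blast
  show ?thesis
  proof (rule Bochner_Integration.integrable_bound)
    show "integrable lborel (\<lambda>x::'a. C * weight x)" by (intro integrable_mult_right integrable_weight)
    show "fourier \<phi> \<in> borel_measurable lborel"
      using fourier_measurable[OF test_function_integrable[OF assms]] by simp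
    show "AE x in lborel. norm (fourier \<phi> x) \<le> norm (C * weight x)"
      by (intro AE_I2 order_trans[OF C(1)]) simp
  qed
qed

section \<open>Gaussians and the reproducing formula\<close>

lemma integrable_product_bounded:
  fixes u :: "'a::euclidean_space \<Rightarrow> complex" and v :: "'b::euclidean_space \<Rightarrow> complex"
    and k :: "'a \<Rightarrow> 'b \<Rightarrow> complex"
  assumes u: "integrable lborel u" and v: "integrable lborel v"
    and k: "case_prod k \<in> borel_measurable (lborel \<Otimes>\<^sub>M lborel)" and k1: "\<And>x y. cmod (k x y) \<le> 1"
  shows "integrable (lborel \<Otimes>\<^sub>M lborel) (\<lambda>(x, y). u x * (v y * k x y))"
proof (rule integrableI_bounded)
  note [measurable] = borel_measurable_integrable[OF u] borel_measurable_integrable[OF v]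
  have kk: "(\<lambda>p. k (fst p) (snd p)) \<in> borel_measurable (lborel \<Otimes>\<^sub>M lborel)"
    using k by (simp add: case_prod_beta)
  note [measurable] = kk
  show m: "(\<lambda>(x, y). u x * (v y * k x y)) \<in> borel_measurable (lborel \<Otimes>\<^sub>M lborel)"
    unfolding case_prod_beta by measurable
  have "(\<integral>\<^sup>+ p. ennreal (norm (case p of (x, y) \<Rightarrow> u x * (v y * k x y))) \<partial>(lborel \<Otimes>\<^sub>M lborel)) \<le>
     (\<integral>\<^sup>+ p. ennreal (norm (u (fst p))) * ennreal (norm (v (snd p))) \<partial>(lborel \<Otimes>\<^sub>M lborel))"
  proof (rule nn_integral_mono)
    fix p :: "'a \<times> 'b"
    obtain x y where p: "p = (x, y)" by (cases p)
    have "cmod (u x) * (cmod (v y) * cmod (k x y)) \<le> cmod (u x) * (cmod (v y) * 1)"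
      by (intro mult_left_mono k1) auto
    then show "ennreal (norm (case p of (x, y) \<Rightarrow> u x * (v y * k x y))) \<le> ennreal (norm (u (fst p))) * ennreal (norm (v (snd p)))"
      by (simp add: p norm_mult ennreal_mult[symmetric] ennreal_leI)
  qed
  also have "\<dots> = (\<integral>\<^sup>+ x. \<integral>\<^sup>+ y. ennreal (norm (u x)) * ennreal (norm (v y)) \<partial>lborel \<partial>lborel)"
    by (subst lborel.nn_integral_fst[symmetric]) auto
  also have "\<dots> = (\<integral>\<^sup>+ x. ennreal (norm (u x)) \<partial>lborel) * (\<integral>\<^sup>+ y. ennreal (norm (v y)) \<partial>lborel)"
    by (simp add: nn_integral_cmult nn_integral_multc)
  also have "\<dots> < \<infinity>"
    using u v unfolding integrable_iff_bounded by (simp add: ennreal_mult_less_top)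
  finally show "(\<integral>\<^sup>+ p. ennreal (norm (case p of (x, y) \<Rightarrow> u x * (v y * k x y))) \<partial>(lborel \<Otimes>\<^sub>M lborel)) < \<infinity>" .
qed

text \<open>Fubini in the form needed for characters, which are kernels of modulus 1.\<close>

lemma integral_swap_bounded:
  fixes u :: "'a::euclidean_space \<Rightarrow> complex" and v :: "'b::euclidean_space \<Rightarrow> complex"
    and k :: "'a \<Rightarrow> 'b \<Rightarrow> complex"
  assumes u: "integrable lborel u" and v: "integrable lborel v"
    and k: "case_prod k \<in> borel_measurable (lborel \<Otimes>\<^sub>M lborel)" and k1: "\<And>x y. cmod (k x y) \<le> 1"
  shows "(\<integral>x. u x * (\<integral>y. v y * k x y \<partial>lborel) \<partial>lborel) = (\<integral>y. v y * (\<integral>x. u x * k x y \<partial>lborel) \<partial>lborel)"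
proof -
  have "(\<integral>x. u x * (\<integral>y. v y * k x y \<partial>lborel) \<partial>lborel) = (\<integral>x. \<integral>y. u x * (v y * k x y) \<partial>lborel \<partial>lborel)"
    by simp
  also have "\<dots> = (\<integral>y. \<integral>x. u x * (v y * k x y) \<partial>lborel \<partial>lborel)"
    by (rule lborel_pair.Fubini_integral[symmetric]) (rule integrable_product_bounded[OF assms])
  also have "\<dots> = (\<integral>y. \<integral>x. v y * (u x * k x y) \<partial>lborel \<partial>lborel)"
    by (simp add: mult_ac)
  also have "\<dots> = (\<integral>y. v y * (\<integral>x. u x * k x y \<partial>lborel) \<partial>lborel)"
    by simp
  finally show ?thesis .
qed

lemma fourier_multiplication_formula:
  fixes u v :: "'a::euclidean_space \<Rightarrow> complex"
  assumes u: "integrable lborel u" and v: "integrable lborel v"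
  shows "(\<integral>x. fourier u x * v x \<partial>lborel) = (\<integral>x. u x * fourier v x \<partial>lborel)"
proof -
  have m: "u \<in> borel_measurable borel" "v \<in> borel_measurable borel"
    using u v by (auto dest: borel_measurable_integrable)
  have "(\<integral>x. v x * (\<integral>y. u y * cis (- 2 * pi * (y \<bullet> x)) \<partial>lborel) \<partial>lborel) =
      (\<integral>y. u y * (\<integral>x. v x * cis (- 2 * pi * (y \<bullet> x)) \<partial>lborel) \<partial>lborel)"
  proof (rule integral_swap_bounded[OF v u])
    have "(\<lambda>p. cis (- 2 * pi * (snd p \<bullet> fst p))) \<in> borel_measurable (lborel \<Otimes>\<^sub>M lborel)" by measurable
    then show "(\<lambda>(x, y). cis (- 2 * pi * (y \<bullet> x))) \<in> borel_measurable (lborel \<Otimes>\<^sub>M lborel)"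
      by (simp add: case_prod_beta)
  qed simp
  then show ?thesis
    unfolding fourier_lborel[OF m(1)] fourier_lborel[OF m(2)] by (simp add: mult.commute inner_commute)
qed

definition gauss :: "'a::euclidean_space \<Rightarrow> real" where
  "gauss x = exp (- pi * (norm x)^2)"

lemma gauss_real_integrable: "integrable lborel (\<lambda>t::real. exp (- pi * t^2))"
proof -
  have "exp (- pi * t^2) = normal_density 0 (1 / sqrt (2 * pi)) t" for t
    by (simp add: normal_density_def power_divide)
  then show ?thesis
    using integrable_normal_moment[of "1 / sqrt (2 * pi)" 0 0] by simp
qed

text \<open>The characteristic function of the standard normal law, rescaled by \<open>c\<close> =
  sqrt(2 pi) to the self-dual normalisation exp(-pi t^2).\<close>

lemma gauss_real_fourier:
  "(\<integral>t. complex_of_real (exp (- pi * t^2)) * cis (- 2 * pi * (t * s)) \<partial>lborel) = complex_of_real (exp (- pi * s^2))"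
proof -
  define c where "c = sqrt (2 * pi)"
  have c: "c > 0" "c * c = 2 * pi" by (auto simp: c_def)
  have "complex_of_real (exp (- ((- c * s)^2) / 2)) = char std_normal_distribution (- c * s)"
    by (simp add: char_std_normal_distribution)
  also have "\<dots> = (\<integral>x. std_normal_density x *\<^sub>R iexp (- c * s * x) \<partial>lborel)"
    unfolding char_def by (subst integral_density) auto
  also have "\<dots> = \<bar>c\<bar> *\<^sub>R (\<integral>t. std_normal_density (0 + c * t) *\<^sub>R iexp (- c * s * (0 + c * t)) \<partial>lborel)"
    using c by (intro lborel_integral_real_affine) auto
  also have "\<dots> = (\<integral>t. c *\<^sub>R (std_normal_density (0 + c * t) *\<^sub>R iexp (- c * s * (0 + c * t))) \<partial>lborel)"
    using c by (simp only: integral_scaleR_right abs_of_pos)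
  also have "\<dots> = (\<integral>t. complex_of_real (exp (- pi * t^2)) * cis (- 2 * pi * (t * s)) \<partial>lborel)"
  proof (rule Bochner_Integration.integral_cong[OF refl])
    fix t
    have 1: "c * std_normal_density (0 + c * t) = exp (- pi * t^2)"
      using c unfolding std_normal_density_def c_def[symmetric]
      by (simp add: power_mult_distrib power2_eq_square[of c])
    have 2: "iexp (- c * s * (0 + c * t)) = cis (- 2 * pi * (t * s))"
    proof -
      have "- c * s * (0 + c * t) = - (c * c) * (t * s)" by simp
      also have "\<dots> = - 2 * pi * (t * s)" unfolding c(2) by simp
      finally show ?thesis by (simp only: cis_conv_exp)
    qed
    show "c *\<^sub>R (std_normal_density (0 + c * t) *\<^sub>R iexp (- c * s * (0 + c * t))) =
       complex_of_real (exp (- pi * t^2)) * cis (- 2 * pi * (t * s))"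
      unfolding scaleR_scaleR 1 2 by (simp add: scaleR_conv_of_real)
  qed
  also have "- ((- c * s)^2) / 2 = - pi * s^2"
    using c by (simp add: power_mult_distrib power2_eq_square[of c])
  finally show ?thesis by simp
qed

lemma cis_sum: "cis (\<Sum>i\<in>I. f i) = (\<Prod>i\<in>I. cis (f i))"
  by (induction I rule: infinite_finite_induct) (auto simp: cis_mult[symmetric])

lemma norm_sq_coords: "(norm x)^2 = (\<Sum>b\<in>Basis. (x \<bullet> b)^2)"
  unfolding power2_norm_eq_inner euclidean_inner[of x x] by (simp add: power2_eq_square)

lemma gauss_prod: "gauss x = (\<Prod>b\<in>Basis. exp (- pi * (x \<bullet> b)^2))"
  unfolding gauss_def norm_sq_coords by (simp add: sum_distrib_left exp_sum)

lemma gauss_integrable: "integrable lborel gauss"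
  unfolding gauss_prod[abs_def] by (intro integrable_lborel_prod(1) gauss_real_integrable)

lemma gauss_continuous: "continuous_on A gauss"
  unfolding gauss_def by (intro continuous_intros)

lemma gauss_measurable [measurable]: "gauss \<in> borel_measurable borel"
  by (intro borel_measurable_continuous_onI gauss_continuous)

lemma gauss_0 [simp]: "gauss 0 = 1"
  by (simp add: gauss_def)

lemma gauss_nonneg: "0 \<le> gauss x"
  and gauss_le_1: "gauss x \<le> 1"
  by (simp_all add: gauss_def)

lemma gauss_fourier:
  fixes \<gamma> :: "'a::euclidean_space"
  shows "fourier (\<lambda>x. complex_of_real (gauss x)) \<gamma> = complex_of_real (gauss \<gamma>)"
proof -
  have "fourier (\<lambda>x. complex_of_real (gauss x)) \<gamma> =
     (\<integral>x. complex_of_real (gauss x) * cis (- 2 * pi * (x \<bullet> \<gamma>)) \<partial>lborel)"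
    by (rule fourier_lborel) measurable
  also have "\<dots> = (\<integral>x. (\<Prod>b\<in>Basis. complex_of_real (exp (- pi * (x \<bullet> b)^2)) * cis (- 2 * pi * ((x \<bullet> b) * (\<gamma> \<bullet> b)))) \<partial>lborel)"
    unfolding gauss_prod euclidean_inner[of _ \<gamma>] sum_distrib_left cis_sum
    by (simp add: prod.distrib)
  also have "\<dots> = (\<Prod>b\<in>Basis. \<integral>t. complex_of_real (exp (- pi * t^2)) * cis (- 2 * pi * (t * (\<gamma> \<bullet> b))) \<partial>lborel)"
    by (rule integrable_lborel_prod(2)[of "\<lambda>b t. complex_of_real (exp (- pi * t^2)) * cis (- 2 * pi * (t * (\<gamma> \<bullet> b)))"])
      (intro integrable_cis integrable_of_real gauss_real_integrable, measurable)
  also have "\<dots> = complex_of_real (gauss \<gamma>)"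
    unfolding gauss_real_fourier gauss_prod by simp
  finally show ?thesis .
qed

lemma integral_gauss: "(\<integral>x. complex_of_real (gauss x) \<partial>(lborel :: 'a::euclidean_space measure)) = 1"
proof -
  have "fourier (\<lambda>x::'a. complex_of_real (gauss x)) 0 = (\<integral>x. complex_of_real (gauss (x::'a)) \<partial>lborel)"
    by (subst fourier_lborel) auto
  then show ?thesis by (simp only: gauss_fourier gauss_0 of_real_1)
qed

text \<open>The Gaussian has integral 1, so its dilates form an approximate identity at 0; the bound
  on \<open>u\<close> supplies the dominating function.\<close>

lemma integral_dilated_gauss_tendsto:
  fixes u :: "'a::euclidean_space \<Rightarrow> complex"
  assumes u: "u \<in> borel_measurable borel" "\<And>x. cmod (u x) \<le> C" "isCont u 0"
  shows "(\<lambda>n. \<integral>x. u (x /\<^sub>R real (Suc n)) * complex_of_real (gauss x) \<partial>lborel) \<longlonglongrightarrow> u 0"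
proof -
  have [measurable]: "u \<in> borel_measurable borel" by fact
  have "(\<lambda>n. \<integral>x. u (x /\<^sub>R real (Suc n)) * complex_of_real (gauss x) \<partial>lborel) \<longlonglongrightarrow>
      (\<integral>x. u 0 * complex_of_real (gauss x) \<partial>(lborel :: 'a measure))"
  proof (rule integral_dominated_convergence[where w = "\<lambda>x. C * gauss x"])
    show "integrable lborel (\<lambda>x::'a. C * gauss x)" by (intro integrable_mult_right gauss_integrable)
    show "AE x in lborel. (\<lambda>n. u (x /\<^sub>R real (Suc n)) * complex_of_real (gauss x)) \<longlonglongrightarrow> u 0 * complex_of_real (gauss x)"
    proof (intro AE_I2 tendsto_mult tendsto_const)
      fix x :: 'a
      have "(\<lambda>n. inverse (real (Suc n)) *\<^sub>R x) \<longlonglongrightarrow> 0 *\<^sub>R x"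
        by (intro tendsto_intros LIMSEQ_inverse_real_of_nat)
      then show "(\<lambda>n. u (x /\<^sub>R real (Suc n))) \<longlonglongrightarrow> u 0"
        using isCont_tendsto_compose[OF u(3)] by simp
    qed
    show "AE x in lborel. norm (u (x /\<^sub>R real (Suc n)) * complex_of_real (gauss x)) \<le> C * gauss x" for n
      by (intro AE_I2) (auto simp: norm_mult gauss_nonneg intro!: mult_right_mono u(2))
  qed measurable
  then show ?thesis by (simp only: integral_mult_right_zero integral_gauss mult_1_right)
qed

lemma dilated_gauss_fourier:
  fixes \<gamma> :: "'a::euclidean_space"
  assumes "r > 0"
  shows "fourier (\<lambda>x. complex_of_real (gauss (r *\<^sub>R x))) \<gamma> = complex_of_real (gauss (\<gamma> /\<^sub>R r) / r ^ DIM('a))"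
  using fourier_dilate[of "\<lambda>x. complex_of_real (gauss x)" r \<gamma>] assms by (simp add: gauss_fourier)

lemma gauss_dilated_tendsto:
  fixes x :: "'a::euclidean_space"
  shows "(\<lambda>n. gauss (x /\<^sub>R real (Suc n))) \<longlonglongrightarrow> 1"
proof -
  have "(\<lambda>n. inverse (real (Suc n)) *\<^sub>R x) \<longlonglongrightarrow> 0 *\<^sub>R x"
    by (intro tendsto_intros LIMSEQ_inverse_real_of_nat)
  moreover have "isCont (gauss :: 'a \<Rightarrow> real) 0"
    using gauss_continuous[of "UNIV :: 'a set"] by (simp add: continuous_on_eq_continuous_at)
  ultimately show ?thesis using isCont_tendsto_compose[of 0 gauss] by fastforce
qed

text \<open>The multiplication formula with a wide Gaussian on one side and its transform, a
  Gaussian concentrating at 0, on the other. Inversion and Plancherel both rest on it.\<close>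

lemma integral_fourier_mult_gauss:
  fixes u :: "'a::euclidean_space \<Rightarrow> complex"
  assumes u: "integrable lborel u"
  shows "(\<integral>x. fourier u x * complex_of_real (gauss (x /\<^sub>R real (Suc n))) \<partial>lborel) =
      (\<integral>x. u (x /\<^sub>R real (Suc n)) * complex_of_real (gauss x) \<partial>lborel)"
proof -
  define r where "r = inverse (real (Suc n))"
  have r: "r > 0" by (simp add: r_def)
  have gi: "integrable lborel (\<lambda>x::'a. complex_of_real (gauss (r *\<^sub>R x)))"
    using integrable_lborel_affine[OF integrable_of_real[OF gauss_integrable], of r 0] r by simp
  have "(\<integral>x. fourier u x * complex_of_real (gauss (r *\<^sub>R x)) \<partial>lborel) =
     (\<integral>x. u x * complex_of_real (gauss (x /\<^sub>R r) / r ^ DIM('a)) \<partial>lborel)"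
    using fourier_multiplication_formula[OF u gi] unfolding dilated_gauss_fourier[OF r] .
  also have "\<dots> = \<bar>r\<bar> ^ DIM('a) *\<^sub>R (\<integral>x. u (0 + r *\<^sub>R x) * complex_of_real (gauss ((0 + r *\<^sub>R x) /\<^sub>R r) / r ^ DIM('a)) \<partial>lborel)"
    by (rule integral_lborel_affine) (use r in simp)
  also have "\<dots> = (\<integral>x. u (r *\<^sub>R x) * complex_of_real (gauss x) \<partial>lborel)"
    using r by (simp add: scaleR_conv_of_real)
  finally show ?thesis by (simp add: r_def)
qed

text \<open>Gaussian summation: damping the integral by ever wider Gaussians turns it into averages
  of \<open>u\<close> near 0.\<close>

lemma fourier_inversion_at_0:
  fixes u :: "'a::euclidean_space \<Rightarrow> complex"
  assumes u: "integrable lborel u" "\<And>x. cmod (u x) \<le> C" "isCont u 0" and fu: "integrable lborel (fourier u)"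
  shows "(\<integral>x. fourier u x \<partial>lborel) = u 0"
proof (rule LIMSEQ_unique)
  have m [measurable]: "u \<in> borel_measurable borel" "fourier u \<in> borel_measurable borel"
    using u(1) fu by (auto dest: borel_measurable_integrable)
  show "(\<lambda>n. \<integral>x. u (x /\<^sub>R real (Suc n)) * complex_of_real (gauss x) \<partial>lborel) \<longlonglongrightarrow> u 0"
    by (rule integral_dilated_gauss_tendsto[OF m(1) u(2,3)])
  have "(\<lambda>n. \<integral>x. fourier u x * complex_of_real (gauss (x /\<^sub>R real (Suc n))) \<partial>lborel) \<longlonglongrightarrow> (\<integral>x. fourier u x * 1 \<partial>lborel)"
  proof (rule integral_dominated_convergence[where w = "\<lambda>x. cmod (fourier u x)"])
    show "AE x in lborel. (\<lambda>n. fourier u x * complex_of_real (gauss (x /\<^sub>R real (Suc n)))) \<longlonglongrightarrow> fourier u x * 1"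
    proof (intro AE_I2 tendsto_mult tendsto_const)
      fix x :: 'a
      show "(\<lambda>n. complex_of_real (gauss (x /\<^sub>R real (Suc n)))) \<longlonglongrightarrow> 1"
        using tendsto_of_real[OF gauss_dilated_tendsto[of x], where 'a = complex] by simp
    qed
    show "AE x in lborel. norm (fourier u x * complex_of_real (gauss (x /\<^sub>R real (Suc n)))) \<le> cmod (fourier u x)" for n
      by (intro AE_I2) (auto simp: norm_mult gauss_nonneg gauss_le_1 intro!: mult_left_le)
    show "integrable lborel (\<lambda>x. cmod (fourier u x))" using fu by simp
  qed measurable
  then show "(\<lambda>n. \<integral>x. u (x /\<^sub>R real (Suc n)) * complex_of_real (gauss x) \<partial>lborel) \<longlonglongrightarrow> (\<integral>x. fourier u x \<partial>lborel)"
    by (simp only: integral_fourier_mult_gauss[OF u(1)] mult_1_right)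
qed

section \<open>Spectral support and the reproducing kernel\<close>

lemma fourier_supp_inD:
  assumes "fourier_supp_in F \<Lambda>" "F \<in> borel_measurable borel" "test_function \<phi>" "tsupport \<phi> \<inter> \<Lambda> = {}"
  shows "(\<integral>z. F z * fourier \<phi> z \<partial>lborel) = 0"
proof -
  have [measurable]: "F \<in> borel_measurable borel" "fourier \<phi> \<in> borel_measurable borel"
    using assms fourier_measurable[OF test_function_integrable] by auto
  have "(\<integral>z. F z * fourier \<phi> z \<partial>lebesgue) = (\<integral>z. F z * fourier \<phi> z \<partial>lborel)"
    by (rule integral_completion) measurable
  with assms show ?thesis by (simp add: fourier_supp_in_def)
qed

lemma fourier_supp_inI:
  assumes "F \<in> borel_measurable borel"
    and "\<And>\<phi>. test_function \<phi> \<Longrightarrow> tsupport \<phi> \<inter> \<Lambda> = {} \<Longrightarrow> (\<integral>z. F z * fourier \<phi> z \<partial>lborel) = 0"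
  shows "fourier_supp_in F \<Lambda>"
  unfolding fourier_supp_in_def
proof (intro allI impI)
  fix \<phi> :: "'a \<Rightarrow> complex" assume \<phi>: "test_function \<phi> \<and> tsupport \<phi> \<inter> \<Lambda> = {}"
  have [measurable]: "F \<in> borel_measurable borel" "fourier \<phi> \<in> borel_measurable borel"
    using assms \<phi> fourier_measurable[OF test_function_integrable] by auto
  have "(\<integral>z. F z * fourier \<phi> z \<partial>lebesgue) = (\<integral>z. F z * fourier \<phi> z \<partial>lborel)"
    by (rule integral_completion) measurable
  with assms(2) \<phi> show "(\<integral>z. F z * fourier \<phi> z \<partial>lebesgue) = 0" by simp
qed

lemma integrable_mult_bounded_fourier:
  assumes "F \<in> borel_measurable borel" "\<And>x. cmod (F x) \<le> M" "integrable lborel h"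
  shows "integrable lborel (\<lambda>x. F x * (h x :: complex))"
proof (rule Bochner_Integration.integrable_bound)
  show "integrable lborel (\<lambda>x. M * cmod (h x))" using assms by auto
  show "AE x in lborel. norm (F x * h x) \<le> norm (M * cmod (h x))"
    using assms(2) by (auto simp: norm_mult abs_mult intro!: AE_I2 mult_right_mono order_trans[OF assms(2) abs_ge_self])
qed (use assms in auto)

definition pw_kernel :: "real \<Rightarrow> 'a::euclidean_space \<Rightarrow> complex" where
  "pw_kernel R = fourier (\<lambda>x. complex_of_real (bump R x))"

lemma pw_kernel_integrable: "R > 0 \<Longrightarrow> integrable lborel (pw_kernel R)"
  unfolding pw_kernel_def by (intro fourier_test_integrable test_function_bump)

lemma pw_kernel_decay:
  assumes "R > 0"
  obtains C where "\<And>x::'a::euclidean_space. cmod (pw_kernel R x) \<le> C * weight x" "C > 0"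
  using fourier_test_decay[OF test_function_bump[OF assms, where 'a='a]] unfolding pw_kernel_def by blast

lemma pw_kernel_continuous: "R > 0 \<Longrightarrow> continuous_on UNIV (pw_kernel R)"
  unfolding pw_kernel_def by (intro continuous_fourier test_function_integrable test_function_bump)

lemma pw_kernel_measurable: "pw_kernel R \<in> borel_measurable borel" if "R > 0"
  using that by (intro borel_measurable_continuous_onI pw_kernel_continuous)

text \<open>Two cutoffs that agree near \<Lambda> have transforms with the same pairing against
  \<open>F\<close>. One is the fixed cutoff \<open>ch\<close>; the other is the widening cutoff
  \<open>et n\<close>, whose transform is an approximate identity, so that its pairing tends to
  F(z).\<close>

theorem reproducing_formula:
  fixes F :: "'a::euclidean_space \<Rightarrow> complex"
  assumes F: "continuous_on UNIV F" "\<And>x. cmod (F x) \<le> M" "fourier_supp_in F \<Lambda>"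
    and R: "R > 0" "\<And>\<gamma> b. \<gamma> \<in> \<Lambda> \<Longrightarrow> b \<in> Basis \<Longrightarrow> \<bar>\<gamma> \<bullet> b\<bar> \<le> R"
  shows "F z = (\<integral>w. F w * pw_kernel R (w - z) \<partial>lborel)"
proof -
  have mF [measurable]: "F \<in> borel_measurable borel" by (rule borel_measurable_continuous_onI[OF F(1)])
  define ch where "ch x = complex_of_real (bump R (x::'a))" for x
  define et where "et n x = complex_of_real (bump (real (Suc n)) (x::'a))" for n x
  have tch: "test_function ch" unfolding ch_def by (rule test_function_bump[OF R(1)])
  have tet: "test_function (et n)" for n unfolding et_def by (rule test_function_bump) simp
  have Ke: "integrable lborel (pw_kernel 1 :: 'a \<Rightarrow> complex)" by (rule pw_kernel_integrable) simp
  have Fe: "fourier (et n) w = of_real (real (Suc n) ^ DIM('a)) * pw_kernel 1 (real (Suc n) *\<^sub>R w)" for n w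
  proof -
    have "et n = (\<lambda>x. complex_of_real (bump 1 (inverse (real (Suc n)) *\<^sub>R x)))"
      using bump_scale[of "real (Suc n)" 1, where 'a='a] by (auto simp: et_def simp del: of_nat_Suc)
    moreover have "(\<lambda>x::'a. complex_of_real (bump 1 x)) \<in> borel_measurable borel"
      by (rule borel_measurable_test) (rule test_function_bump, simp)
    ultimately show ?thesis
      using fourier_dilate[of "\<lambda>x::'a. complex_of_real (bump 1 x)" "inverse (real (Suc n))" w]
      by (simp add: pw_kernel_def power_inverse[symmetric] divide_inverse)
  qed
  have eq: "(\<integral>w. F w * pw_kernel R (w - z) \<partial>lborel) = (\<integral>v. F (z + inverse (real (Suc n)) *\<^sub>R v) * pw_kernel 1 v \<partial>lborel)"
    if n: "real (Suc n) \<ge> 2 * R" for n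
  proof -
    \<comment> \<open>The function 1 - ch has unbounded support. The factor \<open>et n\<close>
      makes a test function of it, and the character moves both kernels to the point
      \<open>z\<close>.\<close>
    define ph where "ph x = cis (2 * pi * (x \<bullet> z)) * (et n x * (1 - ch x))" for x
    \<comment> \<open>As n + 1 \<ge> 2R, the plateau of \<open>et n\<close> covers the support of
      \<open>ch\<close>; so \<open>ph\<close> is a difference of two modulated cutoffs.\<close>
    have ec: "et n x * ch x = ch x" for x
    proof (cases "ch x = 0")
      case False
      then have "\<bar>x \<bullet> b\<bar> < 4 * R" if "b \<in> Basis" for b
        using bump_neq_0D[of R x b] R(1) that by (simp add: ch_def)
      then have "\<bar>x \<bullet> b\<bar> \<le> 2 * real (Suc n)" if "b \<in> Basis" for b
        using n that by fastforce
      then have "bump (real (Suc n)) x = 1" by (intro bump_eq_1) auto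
      then show ?thesis by (simp add: et_def)
    qed simp
    have ph_eq: "ph = (\<lambda>x. cis (2 * pi * (x \<bullet> z)) * et n x - cis (2 * pi * (x \<bullet> z)) * ch x)"
    proof
      fix x
      have "ph x = cis (2 * pi * (x \<bullet> z)) * et n x - cis (2 * pi * (x \<bullet> z)) * (et n x * ch x)"
        by (simp add: ph_def right_diff_distrib)
      then show "ph x = cis (2 * pi * (x \<bullet> z)) * et n x - cis (2 * pi * (x \<bullet> z)) * ch x"
        by (simp only: ec)
    qed
    have cisCk: "Ck k (\<lambda>x::'a. cis (2 * pi * (x \<bullet> z)))" for k
      using Ck_cis_inner[of k "(2 * pi) *\<^sub>R z"] by (simp add: mult_ac)
    have t1: "test_function (\<lambda>x. cis (2 * pi * (x \<bullet> z)) * et n x)"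
      and t2: "test_function (\<lambda>x. cis (2 * pi * (x \<bullet> z)) * ch x)"
      by (intro test_function_mult_left tet tch cisCk)+
    have tph: "test_function ph"
      unfolding ph_eq using test_function_add[OF t1 test_function_cmult[OF t2, of "-1"]] by simp
    \<comment> \<open>\<open>ph\<close> vanishes where all coordinates are below 2R, while \<Lambda>
      stays within R; this margin keeps even the closed support off \<Lambda>.\<close>
    define S where "S = (\<Union>b\<in>Basis. {x::'a. 2 * R \<le> \<bar>x \<bullet> b\<bar>})"
    have "closed S" unfolding S_def
      by (intro closed_UN ballI closed_Collect_le continuous_intros) auto
    moreover have "x \<in> S" if "ph x \<noteq> 0" for x
    proof (rule ccontr)
      assume "x \<notin> S"
      then have "bump R x = 1" using R(1) by (intro bump_eq_1) (auto simp: S_def intro: less_imp_le)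
      with that show False by (simp add: ph_def ch_def)
    qed
    ultimately have "tsupport ph \<subseteq> S" by (rule tsupport_subset)
    moreover have "S \<inter> \<Lambda> = {}" using R by (force simp: S_def)
    ultimately have "(\<integral>w. F w * fourier ph w \<partial>lborel) = 0"
      by (intro fourier_supp_inD[OF F(3) mF tph]) auto
    moreover have "fourier ph w = fourier (et n) (w - z) - pw_kernel R (w - z)" for w
      unfolding ph_eq
      by (subst fourier_diff) (auto simp: fourier_modulate pw_kernel_def ch_def[abs_def, symmetric]
          intro!: test_function_integrable t1 t2)
    moreover have i1: "integrable lborel (\<lambda>w. F w * fourier (et n) (w - z))"
      using integrable_lborel_translate[of "fourier (et n)" "- z"] fourier_test_integrable[OF tet]
      by (intro integrable_mult_bounded_fourier[OF mF F(2)]) simp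
    moreover have i2: "integrable lborel (\<lambda>w. F w * pw_kernel R (w - z))"
      using integrable_lborel_translate[of "pw_kernel R" "- z"] pw_kernel_integrable[OF R(1)]
      by (intro integrable_mult_bounded_fourier[OF mF F(2)]) simp
    ultimately have "(\<integral>w. F w * pw_kernel R (w - z) \<partial>lborel) = (\<integral>w. F w * fourier (et n) (w - z) \<partial>lborel)"
      by (simp add: right_diff_distrib)
    also have "\<dots> = \<bar>inverse (real (Suc n))\<bar> ^ DIM('a) *\<^sub>R
        (\<integral>v. F (z + inverse (real (Suc n)) *\<^sub>R v) * fourier (et n) (z + inverse (real (Suc n)) *\<^sub>R v - z) \<partial>lborel)"
      by (rule integral_lborel_affine) simp
    also have "\<dots> = (\<integral>v. F (z + inverse (real (Suc n)) *\<^sub>R v) * pw_kernel 1 v \<partial>lborel)"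
    proof -
      have "F (z + inverse (real (Suc n)) *\<^sub>R v) * fourier (et n) (z + inverse (real (Suc n)) *\<^sub>R v - z) =
         of_real (real (Suc n) ^ DIM('a)) * (F (z + inverse (real (Suc n)) *\<^sub>R v) * pw_kernel 1 v)" for v
        by (simp add: Fe del: of_nat_Suc)
      then show ?thesis
        by (simp only: integral_mult_right_zero) (simp add: scaleR_conv_of_real power_inverse del: of_nat_Suc)
    qed
    finally show ?thesis .
  qed
  have "(\<lambda>n. \<integral>v. F (z + inverse (real (Suc n)) *\<^sub>R v) * pw_kernel 1 v \<partial>lborel) \<longlonglongrightarrow> (\<integral>v. F z * pw_kernel 1 (v::'a) \<partial>lborel)"
  proof (rule integral_dominated_convergence[where w = "\<lambda>v::'a. M * cmod (pw_kernel 1 v)"])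
    have [measurable]: "(pw_kernel 1 :: 'a \<Rightarrow> complex) \<in> borel_measurable borel" by (rule pw_kernel_measurable) simp
    show "(\<lambda>v::'a. F z * pw_kernel 1 v) \<in> borel_measurable lborel" by measurable
    show "(\<lambda>v. F (z + inverse (real (Suc n)) *\<^sub>R v) * pw_kernel 1 v) \<in> borel_measurable lborel" for n by measurable
    show "integrable lborel (\<lambda>v. M * cmod (pw_kernel 1 (v::'a)))" using Ke by simp
    show "AE v in lborel. (\<lambda>n. F (z + inverse (real (Suc n)) *\<^sub>R v) * pw_kernel 1 v) \<longlonglongrightarrow> F z * pw_kernel 1 v"
    proof (intro AE_I2 tendsto_mult tendsto_const)
      fix v :: 'a
      have "(\<lambda>n. z + inverse (real (Suc n)) *\<^sub>R v) \<longlonglongrightarrow> z + 0 *\<^sub>R v"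
        by (intro tendsto_intros LIMSEQ_inverse_real_of_nat)
      then show "(\<lambda>n. F (z + inverse (real (Suc n)) *\<^sub>R v)) \<longlonglongrightarrow> F z"
        using continuous_on_tendsto_compose[OF F(1)] by force
    qed
    show "AE v in lborel. norm (F (z + inverse (real (Suc n)) *\<^sub>R v) * pw_kernel 1 v) \<le> M * cmod (pw_kernel 1 v)" for n
      by (intro AE_I2) (auto simp: norm_mult intro!: mult_right_mono F(2))
  qed
  moreover have "\<forall>\<^sub>F n in sequentially. (\<integral>v. F (z + inverse (real (Suc n)) *\<^sub>R v) * pw_kernel 1 v \<partial>lborel) = (\<integral>w. F w * pw_kernel R (w - z) \<partial>lborel)"
  proof -
    obtain N :: nat where N: "2 * R \<le> real N" using real_arch_simple by blast
    show ?thesis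
      by (rule eventually_sequentiallyI[of N], rule eq[symmetric]) (use N in simp)
  qed
  ultimately have "(\<lambda>n. \<integral>w. F w * pw_kernel R (w - z) \<partial>lborel) \<longlonglongrightarrow> (\<integral>v. F z * pw_kernel 1 (v::'a) \<partial>lborel)"
    by (rule Lim_transform_eventually)
  then have "(\<integral>w. F w * pw_kernel R (w - z) \<partial>lborel) = F z * (\<integral>v. pw_kernel 1 (v::'a) \<partial>lborel)"
    by (simp add: tendsto_const_iff)
  \<comment> \<open>By inversion at 0, the total mass of the approximate identity is the value of
    the cutoff at the origin.\<close>
  also have "(\<integral>v. pw_kernel 1 (v::'a) \<partial>lborel) = 1"
  proof -
    have t: "test_function (\<lambda>x::'a. complex_of_real (bump 1 x))" by (rule test_function_bump) simp
    have "(\<integral>v. pw_kernel 1 (v::'a) \<partial>lborel) = complex_of_real (bump 1 (0::'a))"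
      unfolding pw_kernel_def
    proof (rule fourier_inversion_at_0)
      show "cmod (complex_of_real (bump 1 x)) \<le> 1" for x :: 'a
        using bump_nonneg[of 1 x] bump_le_1[of 1 x] by simp
      show "isCont (\<lambda>x::'a. complex_of_real (bump 1 x)) 0"
        using test_function_continuous[OF t, of UNIV] by (simp add: continuous_on_eq_continuous_at)
    qed (intro test_function_integrable fourier_test_integrable t)+
    then show ?thesis by (simp add: bump_eq_1)
  qed
  finally show ?thesis by simp
qed

section \<open>Plancherel and the short-time Fourier transform\<close>

text \<open>\<open>L2\<close> is stated for \<open>lebesgue\<close>, whereas Fubini and the product
  measurability are used for Borel functions under \<open>lborel\<close>; Borel representatives
  bridge the two.\<close>

lemma borel_representative:
  fixes f :: "'a::euclidean_space \<Rightarrow> complex"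
  assumes "f \<in> borel_measurable lebesgue"
  obtains f' where "f' \<in> borel_measurable borel" "AE x in lebesgue. f x = f' x"
proof -
  have "(\<lambda>x. Re (f x)) \<in> borel_measurable lebesgue" "(\<lambda>x. Im (f x)) \<in> borel_measurable lebesgue"
    using assms by measurable
  from this[THEN completion_ex_borel_measurable_real]
  obtain r i where r: "r \<in> borel_measurable lborel" "AE x in lborel. Re (f x) = r x"
    and i: "i \<in> borel_measurable lborel" "AE x in lborel. Im (f x) = i x"
    by blast
  have [measurable]: "r \<in> borel_measurable borel" "i \<in> borel_measurable borel" using r i by auto
  have "(\<lambda>x. complex_of_real (r x) + \<i> * complex_of_real (i x)) \<in> borel_measurable borel" by measurable
  moreover have "AE x in lborel. f x = complex_of_real (r x) + \<i> * complex_of_real (i x)"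
    using r(2) i(2) by eventually_elim (simp add: complex_eq_iff)
  ultimately show ?thesis by (intro that[of "\<lambda>x. complex_of_real (r x) + \<i> * complex_of_real (i x)"] AE_completion)
qed

section \<open>Translations and continuous approximation in L2\<close>

lemma lebesgue_translation_measurable: "(\<lambda>x. x + c) \<in> lebesgue \<rightarrow>\<^sub>M lebesgue"
  and lebesgue_distr_translation: "distr lebesgue lebesgue (\<lambda>x. x + c) = lebesgue"
proof -
  have T: "(\<lambda>x. c + (\<Sum>j\<in>Basis. (1 * (x \<bullet> j)) *\<^sub>R j)) = (\<lambda>x. x + c)"
    by (auto simp: euclidean_representation add.commute)
  show "(\<lambda>x. x + c) \<in> lebesgue \<rightarrow>\<^sub>M lebesgue"
    using lebesgue_affine_measurable[of "\<lambda>_. 1" c] unfolding T by simp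
  show "distr lebesgue lebesgue (\<lambda>x. x + c) = lebesgue"
    using lebesgue_affine_euclidean[of "\<lambda>_. 1" c, symmetric] unfolding T by (simp add: density_1)
qed

lemma integrable_lebesgue_translate:
  fixes f :: "'a::euclidean_space \<Rightarrow> 'b::{banach,second_countable_topology}"
  assumes "integrable lebesgue f"
  shows "integrable lebesgue (\<lambda>x. f (x + c))"
    and "(\<integral>x. f (x + c) \<partial>lebesgue) = (\<integral>x. f x \<partial>lebesgue)"
proof -
  show "integrable lebesgue (\<lambda>x. f (x + c))"
    by (rule integrable_distr[OF lebesgue_translation_measurable[of c]])
      (use assms in \<open>simp add: lebesgue_distr_translation\<close>)
  have "(\<integral>x. f x \<partial>distr lebesgue lebesgue (\<lambda>x. x + c)) = (\<integral>x. f (x + c) \<partial>lebesgue)"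
    by (rule integral_distr[OF lebesgue_translation_measurable]) (use assms in auto)
  then show "(\<integral>x. f (x + c) \<partial>lebesgue) = (\<integral>x. f x \<partial>lebesgue)"
    by (simp add: lebesgue_distr_translation)
qed

lemma L2_translate:
  assumes "L2 f"
  shows "L2 (\<lambda>t. f (t + c))"
  using measurable_compose[OF lebesgue_translation_measurable L2_measurable[OF assms], of c]
    integrable_lebesgue_translate(1)[OF L2_integrable[OF assms], of c]
  by (simp add: L2_def)

lemma L2norm_translate: "L2 f \<Longrightarrow> L2norm (\<lambda>t. f (t + c)) = L2norm f"
  unfolding L2norm_def using integrable_lebesgue_translate(2)[OF L2_integrable] by metis

lemma L2norm_dominated:
  fixes f :: "nat \<Rightarrow> 'a::euclidean_space \<Rightarrow> complex"
  assumes "\<And>n. f n \<in> borel_measurable lebesgue" "h \<in> borel_measurable lebesgue" "integrable lebesgue w"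
    and "\<And>n. AE x in lebesgue. (cmod (h x - f n x))^2 \<le> w x"
    and "AE x in lebesgue. (\<lambda>n. f n x) \<longlonglongrightarrow> h x"
  shows "(\<lambda>n. L2norm (\<lambda>x. h x - f n x)) \<longlonglongrightarrow> 0"
proof -
  have "(\<lambda>n. \<integral>x. (cmod (h x - f n x))^2 \<partial>lebesgue) \<longlonglongrightarrow> (\<integral>x. 0 \<partial>(lebesgue :: 'a measure))"
  proof (rule integral_dominated_convergence[where w = w])
    show "AE x in lebesgue. (\<lambda>n. (cmod (h x - f n x))\<^sup>2) \<longlonglongrightarrow> 0"
      using assms(5)
    proof eventually_elim
      case (elim x)
      then have "(\<lambda>n. (cmod (h x - f n x))^2) \<longlonglongrightarrow> (cmod (h x - h x))^2" by (intro tendsto_intros)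
      then show ?case by simp
    qed
  qed (use assms in auto)
  then have "(\<lambda>n. sqrt (\<integral>x. (cmod (h x - f n x))^2 \<partial>lebesgue)) \<longlonglongrightarrow> sqrt (\<integral>x. 0 \<partial>(lebesgue :: 'a measure))"
    by (rule tendsto_real_sqrt)
  then show ?thesis by (simp add: L2norm_def)
qed

lemma norm_measurable_lebesgue [measurable]: "(\<lambda>x::'a::euclidean_space. norm x) \<in> borel_measurable lebesgue"
  by (rule measurable_completion) simp

lemma L2_truncate_tendsto:
  assumes f: "L2 f"
  defines "T k x \<equiv> (if norm x \<le> real k \<and> cmod (f x) \<le> real k then f x else 0)"
  shows "(\<lambda>k. L2norm (\<lambda>x. f x - T k x)) \<longlonglongrightarrow> 0"
proof (rule L2norm_dominated)
  have [measurable]: "f \<in> borel_measurable lebesgue" using f by (simp add: L2_def)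
  show "T k \<in> borel_measurable lebesgue" for k unfolding T_def by measurable
  show "f \<in> borel_measurable lebesgue" by measurable
  show "integrable lebesgue (\<lambda>x. (cmod (f x))^2)" using f by (rule L2_integrable)
  show "AE x in lebesgue. (cmod (f x - T k x))\<^sup>2 \<le> (cmod (f x))\<^sup>2" for k
    by (intro AE_I2) (simp add: T_def)
  show "AE x in lebesgue. (\<lambda>n. T n x) \<longlonglongrightarrow> f x"
  proof (intro AE_I2 tendsto_eventually)
    fix x
    obtain N :: nat where "max (norm x) (cmod (f x)) \<le> real N" using real_arch_simple by blast
    then show "\<forall>\<^sub>F n in sequentially. T n x = f x"
      by (intro eventually_sequentiallyI[of N]) (auto simp: T_def)
  qed
qed

text \<open>The radial retraction of the plane onto the disc of radius \<open>c\<close>. Being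
  continuous, it bounds continuous approximants without losing their continuity.\<close>

definition clip :: "real \<Rightarrow> complex \<Rightarrow> complex" where
  "clip c z = complex_of_real (c / max c (cmod z)) * z"

lemma clip_continuous: "c > 0 \<Longrightarrow> continuous_on A (clip c)"
  unfolding clip_def by (intro continuous_intros) auto

lemma clip_eq: "c > 0 \<Longrightarrow> cmod z \<le> c \<Longrightarrow> clip c z = z"
  by (simp add: clip_def max_def)

lemma clip_le: "c > 0 \<Longrightarrow> cmod (clip c z) \<le> c"
  by (auto simp: clip_def norm_mult norm_divide max_def field_simps)

text \<open>A measurable function is an almost everywhere limit of continuous ones, but without
  domination. Truncating the target first, then clipping and cutting off the approximants, supplies
  a common bound and a common bounded support.\<close>

lemma continuous_dense_L2:
  assumes f: "L2 f" and e: "e > 0"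
  obtains h where "continuous_on UNIV h" "bounded {x. h x \<noteq> 0}" "L2 h" "L2norm (\<lambda>x. f x - h x) < e"
proof -
  define T where "T k x = (if norm x \<le> real k \<and> cmod (f x) \<le> real k then f x else 0)" for k x
  have mf [measurable]: "f \<in> borel_measurable lebesgue" using f by (simp add: L2_def)
  have mT [measurable]: "T k \<in> borel_measurable lebesgue" for k unfolding T_def by measurable
  obtain k0 where k0: "\<And>k. k \<ge> k0 \<Longrightarrow> L2norm (\<lambda>x. f x - T k x) < e/2"
    using LIMSEQ_D[OF L2_truncate_tendsto[OF f], of "e/2"] e unfolding T_def by auto
  define k where "k = Suc k0"
  have kT: "L2norm (\<lambda>x. f x - T k x) < e/2" by (rule k0) (simp add: k_def)
  have "T k measurable_on UNIV"
    using mT[of k] by (subst measurable_on_iff_borel_measurable) auto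
  then obtain N g where N: "negligible N" and g: "\<And>n::nat. continuous_on UNIV (g n)"
    and lim: "\<And>x. x \<notin> N \<Longrightarrow> (\<lambda>n. g n x) \<longlonglongrightarrow> T k x"
    unfolding measurable_on_def by auto
  define c where "c = real k"
  have c: "c > 0" by (simp add: c_def k_def)
  \<comment> \<open>Equal to 1 on the ball of radius \<open>c\<close>, outside which
    \<open>T k\<close> vanishes, and 0 beyond radius c + 1.\<close>
  define cut where "cut x = complex_of_real (max 0 (min 1 (c + 1 - norm x)))" for x :: 'a
  have cutc: "continuous_on UNIV cut" unfolding cut_def by (intro continuous_intros)
  define h where "h n x = clip c (g n x) * cut x" for n x
  have hc: "continuous_on UNIV (h n)" for n
    unfolding h_def by (intro continuous_intros cutc continuous_on_compose2[OF clip_continuous[OF c, of UNIV] g]) auto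
  have hm [measurable]: "h n \<in> borel_measurable lebesgue" for n
    using borel_measurable_continuous_onI[OF hc[of n]] by (simp add: measurable_completion)
  have hz: "h n x = 0" if "norm x > c + 1" for n x using that by (simp add: h_def cut_def)
  have cut1: "cmod (cut x) \<le> 1" for x unfolding cut_def norm_of_real by auto
  have hb: "cmod (h n x) \<le> c" for n x
    using mult_mono[OF clip_le[OF c, of "g n x"] cut1[of x]] c by (simp add: h_def norm_mult)
  have ind: "integrable lebesgue (\<lambda>x::'a. (2 * c)^2 * indicator (cball 0 (c + 1)) x)"
    by (intro integrable_mult_right) (use emeasure_lborel_cball_finite[of "0::'a" "c+1"] in \<open>simp add: integrable_completion integrable_indicator_iff\<close>)
  have Tz: "T k x = 0" if "norm x > c" for x using that by (simp add: T_def c_def)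
  have Tb: "cmod (T k x) \<le> c" for x using c by (simp add: T_def c_def)
  have dom: "(cmod (T k x - h n x))^2 \<le> (2 * c)^2 * indicator (cball 0 (c + 1)) x" for n x
  proof (cases "norm x \<le> c + 1")
    case True
    have "cmod (T k x - h n x) \<le> cmod (T k x) + cmod (h n x)" by (rule norm_triangle_ineq4)
    then have "cmod (T k x - h n x) \<le> 2 * c" using Tb[of x] hb[of n x] by linarith
    then have "(cmod (T k x - h n x))^2 \<le> (2 * c)^2" by (intro power_mono) auto
    with True show ?thesis by simp
  next
    case False
    then show ?thesis using hz[of x n] Tz[of x] by simp
  qed
  have "(\<lambda>n. L2norm (\<lambda>x. T k x - h n x)) \<longlonglongrightarrow> 0"
  proof (rule L2norm_dominated[OF _ _ ind])
    have "AE x in lebesgue. x \<notin> N"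
      using N AE_not_in[of N lebesgue] by (simp add: negligible_iff_null_sets)
    then show "AE x in lebesgue. (\<lambda>n. h n x) \<longlonglongrightarrow> T k x"
    proof eventually_elim
      case (elim x)
      have "(\<lambda>n. clip c (g n x)) \<longlonglongrightarrow> clip c (T k x)"
        using continuous_on_tendsto_compose[OF clip_continuous[OF c, of UNIV] lim[OF elim]] by simp
      then have "(\<lambda>n. h n x) \<longlonglongrightarrow> clip c (T k x) * cut x"
        unfolding h_def by (intro tendsto_mult tendsto_const)
      moreover have "clip c (T k x) * cut x = T k x"
        using clip_eq[OF c Tb[of x]] Tz[of x] by (cases "norm x > c") (auto simp: cut_def)
      ultimately show ?case by simp
    qed
  qed (use dom in auto)
  then obtain n where n: "L2norm (\<lambda>x. T k x - h n x) < e/2"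
    using LIMSEQ_D[of "\<lambda>n. L2norm (\<lambda>x. T k x - h n x)" 0 "e/2"] e by force
  have Lh: "L2 (h n)"
  proof (rule L2_bound[OF hm ind])
    show "(cmod (h n x))\<^sup>2 \<le> (2 * c)\<^sup>2 * indicator (cball 0 (c + 1)) x" for x
    proof (cases "norm x \<le> c + 1")
      case True
      have "(cmod (h n x))^2 \<le> (2 * c)^2" using hb[of n x] c by (intro power_mono) auto
      with True show ?thesis by simp
    qed (simp add: hz)
  qed
  have LT: "L2 (T k)"
    by (rule L2_bound[OF mT L2_integrable[OF f]]) (simp add: T_def)
  have "L2norm (\<lambda>x. f x - h n x) < e"
    using L2norm_triangle3[OF f LT Lh] kT n by linarith
  moreover have "bounded {x. h n x \<noteq> 0}"
    by (rule boundedI[of _ "c + 1"]) (use hz[of _ n] not_le_imp_less in blast)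
  ultimately show ?thesis using hc[of n] Lh that by blast
qed

lemma L2_translation_tendsto:
  assumes f: "L2 f" and s: "s \<longlonglongrightarrow> (0::'a::euclidean_space)"
  shows "(\<lambda>n. L2norm (\<lambda>t. f t - f (t + s n))) \<longlonglongrightarrow> 0"
proof (rule LIMSEQ_I)
  fix e :: real assume e: "e > 0"
  obtain h where h: "continuous_on UNIV h" "bounded {x. h x \<noteq> 0}" "L2 h" "L2norm (\<lambda>x. f x - h x) < e/3"
    using continuous_dense_L2[OF f, of "e/3"] e by auto
  obtain r where r: "\<And>x. h x \<noteq> 0 \<Longrightarrow> norm x \<le> r" using h(2) unfolding bounded_iff by blast
  have "bounded (h ` cball 0 r)"
    by (intro compact_imp_bounded compact_continuous_image continuous_on_subset[OF h(1)]) auto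
  then obtain M0 where "\<forall>x\<in>cball 0 r. cmod (h x) \<le> M0" unfolding bounded_iff by auto
  then have "cmod (h x) \<le> M0" if "norm x \<le> r" for x using that by simp
  then have M: "cmod (h x) \<le> max M0 0" for x using r[of x] by (cases "h x = 0") (auto simp: le_max_iff_disj)
  define M where "M = max M0 0"
  have M': "cmod (h x) \<le> M" "0 \<le> M" for x using M by (auto simp: M_def)
  have hm [measurable]: "h \<in> borel_measurable lebesgue" using h(3) by (simp add: L2_def)
  have ind: "integrable lebesgue (\<lambda>x::'a. (2 * M)^2 * indicator (cball 0 (r + 1)) x)"
    by (intro integrable_mult_right) (use emeasure_lborel_cball_finite[of "0::'a" "r+1"] in \<open>simp add: integrable_completion integrable_indicator_iff\<close>)
  \<comment> \<open>Discarding finitely many terms keeps the shifts below 1, so that one ball of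
    radius r + 1 carries all the differences.\<close>
  obtain n1 where n1: "\<And>n. n \<ge> n1 \<Longrightarrow> norm (s n) \<le> 1"
    using LIMSEQ_D[OF s, of 1] by (auto intro: less_imp_le)
  have "(\<lambda>n. L2norm (\<lambda>t. h t - h (t + s (n + n1)))) \<longlonglongrightarrow> 0"
  proof (rule L2norm_dominated[OF _ _ ind])
    show "(\<lambda>t. h (t + s (n + n1))) \<in> borel_measurable lebesgue" for n
      by (rule measurable_compose[OF lebesgue_translation_measurable hm])
    show "AE x in lebesgue. (cmod (h x - h (x + s (n + n1))))\<^sup>2 \<le> (2 * M)\<^sup>2 * indicator (cball 0 (r + 1)) x" for n
    proof (rule AE_I2)
      fix x
      show "(cmod (h x - h (x + s (n + n1))))\<^sup>2 \<le> (2 * M)\<^sup>2 * indicator (cball 0 (r + 1)) x"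
      proof (cases "norm x \<le> r + 1")
        case True
        have "cmod (h x - h (x + s (n + n1))) \<le> cmod (h x) + cmod (h (x + s (n + n1)))" by (rule norm_triangle_ineq4)
        then have "cmod (h x - h (x + s (n + n1))) \<le> 2 * M" using M'(1)[of x] M'(1)[of "x + s (n + n1)"] by linarith
        then have "(cmod (h x - h (x + s (n + n1))))^2 \<le> (2 * M)^2" by (intro power_mono) auto
        with True show ?thesis by simp
      next
        case False
        have "norm x \<le> norm (x + s (n + n1)) + norm (s (n + n1))" using norm_triangle_ineq4[of "x + s (n+n1)" "s (n+n1)"] by simp
        then have "norm (x + s (n + n1)) > r" using False n1[of "n + n1"] by simp
        then show ?thesis using False r[of x] r[of "x + s (n + n1)"] by fastforce
      qed
    qed
    show "AE x in lebesgue. (\<lambda>n. h (x + s (n + n1))) \<longlonglongrightarrow> h x"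
    proof (rule AE_I2)
      fix x
      have "(\<lambda>n. x + s (n + n1)) \<longlonglongrightarrow> x + 0" by (intro tendsto_intros LIMSEQ_ignore_initial_segment s)
      then show "(\<lambda>n. h (x + s (n + n1))) \<longlonglongrightarrow> h x"
        using continuous_on_tendsto_compose[OF h(1)] by simp
    qed
  qed simp
  then have "(\<lambda>n. L2norm (\<lambda>t. h t - h (t + s n))) \<longlonglongrightarrow> 0"
    by (rule LIMSEQ_offset)
  then obtain n0 where n0: "\<And>n. n \<ge> n0 \<Longrightarrow> L2norm (\<lambda>t. h t - h (t + s n)) < e/3"
    using LIMSEQ_D[of "\<lambda>n. L2norm (\<lambda>t. h t - h (t + s n))" 0 "e/3"] e by auto
  show "\<exists>n0. \<forall>n\<ge>n0. norm (L2norm (\<lambda>t. f t - f (t + s n)) - 0) < e"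
  proof (intro exI allI impI)
    fix n assume n: "n \<ge> n0"
    have 1: "L2norm (\<lambda>t. f t - f (t + s n)) \<le> L2norm (\<lambda>t. f t - h t) + L2norm (\<lambda>t. h t - f (t + s n))"
      by (intro L2norm_triangle3 f h L2_translate)
    have 2: "L2norm (\<lambda>t. h t - f (t + s n)) \<le> L2norm (\<lambda>t. h t - h (t + s n)) + L2norm (\<lambda>t. h (t + s n) - f (t + s n))"
      by (intro L2norm_triangle3 f h L2_translate)
    have 3: "L2norm (\<lambda>t. h (t + s n) - f (t + s n)) = L2norm (\<lambda>t. f t - h t)"
      using L2norm_translate[OF L2_diff[OF h(3) f], of "s n"] L2norm_commute[of h f] by simp
    show "norm (L2norm (\<lambda>t. f t - f (t + s n)) - 0) < e"
      using 1 2 3 n0[OF n] h(4) by simp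
  qed
qed

lemma L2_translation_tendsto':
  assumes f: "L2 f" and s: "s \<longlonglongrightarrow> (x::'a::euclidean_space)"
  shows "(\<lambda>n. L2norm (\<lambda>t. f (t + s n) - f (t + x))) \<longlonglongrightarrow> 0"
proof -
  have "(\<lambda>n. s n - x) \<longlonglongrightarrow> x - x" by (intro tendsto_intros s)
  then have "(\<lambda>n. L2norm (\<lambda>t. f t - f (t + (s n - x)))) \<longlonglongrightarrow> 0"
    by (intro L2_translation_tendsto f) simp
  moreover have "L2norm (\<lambda>t. f t - f (t + (s n - x))) = L2norm (\<lambda>t. f (t + s n) - f (t + x))" for n
  proof -
    have "L2norm (\<lambda>t. (f t - f (t + (s n - x)))) = L2norm (\<lambda>t. (f (t + x) - f ((t + x) + (s n - x))))"
      by (rule L2norm_translate[symmetric]) (intro L2_diff f L2_translate)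
    then show ?thesis using L2norm_commute[of "\<lambda>t. f (t + x)"] by simp
  qed
  ultimately show ?thesis by simp
qed

text \<open>The value at 0 is the squared norm of \<open>u\<close>; in Plancherel's theorem Gaussian
  averages of this function have to converge to it.\<close>

lemma autocorrelation_continuous:
  assumes u: "L2 u"
  shows "continuous_on UNIV (\<lambda>v. L2inner u (\<lambda>t. u (t + v)))"
proof (rule continuous_at_imp_continuous_on, intro ballI)
  fix v
  show "isCont (\<lambda>v. L2inner u (\<lambda>t. u (t + v))) v"
    unfolding continuous_at_sequentially
  proof (intro allI impI)
    fix s assume s: "s \<longlonglongrightarrow> v"
    have "(\<lambda>n. L2inner u (\<lambda>t. u (t + s n)) - L2inner u (\<lambda>t. u (t + v))) \<longlonglongrightarrow> 0"
    proof (rule Lim_null_comparison)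
      show "\<forall>\<^sub>F n in sequentially. norm (L2inner u (\<lambda>t. u (t + s n)) - L2inner u (\<lambda>t. u (t + v)))
          \<le> L2norm u * L2norm (\<lambda>t. u (t + s n) - u (t + v))"
        using L2_Cauchy_Schwarz[OF u L2_diff[OF L2_translate[OF u] L2_translate[OF u]]]
        by (simp add: L2inner_diff_right u L2_translate)
      show "(\<lambda>n. L2norm u * L2norm (\<lambda>t. u (t + s n) - u (t + v))) \<longlonglongrightarrow> 0"
        using tendsto_mult_right_zero[OF L2_translation_tendsto'[OF u s]] .
    qed
    then show "((\<lambda>v. L2inner u (\<lambda>t. u (t + v))) \<circ> s) \<longlonglongrightarrow> L2inner u (\<lambda>t. u (t + v))"
      by (simp add: o_def LIM_zero_iff)
  qed
qed

section \<open>Plancherel's theorem\<close>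

lemma cnj_measurable [measurable]: "cnj \<in> borel_measurable borel"
  by (intro borel_measurable_continuous_onI continuous_intros)

lemma L2inner_lborel:
  assumes "f \<in> borel_measurable borel" "h \<in> borel_measurable borel"
  shows "L2inner f h = (\<integral>x. f x * cnj (h x) \<partial>lborel)"
  unfolding L2inner_def
proof (rule integral_completion)
  note [measurable] = assms
  show "(\<lambda>x. f x * cnj (h x)) \<in> borel_measurable lborel" by measurable
qed

text \<open>The integral of |fourier u|^2 against a wide Gaussian equals the average of the
  autocorrelation of \<open>u\<close> against a narrow one. Continuity of the autocorrelation at 0
  gives the limit of the latter, monotone convergence that of the former.\<close>

lemma plancherel:
  fixes u :: "'a::euclidean_space \<Rightarrow> complex"
  assumes u [measurable]: "u \<in> borel_measurable borel" and L1: "integrable lborel u" and L2: "L2 u"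
  shows "(\<integral>\<^sup>+x. ennreal ((cmod (fourier u x))^2) \<partial>lborel) = (\<integral>\<^sup>+x. ennreal ((cmod (u x))^2) \<partial>lborel)"
proof -
  define g where "g n x = complex_of_real (gauss ((x::'a) /\<^sub>R real (Suc n)))" for n x
  have gi: "integrable lborel (g n)" for n
    using integrable_lborel_affine[OF integrable_of_real[OF gauss_integrable], of "inverse (real (Suc n))" 0]
    by (simp add: g_def[abs_def] del: of_nat_Suc)
  have [measurable]: "g n \<in> borel_measurable borel" for n unfolding g_def by measurable
  have [measurable]: "fourier u \<in> borel_measurable borel" by (rule fourier_measurable[OF L1])
  define A where "A v = L2inner u (\<lambda>t. u (t + v))" for v
  have A_eq: "A v = (\<integral>t. u t * cnj (u (t + v)) \<partial>lborel)" for v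
    unfolding A_def by (rule L2inner_lborel) measurable
  have Ac: "continuous_on UNIV A" unfolding A_def by (rule autocorrelation_continuous[OF L2])
  have A_le: "cmod (A v) \<le> L2norm u * L2norm u" for v
    using L2_Cauchy_Schwarz[OF L2 L2_translate[OF L2, of v]] by (simp add: A_def L2norm_translate L2)
  have A0: "A 0 = complex_of_real ((L2norm u)^2)" by (simp add: A_def L2inner_self)
  have nn2: "(\<integral>\<^sup>+t. ennreal (cmod (u t) * cmod (u (t + v))) \<partial>lborel) \<le> ennreal (L2norm u * L2norm u)" for v
  proof -
    have "(\<integral>\<^sup>+t. ennreal (cmod (u t) * cmod (u (t + v))) \<partial>lborel) =
        (\<integral>\<^sup>+t. ennreal (cmod (u t) * cmod (u (t + v))) \<partial>lebesgue)"
      by (rule nn_integral_completion[symmetric])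
    also have "\<dots> = ennreal (\<integral>t. cmod (u t) * cmod (u (t + v)) \<partial>lebesgue)"
      by (rule nn_integral_eq_integral[OF L2_abs_mult_integrable[OF L2 L2_translate[OF L2]]]) simp
    also have "\<dots> \<le> ennreal (L2norm u * L2norm u)"
      using abs_integral_sq_le[OF L2 L2_translate[OF L2, of v]] by (simp add: L2norm_translate L2 ennreal_leI)
    finally show ?thesis .
  qed
  have I: "(\<integral>x. fourier u x * (cnj (fourier u x) * g n x) \<partial>lborel) =
      (\<integral>s. A (s /\<^sub>R real (Suc n)) * complex_of_real (gauss s) \<partial>lborel)" for n
  proof -
    define r where "r = inverse (real (Suc n))"
    define C where "C = (\<integral>x. cmod (u x) \<partial>lborel)"
    have "cmod (cnj (fourier u x)) \<le> C" for x using norm_fourier_le[OF L1] by (simp add: C_def)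
    then have vi: "integrable lborel (\<lambda>x. cnj (fourier u x) * g n x)"
      by (intro integrable_mult_bounded_fourier[OF _ _ gi]) measurable
    \<comment> \<open>A smoothed inversion formula: the Gaussian factor turns the transform of the
      conjugate transform into an average of translates of the conjugate of
      \<open>u\<close>.\<close>
    have ft: "fourier (\<lambda>x. cnj (fourier u x) * g n x) t = (\<integral>s. cnj (u (t + r *\<^sub>R s)) * complex_of_real (gauss s) \<partial>lborel)" for t
    proof -
      have it: "integrable lborel (\<lambda>x. u (x + t))" using L1 by (simp only: integrable_lborel_translate)
      have "fourier (\<lambda>x. cnj (fourier u x) * g n x) t =
          (\<integral>x. cnj (fourier u x) * g n x * cis (- 2 * pi * (x \<bullet> t)) \<partial>lborel)"
        by (rule fourier_lborel) measurable
      also have "\<dots> = (\<integral>x. cnj (fourier (\<lambda>x. u (x + t)) x * g n x) \<partial>lborel)"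
        by (rule Bochner_Integration.integral_cong)
          (auto simp: fourier_translate[OF u] g_def cis_cnj inner_commute mult_ac)
      also have "\<dots> = cnj (\<integral>x. fourier (\<lambda>x. u (x + t)) x * g n x \<partial>lborel)"
        by (rule Bochner_Integration.integral_cnj)
      also have "\<dots> = cnj (\<integral>s. u (s /\<^sub>R real (Suc n) + t) * complex_of_real (gauss s) \<partial>lborel)"
        unfolding g_def integral_fourier_mult_gauss[OF it] ..
      also have "\<dots> = (\<integral>s. cnj (u (s /\<^sub>R real (Suc n) + t) * complex_of_real (gauss s)) \<partial>lborel)"
        by (rule Bochner_Integration.integral_cnj[symmetric])
      finally show ?thesis by (simp add: r_def add.commute)
    qed
    have "(\<integral>x. fourier u x * (cnj (fourier u x) * g n x) \<partial>lborel) =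
        (\<integral>t. u t * (\<integral>s. cnj (u (t + r *\<^sub>R s)) * complex_of_real (gauss s) \<partial>lborel) \<partial>lborel)"
      using fourier_multiplication_formula[OF L1 vi] by (simp only: ft)
    also have "\<dots> = (\<integral>t. \<integral>s. u t * (cnj (u (t + r *\<^sub>R s)) * complex_of_real (gauss s)) \<partial>lborel \<partial>lborel)"
      by simp
    also have "\<dots> = (\<integral>s. \<integral>t. u t * (cnj (u (t + r *\<^sub>R s)) * complex_of_real (gauss s)) \<partial>lborel \<partial>lborel)"
    \<comment> \<open>Absolute integrability: for fixed s the integral in t is at most the squared
      L2 norm, by Cauchy-Schwarz, and the Gaussian is integrable in s.\<close>
    proof (rule lborel_pair.Fubini_integral[symmetric], rule integrableI_bounded)
      show m: "(\<lambda>(t, s). u t * (cnj (u (t + r *\<^sub>R s)) * complex_of_real (gauss s))) \<in> borel_measurable (lborel \<Otimes>\<^sub>M lborel)"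
        unfolding case_prod_beta by measurable
      have "(\<integral>\<^sup>+ p. ennreal (norm (case p of (t, s) \<Rightarrow> u t * (cnj (u (t + r *\<^sub>R s)) * complex_of_real (gauss s)))) \<partial>(lborel \<Otimes>\<^sub>M lborel))
        = (\<integral>\<^sup>+ s. \<integral>\<^sup>+ t. ennreal (norm (u t * (cnj (u (t + r *\<^sub>R s)) * complex_of_real (gauss s)))) \<partial>lborel \<partial>lborel)"
        by (subst lborel_pair.nn_integral_snd[symmetric]) (use m in \<open>auto simp: case_prod_beta\<close>)
      also have "\<dots> \<le> (\<integral>\<^sup>+ s. ennreal (gauss s) * ennreal (L2norm u * L2norm u) \<partial>(lborel :: 'a measure))"
      proof (rule nn_integral_mono)
        fix s :: 'a
        have "(\<integral>\<^sup>+ t. ennreal (norm (u t * (cnj (u (t + r *\<^sub>R s)) * complex_of_real (gauss s)))) \<partial>lborel)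
          = (\<integral>\<^sup>+ t. ennreal (gauss s) * ennreal (cmod (u t) * cmod (u (t + r *\<^sub>R s))) \<partial>lborel)"
          by (rule nn_integral_cong) (simp add: norm_mult gauss_nonneg ennreal_mult[symmetric] mult_ac)
        also have "\<dots> = ennreal (gauss s) * (\<integral>\<^sup>+ t. ennreal (cmod (u t) * cmod (u (t + r *\<^sub>R s))) \<partial>lborel)"
          by (rule nn_integral_cmult) measurable
        also have "\<dots> \<le> ennreal (gauss s) * ennreal (L2norm u * L2norm u)"
          by (intro mult_left_mono nn2) simp
        finally show "(\<integral>\<^sup>+ t. ennreal (norm (u t * (cnj (u (t + r *\<^sub>R s)) * complex_of_real (gauss s)))) \<partial>lborel)
            \<le> ennreal (gauss s) * ennreal (L2norm u * L2norm u)" .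
      qed
      also have "\<dots> = (\<integral>\<^sup>+ s. ennreal (gauss (s::'a)) \<partial>lborel) * ennreal (L2norm u * L2norm u)"
        by (rule nn_integral_multc) measurable
      also have "\<dots> < \<infinity>"
      proof -
        have "(\<integral>\<^sup>+ s. ennreal (gauss (s::'a)) \<partial>lborel) = ennreal (\<integral>s. gauss (s::'a) \<partial>lborel)"
          by (rule nn_integral_eq_integral[OF gauss_integrable]) (simp add: gauss_nonneg)
        then show ?thesis by (simp add: ennreal_mult_less_top)
      qed
      finally show "(\<integral>\<^sup>+ p. ennreal (norm (case p of (t, s) \<Rightarrow> u t * (cnj (u (t + r *\<^sub>R s)) * complex_of_real (gauss s)))) \<partial>(lborel \<Otimes>\<^sub>M lborel)) < \<infinity>" .
    qed
    also have "\<dots> = (\<integral>s. A (r *\<^sub>R s) * complex_of_real (gauss s) \<partial>lborel)"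
      unfolding A_eq by (simp add: mult.assoc[symmetric])
    finally show ?thesis by (simp add: r_def)
  qed
  have lim: "(\<lambda>n. \<integral>x. fourier u x * (cnj (fourier u x) * g n x) \<partial>lborel) \<longlonglongrightarrow> A 0"
    unfolding I
    by (rule integral_dilated_gauss_tendsto[OF borel_measurable_continuous_onI[OF Ac] A_le])
      (use Ac in \<open>simp add: continuous_on_eq_continuous_at\<close>)
  define P where "P n x = (cmod (fourier u x))^2 * gauss (x /\<^sub>R real (Suc n))" for n x
  have Pint: "integrable lborel (P n)" for n
  proof (rule Bochner_Integration.integrable_bound)
    define C where "C = (\<integral>x. cmod (u x) \<partial>lborel)"
    have C: "cmod (fourier u x) \<le> C" for x using norm_fourier_le[OF L1] by (simp add: C_def)
    show "integrable lborel (\<lambda>x. C^2 * cmod (g n x))" using gi[of n] by simp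
    show "AE x in lborel. norm (P n x) \<le> norm (C^2 * cmod (g n x))"
      by (intro AE_I2) (auto simp: P_def g_def abs_mult gauss_nonneg intro!: mult_right_mono power_mono C)
    show "P n \<in> borel_measurable lborel" unfolding P_def by measurable
  qed
  have "(\<lambda>n. complex_of_real (\<integral>x. P n x \<partial>lborel)) \<longlonglongrightarrow> complex_of_real ((L2norm u)^2)"
  proof -
    have "(\<integral>x. fourier u x * (cnj (fourier u x) * g n x) \<partial>lborel) = (\<integral>x. complex_of_real (P n x) \<partial>lborel)" for n
      by (rule Bochner_Integration.integral_cong)
        (auto simp: P_def g_def complex_norm_square mult.assoc simp del: of_real_power)
    then show ?thesis using lim by (simp add: A0)
  qed
  then have limP: "(\<lambda>n. \<integral>x. P n x \<partial>lborel) \<longlonglongrightarrow> (L2norm u)^2"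
    by (simp only: tendsto_of_real_iff)
  have Pnn: "(\<integral>\<^sup>+x. ennreal (P n x) \<partial>lborel) = ennreal (\<integral>x. P n x \<partial>lborel)" for n
    by (rule nn_integral_eq_integral[OF Pint]) (auto simp: P_def gauss_nonneg)
  \<comment> \<open>Wider Gaussians are pointwise larger, so monotone convergence applies although
    |fourier u|^2 is not yet known to be integrable.\<close>
  have Pmono: "incseq (\<lambda>n x. ennreal (P n x))"
  proof (rule incseq_SucI, rule le_funI, rule ennreal_leI)
    fix n and x :: 'a
    have "norm (x /\<^sub>R real (Suc (Suc n))) \<le> norm (x /\<^sub>R real (Suc n))"
      by (simp add: divide_simps mult_left_mono)
    then have "(norm (x /\<^sub>R real (Suc (Suc n))))^2 \<le> (norm (x /\<^sub>R real (Suc n)))^2" by (intro power_mono) auto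
    then show "P n x \<le> P (Suc n) x"
      unfolding P_def gauss_def by (intro mult_left_mono) auto
  qed
  have Psup: "(SUP n. ennreal (P n x)) = ennreal ((cmod (fourier u x))^2)" for x
  proof (rule LIMSEQ_unique[OF LIMSEQ_SUP])
    show "incseq (\<lambda>n. ennreal (P n x))" using Pmono by (auto simp: incseq_def le_fun_def)
    have "(\<lambda>n. P n x) \<longlonglongrightarrow> (cmod (fourier u x))^2 * 1"
      unfolding P_def by (intro tendsto_mult tendsto_const gauss_dilated_tendsto)
    then show "(\<lambda>n. ennreal (P n x)) \<longlonglongrightarrow> ennreal ((cmod (fourier u x))^2)"
      by (intro tendsto_ennrealI) simp
  qed
  have "(\<integral>\<^sup>+x. ennreal ((cmod (fourier u x))^2) \<partial>lborel) = (SUP n. \<integral>\<^sup>+x. ennreal (P n x) \<partial>lborel)"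
    unfolding Psup[symmetric]
    by (rule nn_integral_monotone_convergence_SUP[OF Pmono]) (simp add: P_def)
  also have "\<dots> = ennreal ((L2norm u)^2)"
  proof (rule LIMSEQ_unique[OF LIMSEQ_SUP])
    show "incseq (\<lambda>n. \<integral>\<^sup>+x. ennreal (P n x) \<partial>lborel)"
      using Pmono by (auto simp: incseq_def le_fun_def intro!: nn_integral_mono)
    show "(\<lambda>n. \<integral>\<^sup>+x. ennreal (P n x) \<partial>lborel) \<longlonglongrightarrow> ennreal ((L2norm u)^2)"
      unfolding Pnn by (intro tendsto_ennrealI limP)
  qed
  also have "\<dots> = (\<integral>\<^sup>+x. ennreal ((cmod (u x))^2) \<partial>lborel)"
    by (simp add: L2norm_ennreal[OF L2] nn_integral_completion)
  finally show ?thesis .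
qed

section \<open>The short-time Fourier transform\<close>

lemma L2_modulate_cnj:
  assumes g: "L2 g"
  shows "L2 (\<lambda>t. cis (2 * pi * (t \<bullet> w)) * g (t + x))"
proof -
  have "(\<lambda>t::'a. cis (2 * pi * (t \<bullet> w))) \<in> borel_measurable borel" by measurable
  then have "(\<lambda>t::'a. cis (2 * pi * (t \<bullet> w))) \<in> borel_measurable lebesgue" by (simp add: measurable_completion)
  with L2_translate[OF g, of x] show ?thesis by (auto simp: L2_def norm_mult)
qed

lemma stft_inner: "stft g f (x, w) = L2inner f (\<lambda>t. cis (2 * pi * (t \<bullet> w)) * g (t + - x))"
  unfolding stft_def L2inner_def by (simp add: cis_cnj mult_ac)

lemma L2norm_modulate_cnj:
  "L2 g \<Longrightarrow> L2norm (\<lambda>t. cis (2 * pi * (t \<bullet> w)) * g (t + x)) = L2norm g"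
  using L2norm_translate[of g x] by (simp add: L2norm_def norm_mult)

lemma stft_bound:
  assumes "L2 f" "L2 g"
  shows "cmod (stft g f z) \<le> L2norm f * L2norm g"
proof (cases z)
  case (Pair x w)
  then show ?thesis
    using L2_Cauchy_Schwarz[OF assms(1) L2_modulate_cnj[OF assms(2), of w "- x"]]
    by (simp only: stft_inner L2norm_modulate_cnj assms)
qed

text \<open>The shift of the window is controlled by L2-continuity of translation, uniformly in the
  frequency. With the shift frozen at x, the frequency is handled by dominated convergence.\<close>

lemma stft_continuous:
  fixes f g :: "real^'n \<Rightarrow> complex"
  assumes f: "L2 f" and g: "L2 g"
  shows "continuous_on UNIV (stft g f)"
proof (rule continuous_at_imp_continuous_on, intro ballI)
  fix z :: "(real^'n) \<times> (real^'n)"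
  obtain x w where z: "z = (x, w)" by (cases z)
  show "isCont (stft g f) z"
    unfolding continuous_at_sequentially
  proof (intro allI impI)
    fix s assume s: "s \<longlonglongrightarrow> z"
    have sx: "(\<lambda>n. fst (s n)) \<longlonglongrightarrow> x" and sw: "(\<lambda>n. snd (s n)) \<longlonglongrightarrow> w"
      using tendsto_fst[OF s] tendsto_snd[OF s] by (simp_all add: z)
    have 1: "(\<lambda>n. stft g f (s n) - stft g f (x, snd (s n))) \<longlonglongrightarrow> 0"
    proof (rule Lim_null_comparison)
      have "cmod (stft g f (s n) - stft g f (x, snd (s n))) \<le> L2norm f * L2norm (\<lambda>t. g (t + - fst (s n)) - g (t + - x))" for n
      proof -
        let ?D = "\<lambda>t. cis (2 * pi * (t \<bullet> snd (s n))) * g (t + - fst (s n)) - cis (2 * pi * (t \<bullet> snd (s n))) * g (t + - x)"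
        have "stft g f (s n) - stft g f (x, snd (s n)) = L2inner f ?D"
          using stft_inner[of g f "fst (s n)" "snd (s n)"]
          by (simp only: L2inner_diff_right L2_modulate_cnj f g stft_inner prod.collapse)
        then have "cmod (stft g f (s n) - stft g f (x, snd (s n))) \<le> L2norm f * L2norm ?D"
          using L2_Cauchy_Schwarz[OF f L2_diff[OF L2_modulate_cnj[OF g] L2_modulate_cnj[OF g]]] by (simp only:)
        also have "L2norm ?D = L2norm (\<lambda>t. g (t + - fst (s n)) - g (t + - x))"
          by (simp add: L2norm_def norm_mult right_diff_distrib[symmetric])
        finally show ?thesis .
      qed
      then show "\<forall>\<^sub>F n in sequentially. norm (stft g f (s n) - stft g f (x, snd (s n))) \<le> L2norm f * L2norm (\<lambda>t. g (t + - fst (s n)) - g (t + - x))"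
        by simp
      show "(\<lambda>n. L2norm f * L2norm (\<lambda>t. g (t + - fst (s n)) - g (t + - x))) \<longlonglongrightarrow> 0"
        by (intro tendsto_mult_right_zero L2_translation_tendsto' g tendsto_intros sx)
    qed
    have i: "integrable lebesgue (\<lambda>t. f t * cnj (g (t + - x)))"
      by (rule L2_mult_integrable[OF f L2_translate[OF g]])
    have cm: "(\<lambda>t::real^'n. cis (h t)) \<in> borel_measurable lebesgue" if "h \<in> borel_measurable borel" for h
      using measurable_compose[OF that cis_measurable] by (simp add: measurable_completion)
    have 2: "(\<lambda>n. stft g f (x, snd (s n))) \<longlonglongrightarrow> stft g f (x, w)"
      unfolding stft_def prod.case
    proof (rule integral_dominated_convergence[where w = "\<lambda>t. cmod (f t * cnj (g (t + - x)))"])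
      show "integrable lebesgue (\<lambda>t. cmod (f t * cnj (g (t + - x))))" using i by (rule integrable_norm)
      show "(\<lambda>t. f t * cnj (g (t - x)) * cis (- 2 * pi * (t \<bullet> w))) \<in> borel_measurable lebesgue"
        "(\<lambda>t. f t * cnj (g (t - x)) * cis (- 2 * pi * (t \<bullet> snd (s n)))) \<in> borel_measurable lebesgue" for n
        using borel_measurable_times[OF borel_measurable_integrable[OF i] cm[of "\<lambda>t. - 2 * pi * (t \<bullet> w)"]]
          borel_measurable_times[OF borel_measurable_integrable[OF i] cm[of "\<lambda>t. - 2 * pi * (t \<bullet> snd (s n))"]]
        by simp_all
      show "AE t in lebesgue. (\<lambda>n. f t * cnj (g (t - x)) * cis (- 2 * pi * (t \<bullet> snd (s n)))) \<longlonglongrightarrow>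
            f t * cnj (g (t - x)) * cis (- 2 * pi * (t \<bullet> w))"
        by (intro AE_I2 tendsto_intros sw)
    qed (simp add: norm_mult)
    show "(stft g f \<circ> s) \<longlonglongrightarrow> stft g f z"
      using tendsto_add[OF 1 2] by (simp add: o_def z)
  qed
qed

lemma stft_cong_AE:
  assumes "AE t in lebesgue. f t = f' t" "AE t in lebesgue. g t = g' t"
    "L2 f" "L2 g" "L2 f'" "L2 g'"
  shows "stft g f z = stft g' f' z"
proof (cases z)
  case (Pair x w)
  have "AE t in lebesgue. g (t + - x) = g' (t + - x)"
    by (rule AE_distrD[OF lebesgue_translation_measurable[of "- x"], of "\<lambda>t. g t = g' t"])
      (unfold lebesgue_distr_translation, rule assms(2))
  with assms(1) have ae: "AE t in lebesgue. f t * cnj (cis (2 * pi * (t \<bullet> w)) * g (t + - x)) =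
      f' t * cnj (cis (2 * pi * (t \<bullet> w)) * g' (t + - x))"
    by eventually_elim simp
  show ?thesis
    unfolding Pair stft_inner L2inner_def
    by (rule integral_cong_AE[OF _ _ ae])
      (intro borel_measurable_integrable L2_mult_integrable L2_modulate_cnj assms)+
qed

text \<open>For fixed x the function of w is the Fourier transform of t \<mapsto> f(t) cnj(g(t -
  x)). Plancherel in w, integrated over x, reduces the claim to Tonelli for this product, where the
  x-integral of |g(t - x)|^2 does not depend on t.\<close>

theorem stft_isometry:
  fixes f g :: "real^'n \<Rightarrow> complex"
  assumes f: "L2 f" and g: "L2 g"
  shows "(\<integral>\<^sup>+z. ennreal ((cmod (stft g f z))^2) \<partial>lborel) = ennreal ((L2norm f)^2 * (L2norm g)^2)"
proof -
  obtain f' where f': "f' \<in> borel_measurable borel" "AE x in lebesgue. f x = f' x"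
    using borel_representative[OF L2_measurable[OF f]] by blast
  obtain g' where g': "g' \<in> borel_measurable borel" "AE x in lebesgue. g x = g' x"
    using borel_representative[OF L2_measurable[OF g]] by blast
  note [measurable] = f'(1) g'(1)
  have Lrep: "L2 k'" if "L2 k" "k' \<in> borel_measurable borel" "AE x in lebesgue. k x = k' x" for k k' :: "real^'n \<Rightarrow> complex"
  proof -
    have m: "k' \<in> borel_measurable lebesgue" using that by (simp add: measurable_completion)
    have "integrable lebesgue (\<lambda>x. (cmod (k' x))^2)"
    proof (rule integrable_cong_AE_imp[OF L2_integrable[OF that(1)]])
      show "AE x in lebesgue. (cmod (k x))\<^sup>2 = (cmod (k' x))\<^sup>2" using that(3) by eventually_elim simp
    qed (use m in auto)
    with m show ?thesis by (simp add: L2_def)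
  qed
  have Lf: "L2 f'" and Lg: "L2 g'" by (rule Lrep[OF f f'], rule Lrep[OF g g'])
  have Nf: "L2norm f' = L2norm f" "L2norm g' = L2norm g"
    using L2norm_cong_AE[OF f'(2) L2_measurable[OF f] L2_measurable[OF Lf]]
      L2norm_cong_AE[OF g'(2) L2_measurable[OF g] L2_measurable[OF Lg]] by auto
  define u where "u x t = f' t * cnj (g' (t - x))" for x t :: "real^'n"
  have um: "(\<lambda>p. u (fst p) (snd p)) \<in> borel_measurable (lborel \<Otimes>\<^sub>M lborel)"
    unfolding u_def by measurable
  have u_meas [measurable]: "u x \<in> borel_measurable borel" for x unfolding u_def by measurable
  have u1: "integrable lborel (u x)" for x
    using L2_mult_integrable[OF Lf L2_translate[OF Lg, of "- x"]] u_meas[of x]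
    by (simp add: u_def[abs_def] integrable_completion)
  have V: "stft g f (x, w) = fourier (u x) w" for x w
    by (subst stft_cong_AE[OF f'(2) g'(2) f g Lf Lg]) (simp add: stft_def fourier_def u_def mult.assoc)
  have tot: "(\<integral>\<^sup>+x. \<integral>\<^sup>+t. ennreal ((cmod (u x t))^2) \<partial>lborel \<partial>lborel) = ennreal ((L2norm f)^2 * (L2norm g)^2)"
  proof -
    have "(\<integral>\<^sup>+x. \<integral>\<^sup>+t. ennreal ((cmod (u x t))^2) \<partial>lborel \<partial>lborel) =
       (\<integral>\<^sup>+t. \<integral>\<^sup>+x. ennreal ((cmod (u x t))^2) \<partial>lborel \<partial>lborel)"
      by (rule lborel_pair.Fubini'[symmetric]) (use um in \<open>simp add: case_prod_beta\<close>)
    also have "\<dots> = (\<integral>\<^sup>+t. ennreal ((cmod (f' t))^2) * ennreal ((L2norm g)^2) \<partial>lborel)"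
    proof (rule nn_integral_cong)
      fix t
      have "(\<integral>\<^sup>+x. ennreal ((cmod (u x t))^2) \<partial>lborel) = (\<integral>\<^sup>+x. ennreal ((cmod (f' t))^2) * ennreal ((cmod (g' (t - x)))^2) \<partial>lborel)"
        by (simp add: u_def norm_mult power_mult_distrib ennreal_mult)
      also have "\<dots> = ennreal ((cmod (f' t))^2) * (\<integral>\<^sup>+x. ennreal ((cmod (g' (t - x)))^2) \<partial>lborel)"
        by (rule nn_integral_cmult) measurable
      also have "(\<integral>\<^sup>+x. ennreal ((cmod (g' (t - x)))^2) \<partial>lborel) = (\<integral>\<^sup>+x. ennreal ((cmod (g' x))^2) \<partial>lborel)"
        by (rule nn_integral_lborel_reflect) measurable
      finally show "(\<integral>\<^sup>+x. ennreal ((cmod (u x t))^2) \<partial>lborel) = ennreal ((cmod (f' t))^2) * ennreal ((L2norm g)^2)"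
        using L2norm_ennreal[OF Lg] by (simp add: nn_integral_completion Nf)
    qed
    also have "\<dots> = (\<integral>\<^sup>+t. ennreal ((cmod (f' t))^2) \<partial>lborel) * ennreal ((L2norm g)^2)"
      by (rule nn_integral_multc) measurable
    also have "(\<integral>\<^sup>+t. ennreal ((cmod (f' t))^2) \<partial>lborel) = ennreal ((L2norm f)^2)"
      using L2norm_ennreal[OF Lf] by (simp add: nn_integral_completion Nf)
    finally show ?thesis by (simp add: ennreal_mult)
  qed
  have nm: "(\<lambda>x. \<integral>\<^sup>+t. ennreal ((cmod (u x t))^2) \<partial>lborel) \<in> borel_measurable lborel"
  proof -
    have "(\<lambda>p. ennreal ((cmod (u (fst p) (snd p)))^2)) \<in> borel_measurable (lborel \<Otimes>\<^sub>M lborel)" using um by measurable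
    then have "(\<lambda>(x, t). ennreal ((cmod (u x t))^2)) \<in> borel_measurable (lborel \<Otimes>\<^sub>M lborel)" by (simp add: case_prod_beta)
    from lborel.borel_measurable_nn_integral[OF this] show ?thesis by simp
  qed
  \<comment> \<open>Plancherel requires \<open>u x\<close> to be square-integrable, and the finite
    total integral guarantees this for almost every x only.\<close>
  have "AE x in lborel. (\<integral>\<^sup>+t. ennreal ((cmod (u x t))^2) \<partial>lborel) \<noteq> \<infinity>"
    by (rule nn_integral_noteq_infinite[OF nm]) (simp add: tot)
  then have ae: "AE x in lborel. (\<integral>\<^sup>+w. ennreal ((cmod (stft g f (x, w)))^2) \<partial>lborel) = (\<integral>\<^sup>+t. ennreal ((cmod (u x t))^2) \<partial>lborel)"
  proof eventually_elim
    case (elim x)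
    have "integrable lborel (\<lambda>t. (cmod (u x t))^2)"
      by (rule integrableI_bounded) (use elim in \<open>auto simp: top.not_eq_extremum less_top\<close>)
    then have "L2 (u x)" by (simp add: L2_def integrable_completion measurable_completion)
    from plancherel[OF u_meas u1 this] show ?case by (simp add: V)
  qed
  have Vm: "stft g f \<in> borel_measurable (lborel \<Otimes>\<^sub>M lborel)"
    using borel_measurable_continuous_onI[OF stft_continuous[OF f g]] by (simp add: lborel_prod)
  have "(\<integral>\<^sup>+z. ennreal ((cmod (stft g f z))^2) \<partial>lborel) = (\<integral>\<^sup>+z. ennreal ((cmod (stft g f z))^2) \<partial>(lborel \<Otimes>\<^sub>M lborel))"
    by (simp add: lborel_prod)
  also have "\<dots> = (\<integral>\<^sup>+x. \<integral>\<^sup>+w. ennreal ((cmod (stft g f (x, w)))^2) \<partial>lborel \<partial>lborel)"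
    by (rule lborel.nn_integral_fst[symmetric]) (use Vm in measurable)
  also have "\<dots> = (\<integral>\<^sup>+x. \<integral>\<^sup>+t. ennreal ((cmod (u x t))^2) \<partial>lborel \<partial>lborel)"
    by (rule nn_integral_cong_AE[OF ae])
  finally show ?thesis by (simp add: tot)
qed

section \<open>Band-limited functions\<close>

lemma CspecD:
  assumes "F \<in> Cspec \<Lambda>"
  shows "continuous_on UNIV F" "F \<in> borel_measurable borel" "fourier_supp_in F \<Lambda>" "\<exists>M. \<forall>x. cmod (F x) \<le> M"
  using assms by (auto simp: Cspec_def bounded_iff intro: borel_measurable_continuous_onI)

lemma CspecI:
  assumes "continuous_on UNIV F" "\<And>x. cmod (F x) \<le> M"
    and "\<And>\<phi>. test_function \<phi> \<Longrightarrow> tsupport \<phi> \<inter> \<Lambda> = {} \<Longrightarrow> (\<integral>z. F z * fourier \<phi> z \<partial>lborel) = 0"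
  shows "F \<in> Cspec \<Lambda>"
  using assms fourier_supp_inI[OF borel_measurable_continuous_onI[OF assms(1)] assms(3)]
  unfolding Cspec_def bounded_iff by auto

lemma Cspec_integral:
  "F \<in> Cspec \<Lambda> \<Longrightarrow> test_function \<phi> \<Longrightarrow> tsupport \<phi> \<inter> \<Lambda> = {} \<Longrightarrow> (\<integral>z. F z * fourier \<phi> z \<partial>lborel) = 0"
  by (rule fourier_supp_inD[OF CspecD(3) CspecD(2)])

lemma Cspec_integrable:
  assumes "F \<in> Cspec \<Lambda>" "integrable lborel h"
  shows "integrable lborel (\<lambda>z. F z * h z)"
proof -
  obtain M where "\<And>x. cmod (F x) \<le> M" using CspecD(4)[OF assms(1)] by blast
  then show ?thesis by (rule integrable_mult_bounded_fourier[OF CspecD(2)[OF assms(1)] _ assms(2)])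
qed

lemma Cspec_cmult:
  assumes "F \<in> Cspec \<Lambda>"
  shows "(\<lambda>x. c * F x) \<in> Cspec \<Lambda>"
proof -
  obtain M where M: "\<And>x. cmod (F x) \<le> M" using CspecD(4)[OF assms] by blast
  show ?thesis
  proof (rule CspecI[of _ "cmod c * M"])
    show "continuous_on UNIV (\<lambda>x. c * F x)" by (intro continuous_intros CspecD(1)[OF assms])
    show "cmod (c * F x) \<le> cmod c * M" for x using M[of x] by (simp add: norm_mult mult_left_mono)
  qed (simp add: mult.assoc Cspec_integral[OF assms])
qed

lemma Cspec_add:
  assumes "F \<in> Cspec \<Lambda>" "G \<in> Cspec \<Lambda>"
  shows "(\<lambda>x. F x + G x) \<in> Cspec \<Lambda>"
proof -
  obtain M where M: "\<And>x. cmod (F x) \<le> M" using CspecD(4)[OF assms(1)] by blast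
  obtain N where N: "\<And>x. cmod (G x) \<le> N" using CspecD(4)[OF assms(2)] by blast
  show ?thesis
  proof (rule CspecI[of _ "M + N"])
    show "continuous_on UNIV (\<lambda>x. F x + G x)" by (intro continuous_intros CspecD(1)[OF assms(1)] CspecD(1)[OF assms(2)])
    show "cmod (F x + G x) \<le> M + N" for x by (intro norm_triangle_mono M N)
    fix \<phi> :: "'a \<Rightarrow> complex" assume \<phi>: "test_function \<phi>" "tsupport \<phi> \<inter> \<Lambda> = {}"
    then show "(\<integral>z. (F z + G z) * fourier \<phi> z \<partial>lborel) = 0"
      using Cspec_integrable[OF assms(1) fourier_test_integrable[OF \<phi>(1)]]
        Cspec_integrable[OF assms(2) fourier_test_integrable[OF \<phi>(1)]]
      by (simp add: ring_distribs Cspec_integral[OF assms(1)] Cspec_integral[OF assms(2)])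
  qed
qed

lemma Cspec_zero: "(\<lambda>x. 0) \<in> Cspec \<Lambda>"
  by (rule CspecI[of _ 0]) auto

lemma Cspec_sum: "(\<And>i. i \<in> I \<Longrightarrow> u i \<in> Cspec \<Lambda>) \<Longrightarrow> (\<lambda>x. \<Sum>i\<in>I. u i x) \<in> Cspec \<Lambda>"
proof (induction I rule: infinite_finite_induct)
  case (insert i I)
  then show ?case using Cspec_add[of "u i" \<Lambda> "\<lambda>x. \<Sum>i\<in>I. u i x"] by simp
qed (simp_all add: Cspec_zero)

lemma test_function_modulate: "test_function \<phi> \<Longrightarrow> test_function (\<lambda>x. cis (2 * pi * (x \<bullet> p)) * \<phi> x)"
proof (rule test_function_mult_left)
  show "Ck k (\<lambda>x. cis (2 * pi * (x \<bullet> p)))" for k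
    using Ck_cis_inner[of k "(2 * pi) *\<^sub>R p"] by simp
qed

lemma tsupport_closed: "closed (tsupport \<phi>)"
  by (simp add: tsupport_def)

lemma Cspec_translate:
  assumes F: "F \<in> Cspec \<Lambda>"
  shows "(\<lambda>x. F (x + p)) \<in> Cspec \<Lambda>"
proof -
  obtain M where M: "\<And>x. cmod (F x) \<le> M" using CspecD(4)[OF F] by blast
  show ?thesis
  proof (rule CspecI[of _ M])
    show "continuous_on UNIV (\<lambda>x. F (x + p))"
      by (intro continuous_on_compose2[OF CspecD(1)[OF F]] continuous_intros) auto
    fix \<phi> :: "'a \<Rightarrow> complex" assume \<phi>: "test_function \<phi>" "tsupport \<phi> \<inter> \<Lambda> = {}"
    define \<psi> where "\<psi> x = cis (2 * pi * (x \<bullet> p)) * \<phi> x" for x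
    have \<psi>: "test_function \<psi>" unfolding \<psi>_def by (rule test_function_modulate[OF \<phi>(1)])
    have "tsupport \<psi> \<subseteq> tsupport \<phi>"
      by (rule tsupport_subset[OF tsupport_closed]) (auto simp: \<psi>_def intro: in_tsupport)
    then have "(\<integral>z. F z * fourier \<psi> z \<partial>lborel) = 0" using \<phi>(2) by (intro Cspec_integral[OF F \<psi>]) auto
    moreover have "(\<integral>z. F (z + p) * fourier \<psi> (z + p) \<partial>lborel) = (\<integral>z. F z * fourier \<psi> z \<partial>lborel)"
      by (rule integral_lborel_translate)
    moreover have "fourier \<psi> (z + p) = fourier \<phi> z" for z
      unfolding \<psi>_def fourier_modulate by simp
    ultimately show "(\<integral>z. F (z + p) * fourier \<phi> z \<partial>lborel) = 0" by simp
  qed (rule M)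
qed

lemma Cspec_dilate:
  fixes F :: "'a::euclidean_space \<Rightarrow> complex"
  assumes F: "F \<in> Cspec \<Lambda>" and r: "r > 0"
  shows "(\<lambda>x. F (r *\<^sub>R x)) \<in> Cspec ((*\<^sub>R) r ` \<Lambda>)"
proof -
  obtain M where M: "\<And>x. cmod (F x) \<le> M" using CspecD(4)[OF F] by blast
  show ?thesis
  proof (rule CspecI[of _ M])
    show "continuous_on UNIV (\<lambda>x. F (r *\<^sub>R x))"
      by (intro continuous_on_compose2[OF CspecD(1)[OF F]] continuous_intros) auto
    fix \<phi> :: "'a \<Rightarrow> complex" assume \<phi>: "test_function \<phi>" "tsupport \<phi> \<inter> (*\<^sub>R) r ` \<Lambda> = {}"
    define \<psi> where "\<psi> x = \<phi> (r *\<^sub>R x)" for x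
    have \<psi>: "test_function \<psi>"
      using test_function_affine[OF \<phi>(1), of r 0] r by (simp add: \<psi>_def[abs_def])
    have "closed {x. r *\<^sub>R x \<in> tsupport \<phi>}"
      using closed_vimage[OF tsupport_closed[of \<phi>], of "(*\<^sub>R) r"] by (simp add: vimage_def continuous_intros)
    then have "tsupport \<psi> \<subseteq> {x. r *\<^sub>R x \<in> tsupport \<phi>}"
      by (rule tsupport_subset) (auto simp: \<psi>_def intro: in_tsupport)
    then have "tsupport \<psi> \<inter> \<Lambda> = {}" using \<phi>(2) by blast
    then have "(\<integral>z. F z * fourier \<psi> z \<partial>lborel) = 0" by (intro Cspec_integral[OF F \<psi>])
    also have "(\<integral>z. F z * fourier \<psi> z \<partial>lborel) = \<bar>r\<bar> ^ DIM('a) *\<^sub>R (\<integral>z. F (0 + r *\<^sub>R z) * fourier \<psi> (0 + r *\<^sub>R z) \<partial>lborel)"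
      by (rule integral_lborel_affine) (use r in simp)
    also have "(\<lambda>z. F (0 + r *\<^sub>R z) * fourier \<psi> (0 + r *\<^sub>R z)) = (\<lambda>z. of_real (1 / r ^ DIM('a)) * (F (r *\<^sub>R z) * fourier \<phi> z))"
    proof
      fix z
      have "fourier \<psi> (r *\<^sub>R z) = of_real (1 / r ^ DIM('a)) * fourier \<phi> z"
        using fourier_dilate[OF borel_measurable_test[OF \<phi>(1)] r, of "r *\<^sub>R z"] r by (simp add: \<psi>_def[abs_def])
      then show "F (0 + r *\<^sub>R z) * fourier \<psi> (0 + r *\<^sub>R z) = of_real (1 / r ^ DIM('a)) * (F (r *\<^sub>R z) * fourier \<phi> z)"
        by simp
    qed
    finally show "(\<integral>z. F (r *\<^sub>R z) * fourier \<phi> z \<partial>lborel) = 0"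
      using r by simp
  qed (rule M)
qed

text \<open>The second factor is a superposition of characters of frequency -\<delta> q with density
  \<kappa>(q), and each character shifts the spectrum by -\<delta> q. Treating one q at a time, the
  inclusion is required only where \<kappa> is nonzero, not on its closed support.\<close>

lemma Cspec_mult_fourier:
  fixes F :: "'a::euclidean_space \<Rightarrow> complex"
  assumes F: "F \<in> Cspec \<Lambda>" and \<kappa>: "test_function \<kappa>"
    and sub: "\<And>\<gamma> q. \<gamma> \<in> \<Lambda> \<Longrightarrow> \<kappa> q \<noteq> 0 \<Longrightarrow> \<gamma> - \<delta> *\<^sub>R q \<in> \<Lambda>'"
  shows "(\<lambda>x. F x * fourier \<kappa> (\<delta> *\<^sub>R x)) \<in> Cspec \<Lambda>'"
proof -
  obtain M where M: "\<And>x. cmod (F x) \<le> M" using CspecD(4)[OF F] by blast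
  have \<kappa>i: "integrable lborel \<kappa>" by (rule test_function_integrable[OF \<kappa>])
  define C where "C = (\<integral>x. cmod (\<kappa> x) \<partial>lborel)"
  have C: "cmod (fourier \<kappa> x) \<le> C" for x unfolding C_def by (rule norm_fourier_le[OF \<kappa>i])
  show ?thesis
  proof (rule CspecI[of _ "M * C"])
    show "continuous_on UNIV (\<lambda>x. F x * fourier \<kappa> (\<delta> *\<^sub>R x))"
      by (intro continuous_intros CspecD(1)[OF F] continuous_on_compose2[OF continuous_fourier[OF \<kappa>i]]) auto
    show "cmod (F x * fourier \<kappa> (\<delta> *\<^sub>R x)) \<le> M * C" for x
      unfolding norm_mult using order_trans[OF norm_ge_zero M] by (intro mult_mono M C) auto
    fix \<phi> :: "'a \<Rightarrow> complex" assume \<phi>: "test_function \<phi>" "tsupport \<phi> \<inter> \<Lambda>' = {}"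
    define v where "v x = F x * fourier \<phi> x" for x
    have vi: "integrable lborel v" unfolding v_def by (rule Cspec_integrable[OF F fourier_test_integrable[OF \<phi>(1)]])
    have \<kappa>m: "\<kappa> \<in> borel_measurable borel" by (rule borel_measurable_test[OF \<kappa>])
    have "(\<integral>z. F z * fourier \<kappa> (\<delta> *\<^sub>R z) * fourier \<phi> z \<partial>lborel) =
        (\<integral>z. v z * (\<integral>q. \<kappa> q * cis (- 2 * pi * (q \<bullet> \<delta> *\<^sub>R z)) \<partial>lborel) \<partial>lborel)"
      unfolding v_def fourier_lborel[OF \<kappa>m] by (simp add: mult_ac)
    also have "\<dots> = (\<integral>q. \<kappa> q * (\<integral>z. v z * cis (- 2 * pi * (q \<bullet> \<delta> *\<^sub>R z)) \<partial>lborel) \<partial>lborel)"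
    proof (rule integral_swap_bounded[OF vi \<kappa>i])
      have "(\<lambda>p. cis (- 2 * pi * (snd p \<bullet> \<delta> *\<^sub>R fst p))) \<in> borel_measurable (lborel \<Otimes>\<^sub>M (lborel :: 'a measure))" by measurable
      then show "(\<lambda>(z, q). cis (- 2 * pi * (q \<bullet> \<delta> *\<^sub>R z))) \<in> borel_measurable (lborel \<Otimes>\<^sub>M (lborel :: 'a measure))"
        by (simp add: case_prod_beta)
    qed simp
    also have "\<dots> = (\<integral>q. 0 \<partial>(lborel :: 'a measure))"
    proof (rule Bochner_Integration.integral_cong[OF refl])
      fix q
      show "\<kappa> q * (\<integral>z. v z * cis (- 2 * pi * (q \<bullet> \<delta> *\<^sub>R z)) \<partial>lborel) = 0"
      proof (cases "\<kappa> q = 0")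
        case False
        define \<psi> where "\<psi> x = \<phi> (x + - (\<delta> *\<^sub>R q))" for x
        have \<psi>: "test_function \<psi>"
          using test_function_affine[OF \<phi>(1), of 1 "- (\<delta> *\<^sub>R q)"] by (simp add: \<psi>_def[abs_def])
        have "closed ((\<lambda>x. x + - (\<delta> *\<^sub>R q)) -` tsupport \<phi>)"
          by (intro closed_vimage tsupport_closed continuous_intros)
        then have "tsupport \<psi> \<subseteq> (\<lambda>x. x + - (\<delta> *\<^sub>R q)) -` tsupport \<phi>"
          by (rule tsupport_subset) (auto simp: \<psi>_def intro: in_tsupport)
        moreover have "x - \<delta> *\<^sub>R q \<in> \<Lambda>'" if "x \<in> \<Lambda>" for x by (rule sub[OF that False])
        ultimately have "tsupport \<psi> \<inter> \<Lambda> = {}" using \<phi>(2) by auto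
        then have "(\<integral>z. F z * fourier \<psi> z \<partial>lborel) = 0" by (rule Cspec_integral[OF F \<psi>])
        moreover have "F z * fourier \<psi> z = v z * cis (- 2 * pi * (q \<bullet> \<delta> *\<^sub>R z))" for z
          unfolding \<psi>_def v_def fourier_translate[OF borel_measurable_test[OF \<phi>(1)]] by (simp add: mult_ac)
        ultimately show ?thesis by simp
      qed simp
    qed
    finally show "(\<integral>z. F z * fourier \<kappa> (\<delta> *\<^sub>R z) * fourier \<phi> z \<partial>lborel) = 0" by simp
  qed
qed

section \<open>Uniform estimates for band-limited functions\<close>

lemma pw_kernel_translation:
  assumes R: "R > 0" and t: "t \<longlonglongrightarrow> (0::'a::euclidean_space)"
  shows "(\<lambda>n. \<integral>w. cmod (pw_kernel R w - pw_kernel R (w - t n)) \<partial>lborel) \<longlonglongrightarrow> 0"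
proof -
  have [measurable]: "pw_kernel R \<in> borel_measurable (borel :: 'a measure)" by (rule pw_kernel_measurable[OF R])
  obtain C where C: "\<And>x::'a. cmod (pw_kernel R x) \<le> C * weight x" "C > 0" using pw_kernel_decay[OF R] by blast
  obtain n1 where n1: "\<And>n. n \<ge> n1 \<Longrightarrow> norm (t n) \<le> 1"
    using LIMSEQ_D[OF t, of 1] by (auto intro: less_imp_le)
  have "(\<lambda>n. \<integral>w. cmod (pw_kernel R w - pw_kernel R (w - t (n + n1))) \<partial>lborel) \<longlonglongrightarrow> (\<integral>w. 0 \<partial>(lborel :: 'a measure))"
  proof (rule integral_dominated_convergence[where w = "\<lambda>w. (C + C * 3 ^ DIM('a)) * weight w"])
    show "integrable lborel (\<lambda>w::'a. (C + C * 3 ^ DIM('a)) * weight w)" by (intro integrable_mult_right integrable_weight)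
    show "AE w in lborel. (\<lambda>n. cmod (pw_kernel R w - pw_kernel R (w - t (n + n1)))) \<longlonglongrightarrow> 0"
    proof (rule AE_I2)
      fix w :: 'a
      have "(\<lambda>n. w - t (n + n1)) \<longlonglongrightarrow> w - 0" by (intro tendsto_intros LIMSEQ_ignore_initial_segment t)
      then have "(\<lambda>n. pw_kernel R (w - t (n + n1))) \<longlonglongrightarrow> pw_kernel R w"
        using continuous_on_tendsto_compose[OF pw_kernel_continuous[OF R]] by simp
      then have "(\<lambda>n. cmod (pw_kernel R w - pw_kernel R (w - t (n + n1)))) \<longlonglongrightarrow> cmod (pw_kernel R w - pw_kernel R w)"
        by (intro tendsto_intros)
      then show "(\<lambda>n. cmod (pw_kernel R w - pw_kernel R (w - t (n + n1)))) \<longlonglongrightarrow> 0" by simp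
    qed
    show "AE w in lborel. norm (cmod (pw_kernel R w - pw_kernel R (w - t (n + n1)))) \<le> (C + C * 3 ^ DIM('a)) * weight w" for n
    proof (rule AE_I2)
      fix w :: 'a
      have "cmod (pw_kernel R w - pw_kernel R (w - t (n + n1))) \<le> C * weight w + C * weight (w + - t (n + n1))"
        using norm_triangle_ineq4[of "pw_kernel R w" "pw_kernel R (w - t (n + n1))"] C(1)[of w] C(1)[of "w - t (n + n1)"] by simp
      also have "C * weight (w + - t (n + n1)) \<le> C * (3 ^ DIM('a) * weight w)"
        using C(2) n1[of "n + n1"] by (intro mult_left_mono weight_shift) auto
      finally show "norm (cmod (pw_kernel R w - pw_kernel R (w - t (n + n1)))) \<le> (C + C * 3 ^ DIM('a)) * weight w"
        by (simp add: algebra_simps)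
    qed
  qed measurable
  then have "(\<lambda>n. \<integral>w. cmod (pw_kernel R w - pw_kernel R (w - t (n + n1))) \<partial>lborel) \<longlonglongrightarrow> 0" by simp
  then show ?thesis by (rule LIMSEQ_offset)
qed

text \<open>In the reproducing formula the point enters only through a translate of the kernel, so
  L1-continuity of translation gives a modulus of continuity common to all \<open>F\<close> bounded
  by 1.\<close>

lemma Cspec_equicontinuous:
  assumes R: "R > 0" "\<And>\<gamma> b. \<gamma> \<in> \<Lambda> \<Longrightarrow> b \<in> Basis \<Longrightarrow> \<bar>\<gamma> \<bullet> b\<bar> \<le> R" and e: "e > 0"
  obtains d where "d > 0" "\<And>F M x y. \<lbrakk>F \<in> Cspec \<Lambda>; \<And>x. cmod (F x) \<le> M; norm (x - y) \<le> d\<rbrakk>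
      \<Longrightarrow> cmod (F x - F (y::'a::euclidean_space)) \<le> e * M"
proof -
  define W where "W t = (\<integral>w. cmod (pw_kernel R w - pw_kernel R (w - t)) \<partial>(lborel::'a measure))" for t
  have "\<exists>d>0. \<forall>t. norm t \<le> d \<longrightarrow> W t \<le> e"
  proof (rule ccontr)
    assume "\<not> ?thesis"
    then have "\<exists>t. norm t \<le> inverse (real (Suc n)) \<and> W t > e" for n
      by (metis inverse_positive_iff_positive not_le of_nat_0_less_iff zero_less_Suc)
    then obtain t where t: "\<And>n. norm (t n) \<le> inverse (real (Suc n))" "\<And>n. W (t n) > e" by metis
    have "t \<longlonglongrightarrow> 0"
      by (rule Lim_null_comparison[OF _ LIMSEQ_inverse_real_of_nat]) (use t(1) in auto)
    then have "(\<lambda>n. W (t n)) \<longlonglongrightarrow> 0" unfolding W_def by (rule pw_kernel_translation[OF R(1)])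
    then obtain n where "norm (W (t n) - 0) < e" using LIMSEQ_D[OF _ e] by blast
    with t(2)[of n] show False by simp
  qed
  then obtain d where d: "d > 0" "\<And>t. norm t \<le> d \<Longrightarrow> W t \<le> e" by blast
  have "cmod (F x - F y) \<le> e * M" if F: "F \<in> Cspec \<Lambda>" and M: "\<And>x. cmod (F x) \<le> M" and xy: "norm (x - y) \<le> d" for F M x y
  proof -
    have mF [measurable]: "F \<in> borel_measurable borel" by (rule CspecD(2)[OF F])
    have [measurable]: "pw_kernel R \<in> borel_measurable (borel :: 'a measure)" by (rule pw_kernel_measurable[OF R(1)])
    have ki: "integrable lborel (\<lambda>w. pw_kernel R (w - z))" for z :: 'a
      using integrable_lborel_translate[of "pw_kernel R" "- z"] pw_kernel_integrable[OF R(1)] by simp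
    have kd: "integrable lborel (\<lambda>w. pw_kernel R (w - x) - pw_kernel R (w - y))" by (intro Bochner_Integration.integrable_diff ki)
    have rep: "F z = (\<integral>w. F w * pw_kernel R (w - z) \<partial>lborel)" for z
      by (rule reproducing_formula[OF CspecD(1)[OF F] M CspecD(3)[OF F] R])
    have M0: "0 \<le> M" using order_trans[OF norm_ge_zero M] .
    have "F x - F y = (\<integral>w. F w * (pw_kernel R (w - x) - pw_kernel R (w - y)) \<partial>lborel)"
      by (subst rep[of x], subst rep[of y]) (simp add: right_diff_distrib Cspec_integrable[OF F ki])
    then have "cmod (F x - F y) \<le> (\<integral>w. cmod (F w * (pw_kernel R (w - x) - pw_kernel R (w - y))) \<partial>lborel)"
      using integral_norm_bound by metis
    also have "\<dots> \<le> (\<integral>w. M * cmod (pw_kernel R (w - x) - pw_kernel R (w - y)) \<partial>lborel)"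
    proof (rule integral_mono)
      show "integrable lborel (\<lambda>w. cmod (F w * (pw_kernel R (w - x) - pw_kernel R (w - y))))"
        by (intro integrable_norm Cspec_integrable[OF F kd])
      show "integrable lborel (\<lambda>w. M * cmod (pw_kernel R (w - x) - pw_kernel R (w - y)))"
        by (intro integrable_mult_right integrable_norm kd)
    qed (auto simp: norm_mult intro!: mult_right_mono M)
    also have "\<dots> = M * (\<integral>w. cmod (pw_kernel R (w - x) - pw_kernel R (w - y)) \<partial>lborel)" by simp
    also have "(\<integral>w. cmod (pw_kernel R (w - x) - pw_kernel R (w - y)) \<partial>lborel) =
       (\<integral>w. cmod (pw_kernel R ((w + x) - x) - pw_kernel R ((w + x) - y)) \<partial>lborel)"
      by (rule integral_lborel_translate[symmetric])
    also have "\<dots> = W (y - x)" unfolding W_def by (simp add: algebra_simps)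
    also have "M * W (y - x) \<le> M * e" using d(2)[of "y - x"] xy M0 by (intro mult_left_mono) (auto simp: norm_minus_commute)
    finally show ?thesis by (simp add: mult.commute)
  qed
  with d(1) show ?thesis by (rule that)
qed

text \<open>The sum is compared with an integral over disjoint balls around the points, since
  \<open>weight\<close> changes by at most a constant factor on a ball of radius at most 1.\<close>

lemma weight_sum_separated:
  fixes E :: "nat \<Rightarrow> 'a::euclidean_space"
  assumes "separated E"
  obtains C where "C > 0" "\<And>w. (\<Sum>n. ennreal (weight (w - E n))) \<le> ennreal C"
proof -
  obtain d where d: "d > 0" "\<And>m n. m \<noteq> n \<Longrightarrow> d \<le> dist (E m) (E n)" using assms unfolding separated_def by blast
  \<comment> \<open>At most 1 for \<open>weight_shift\<close>, at most d/2 for the balls to be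
    disjoint.\<close>
  define r where "r = min 1 (d / 2)"
  have r: "r > 0" "r \<le> 1" "2 * r \<le> d" using d by (auto simp: r_def)
  define v where "v = measure lborel (ball (0::'a) r)"
  have ball_fin: "emeasure lborel (ball x r) < \<infinity>" for x :: 'a by (rule emeasure_lborel_ball_finite)
  have v_eq: "emeasure lborel (ball x r) = ennreal v" for x :: 'a
  proof -
    have "emeasure lborel (ball x r) = (\<integral>\<^sup>+y. indicator (ball x r) y \<partial>lborel)" by simp
    also have "\<dots> = (\<integral>\<^sup>+y. indicator (ball x r) (y + x) \<partial>lborel)"
      by (intro nn_integral_lborel_translate[symmetric] borel_measurable_indicator borel_open) simp
    also have "\<dots> = (\<integral>\<^sup>+y. indicator (ball (0::'a) r) y \<partial>lborel)"
      by (rule nn_integral_cong) (auto simp: indicator_def dist_norm)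
    also have "\<dots> = emeasure lborel (ball (0::'a) r)" by simp
    finally show ?thesis using ball_fin[of 0] by (simp add: v_def emeasure_eq_ennreal_measure)
  qed
  have v: "v > 0"
  proof -
    have "emeasure lborel (ball (0::'a) r) \<noteq> 0"
    proof
      assume "emeasure lborel (ball (0::'a) r) = 0"
      then have "ball (0::'a) r \<in> null_sets lebesgue" by (intro null_sets_completionI) (auto simp: null_sets_def)
      then have "negligible (ball (0::'a) r)" by (simp add: negligible_iff_null_sets)
      then show False using open_not_negligible[of "ball (0::'a) r"] r(1) by auto
    qed
    then have "\<not> v \<le> 0" using v_eq[of 0] ennreal_eq_0_iff[of v] by metis
    then show ?thesis by simp
  qed
  define I where "I = (\<integral>x. weight (x::'a) \<partial>lborel)"
  have I0: "0 \<le> I" unfolding I_def by (rule Bochner_Integration.integral_nonneg) (rule weight_nonneg)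
  have Inn: "(\<integral>\<^sup>+x. ennreal (weight (w - x)) \<partial>lborel) = ennreal I" for w :: 'a
  proof -
    have "(\<integral>\<^sup>+x. ennreal (weight (w - x)) \<partial>lborel) = (\<integral>\<^sup>+x. ennreal (weight (x::'a)) \<partial>lborel)"
      by (rule nn_integral_lborel_reflect) measurable
    also have "\<dots> = ennreal I" unfolding I_def
      by (rule nn_integral_eq_integral[OF integrable_weight]) (simp add: weight_nonneg)
    finally show ?thesis .
  qed
  define C where "C = (3 ^ DIM('a) * I + 1) / v"
  have "(\<Sum>n. ennreal (weight (w - E n))) \<le> ennreal C" for w
  proof -
    have [measurable]: "ball (E n) r \<in> sets borel" for n by simp
    have tm: "ennreal v * ennreal (weight (w - E n)) \<le>
        (\<integral>\<^sup>+y. ennreal (3 ^ DIM('a)) * ennreal (weight (w - y)) * indicator (ball (E n) r) y \<partial>lborel)" for n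
    proof -
      have "ennreal v * ennreal (weight (w - E n)) = (\<integral>\<^sup>+y. ennreal (weight (w - E n)) * indicator (ball (E n) r) y \<partial>lborel)"
        by (simp add: nn_integral_cmult_indicator v_eq mult.commute)
      also have "\<dots> \<le> (\<integral>\<^sup>+y. ennreal (3 ^ DIM('a)) * ennreal (weight (w - y)) * indicator (ball (E n) r) y \<partial>lborel)"
      proof (rule nn_integral_mono)
        fix y
        show "ennreal (weight (w - E n)) * indicator (ball (E n) r) y \<le>
            ennreal (3 ^ DIM('a)) * ennreal (weight (w - y)) * indicator (ball (E n) r) y"
        proof (cases "y \<in> ball (E n) r")
          case True
          then have "norm (y - E n) \<le> 1" using r by (auto simp: dist_norm norm_minus_commute)
          from weight_shift[OF this, of "w - y"] have "weight (w - E n) \<le> 3 ^ DIM('a) * weight (w - y)" by simp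
          then have "ennreal (weight (w - E n)) \<le> ennreal (3 ^ DIM('a) * weight (w - y))" by (rule ennreal_leI)
          then show ?thesis using True by (simp add: ennreal_mult weight_nonneg)
        qed simp
      qed
      finally show ?thesis .
    qed
    have disj: "(\<Sum>n. indicator (ball (E n) r) y :: ennreal) \<le> 1" for y
    proof -
      have "disjoint_family (\<lambda>n. ball (E n) r)"
        unfolding disjoint_family_on_def
      proof (intro ballI impI)
        fix m n :: nat assume "m \<noteq> n"
        then have "d \<le> dist (E m) (E n)" by (rule d(2))
        moreover have False if "z \<in> ball (E m) r" "z \<in> ball (E n) r" for z
          using dist_triangle[of "E m" "E n" z] that \<open>d \<le> dist (E m) (E n)\<close> r(3) by (simp add: dist_commute)
        ultimately show "ball (E m) r \<inter> ball (E n) r = {}" by blast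
      qed
      then have "(\<Sum>n. indicator (ball (E n) r) y :: ennreal) = indicator (\<Union>n. ball (E n) r) y"
        by (rule suminf_indicator)
      also have "\<dots> \<le> 1" by (simp add: indicator_def)
      finally show ?thesis .
    qed
    have "ennreal v * (\<Sum>n. ennreal (weight (w - E n))) = (\<Sum>n. ennreal v * ennreal (weight (w - E n)))"
      by (rule ennreal_suminf_cmult[symmetric])
    also have "\<dots> \<le> (\<Sum>n. \<integral>\<^sup>+y. ennreal (3 ^ DIM('a)) * ennreal (weight (w - y)) * indicator (ball (E n) r) y \<partial>lborel)"
      by (intro suminf_le tm summableI)
    also have "\<dots> = (\<integral>\<^sup>+y. (\<Sum>n. ennreal (3 ^ DIM('a)) * ennreal (weight (w - y)) * indicator (ball (E n) r) y) \<partial>lborel)"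
      by (rule nn_integral_suminf[symmetric]) measurable
    also have "\<dots> \<le> (\<integral>\<^sup>+y. ennreal (3 ^ DIM('a)) * ennreal (weight (w - y)) \<partial>lborel)"
    proof (rule nn_integral_mono)
      fix y
      have "(\<Sum>n. ennreal (3 ^ DIM('a)) * ennreal (weight (w - y)) * indicator (ball (E n) r) y) =
          ennreal (3 ^ DIM('a)) * ennreal (weight (w - y)) * (\<Sum>n. indicator (ball (E n) r) y)"
        by (rule ennreal_suminf_cmult)
      also have "\<dots> \<le> ennreal (3 ^ DIM('a)) * ennreal (weight (w - y)) * 1" by (intro mult_left_mono disj) simp
      finally show "(\<Sum>n. ennreal (3 ^ DIM('a)) * ennreal (weight (w - y)) * indicator (ball (E n) r) y) \<le>
          ennreal (3 ^ DIM('a)) * ennreal (weight (w - y))" by simp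
    qed
    also have "\<dots> = ennreal (3 ^ DIM('a)) * ennreal I"
      by (subst nn_integral_cmult) (measurable, simp add: Inn)
    also have "\<dots> \<le> ennreal v * ennreal C"
      using v I0 by (simp add: ennreal_mult[symmetric] C_def ennreal_leI del: ennreal_power)
    finally have "ennreal v * (\<Sum>n. ennreal (weight (w - E n))) \<le> ennreal v * ennreal C" .
    then show ?thesis using v by (simp add: ennreal_mult_le_mult_iff)
  qed
  moreover have "C > 0" using v I0 by (auto simp: C_def intro!: divide_pos_pos add_nonneg_pos mult_nonneg_nonneg)
  ultimately show ?thesis using that by blast
qed

text \<open>The reproducing formula bounds |F(z)| by a weighted mean of |F|. With the weight split
  into two square roots, Cauchy-Schwarz bounds |F(z)|^2 by a weighted mean of |F|^2, and summation
  over \<open>E\<close> then only involves the bounded sums of weights.\<close>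

theorem plancherel_polya:
  fixes E :: "nat \<Rightarrow> 'a::euclidean_space"
  assumes R: "R > 0" "\<And>\<gamma> b. \<gamma> \<in> \<Lambda> \<Longrightarrow> b \<in> Basis \<Longrightarrow> \<bar>\<gamma> \<bullet> b\<bar> \<le> R" and E: "separated E"
  obtains B where "B > 0" "\<And>F. F \<in> Cspec \<Lambda> \<Longrightarrow>
     (\<Sum>n. ennreal ((cmod (F (E n)))^2)) \<le> ennreal B * (\<integral>\<^sup>+x. ennreal ((cmod (F x))^2) \<partial>lborel)"
proof -
  obtain C where C: "\<And>x::'a. cmod (pw_kernel R x) \<le> C * weight x" "C > 0" using pw_kernel_decay[OF R(1)] by blast
  obtain D where D: "D > 0" "\<And>w. (\<Sum>n. ennreal (weight (w - E n))) \<le> ennreal D" using weight_sum_separated[OF E] by blast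
  define I where "I = (\<integral>x. weight (x::'a) \<partial>lborel)"
  have I0: "0 \<le> I" unfolding I_def by (rule Bochner_Integration.integral_nonneg) (rule weight_nonneg)
  have Inn: "(\<integral>\<^sup>+x. ennreal (weight (x - w)) \<partial>lborel) = ennreal I" for w :: 'a
  proof -
    have "(\<integral>\<^sup>+x. ennreal (weight (x + - w)) \<partial>lborel) = (\<integral>\<^sup>+x. ennreal (weight (x::'a)) \<partial>lborel)"
      by (rule nn_integral_lborel_translate) measurable
    also have "\<dots> = ennreal I" unfolding I_def
      by (rule nn_integral_eq_integral[OF integrable_weight]) (simp add: weight_nonneg)
    finally show ?thesis by simp
  qed
  define B where "B = C^2 * I * D + 1"
  have "(\<Sum>n. ennreal ((cmod (F (E n)))^2)) \<le> ennreal B * (\<integral>\<^sup>+x. ennreal ((cmod (F x))^2) \<partial>lborel)" if F: "F \<in> Cspec \<Lambda>" for F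
  proof -
    obtain M where M: "\<And>x. cmod (F x) \<le> M" using CspecD(4)[OF F] by blast
    have mF [measurable]: "F \<in> borel_measurable borel" by (rule CspecD(2)[OF F])
    define Q where "Q = (\<lambda>x. ennreal ((cmod (F x))^2))"
    have [measurable]: "Q \<in> borel_measurable borel" unfolding Q_def by measurable
    have [measurable]: "pw_kernel R \<in> borel_measurable (borel :: 'a measure)" by (rule pw_kernel_measurable[OF R(1)])
    have pt: "ennreal ((cmod (F z))^2) \<le> ennreal (C^2 * I) * (\<integral>\<^sup>+w. Q w * ennreal (weight (w - z)) \<partial>lborel)" for z
    proof -
      have ki: "integrable lborel (\<lambda>w. F w * pw_kernel R (w - z))"
        using integrable_lborel_translate[of "pw_kernel R" "- z"] pw_kernel_integrable[OF R(1)]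
        by (intro Cspec_integrable[OF F]) simp
      have "F z = (\<integral>w. F w * pw_kernel R (w - z) \<partial>lborel)"
        by (rule reproducing_formula[OF CspecD(1)[OF F] M CspecD(3)[OF F] R])
      then have "ennreal (cmod (F z)) \<le> (\<integral>\<^sup>+w. ennreal (norm (F w * pw_kernel R (w - z))) \<partial>lborel)"
        using integral_norm_bound_ennreal[OF ki] by simp
      also have "\<dots> \<le> (\<integral>\<^sup>+w. ennreal C * (ennreal (cmod (F w) * sqrt (weight (w - z))) * ennreal (sqrt (weight (w - z)))) \<partial>lborel)"
      proof (rule nn_integral_mono)
        fix w
        have "cmod (F w) * cmod (pw_kernel R (w - z)) \<le> cmod (F w) * (C * weight (w - z))"
          by (intro mult_left_mono C) auto
        also have "\<dots> = C * ((cmod (F w) * sqrt (weight (w - z))) * sqrt (weight (w - z)))"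
          by (simp add: weight_nonneg)
        finally show "ennreal (norm (F w * pw_kernel R (w - z))) \<le>
          ennreal C * (ennreal (cmod (F w) * sqrt (weight (w - z))) * ennreal (sqrt (weight (w - z))))"
          using C(2) by (simp only: norm_mult ennreal_mult[symmetric] mult_nonneg_nonneg norm_ge_zero real_sqrt_ge_zero weight_nonneg less_imp_le ennreal_leI)
      qed
      also have "\<dots> = ennreal C * (\<integral>\<^sup>+w. ennreal (cmod (F w) * sqrt (weight (w - z))) * ennreal (sqrt (weight (w - z))) \<partial>lborel)"
        by (rule nn_integral_cmult) measurable
      finally have "(ennreal (cmod (F z)))^2 \<le> (ennreal C * (\<integral>\<^sup>+w. ennreal (cmod (F w) * sqrt (weight (w - z))) * ennreal (sqrt (weight (w - z))) \<partial>lborel))^2"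
        by (rule power_mono) simp
      also have "\<dots> \<le> (ennreal C)^2 * ((\<integral>\<^sup>+w. (ennreal (cmod (F w) * sqrt (weight (w - z))))^2 \<partial>lborel) * (\<integral>\<^sup>+w. (ennreal (sqrt (weight (w - z))))^2 \<partial>lborel))"
        unfolding power_mult_distrib by (intro mult_left_mono Cauchy_Schwarz_nn_integral) simp_all
      also have "(\<integral>\<^sup>+w. (ennreal (sqrt (weight (w - z))))^2 \<partial>lborel) = ennreal I"
        unfolding Inn[of z, symmetric] by (simp add: ennreal_power weight_nonneg)
      also have "(\<integral>\<^sup>+w. (ennreal (cmod (F w) * sqrt (weight (w - z))))^2 \<partial>lborel) = (\<integral>\<^sup>+w. Q w * ennreal (weight (w - z)) \<partial>lborel)"
        by (rule nn_integral_cong) (simp add: Q_def ennreal_power weight_nonneg power_mult_distrib ennreal_mult[symmetric])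
      also have "(ennreal C)^2 * ((\<integral>\<^sup>+w. Q w * ennreal (weight (w - z)) \<partial>lborel) * ennreal I) =
          ennreal (C^2 * I) * (\<integral>\<^sup>+w. Q w * ennreal (weight (w - z)) \<partial>lborel)"
        using C(2) I0 by (simp add: ennreal_mult ennreal_power mult_ac)
      finally show ?thesis by (simp add: ennreal_power)
    qed
    have "(\<Sum>n. \<integral>\<^sup>+w. Q w * ennreal (weight (w - E n)) \<partial>lborel) = (\<integral>\<^sup>+w. (\<Sum>n. Q w * ennreal (weight (w - E n))) \<partial>lborel)"
      by (rule nn_integral_suminf[symmetric]) measurable
    also have "\<dots> \<le> (\<integral>\<^sup>+w. Q w * ennreal D \<partial>lborel)"
      unfolding ennreal_suminf_cmult by (intro nn_integral_mono mult_left_mono D(2)) simp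
    also have "\<dots> = (\<integral>\<^sup>+w. Q w \<partial>lborel) * ennreal D" by (rule nn_integral_multc) measurable
    finally have le: "(\<Sum>n. \<integral>\<^sup>+w. Q w * ennreal (weight (w - E n)) \<partial>lborel) \<le> (\<integral>\<^sup>+w. Q w \<partial>lborel) * ennreal D" .
    have "(\<Sum>n. ennreal ((cmod (F (E n)))^2)) \<le> (\<Sum>n. ennreal (C^2 * I) * (\<integral>\<^sup>+w. Q w * ennreal (weight (w - E n)) \<partial>lborel))"
      by (intro suminf_le pt summableI)
    also have "\<dots> = ennreal (C^2 * I) * (\<Sum>n. \<integral>\<^sup>+w. Q w * ennreal (weight (w - E n)) \<partial>lborel)"
      by (rule ennreal_suminf_cmult)
    also have "\<dots> \<le> ennreal (C^2 * I) * ((\<integral>\<^sup>+w. Q w \<partial>lborel) * ennreal D)"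
      by (rule mult_left_mono[OF le]) simp
    also have "\<dots> = ennreal (C^2 * I * D) * (\<integral>\<^sup>+w. Q w \<partial>lborel)"
      using I0 D(1) by (simp add: ennreal_mult mult_ac)
    also have "\<dots> \<le> ennreal B * (\<integral>\<^sup>+w. Q w \<partial>lborel)"
      by (intro mult_right_mono ennreal_leI) (auto simp: B_def)
    finally show ?thesis by (simp add: Q_def)
  qed
  moreover have "B > 0" unfolding B_def using I0 D(1) by (intro add_nonneg_pos mult_nonneg_nonneg) auto
  ultimately show ?thesis using that by blast
qed

section \<open>Balayage and the sampling inequality\<close>

text \<open>Encoded as the image of a weighted counting measure on the indices, so that repeated
  points simply add their weights.\<close>

definition atomic :: "(nat \<Rightarrow> real) \<Rightarrow> (nat \<Rightarrow> 'a::euclidean_space) \<Rightarrow> 'a measure" where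
  "atomic w p = distr (density (count_space UNIV) (\<lambda>n. ennreal (w n))) borel p"

lemma sets_atomic [simp]: "sets (atomic w p) = sets borel"
  by (simp add: atomic_def)

lemma emeasure_atomic:
  assumes "A \<in> sets borel"
  shows "emeasure (atomic w p) A = (\<Sum>n. ennreal (w n) * indicator A (p n))"
proof -
  have "emeasure (atomic w p) A = emeasure (density (count_space UNIV) (\<lambda>n. ennreal (w n))) (p -` A)"
    unfolding atomic_def using assms by (subst emeasure_distr) auto
  also have "\<dots> = (\<integral>\<^sup>+n. ennreal (w n) * indicator (p -` A) n \<partial>count_space UNIV)"
    by (rule emeasure_density) auto
  also have "\<dots> = (\<Sum>n. ennreal (w n) * indicator (p -` A) n)"
    by (rule nn_integral_count_space_nat)
  finally show ?thesis by (simp add: indicator_def)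
qed

lemma finite_atomic:
  assumes "\<And>n. 0 \<le> w n" "summable w"
  shows "finite_measure (atomic w p)"
proof
  have "emeasure (atomic w p) (space (atomic w p)) = (\<Sum>n. ennreal (w n))"
    by (subst emeasure_atomic) (simp_all add: atomic_def)
  also have "\<dots> = ennreal (\<Sum>n. w n)"
    by (rule suminf_ennreal2[OF assms])
  finally show "emeasure (atomic w p) (space (atomic w p)) \<noteq> \<infinity>" by simp
qed

lemma integral_atomic:
  fixes F :: "'a::euclidean_space \<Rightarrow> complex"
  assumes w: "\<And>n. 0 \<le> w n" "summable w" and F: "F \<in> borel_measurable borel" "\<And>x. cmod (F x) \<le> M"
  shows "summable (\<lambda>n. complex_of_real (w n) * F (p n))"
    and "(\<integral>x. F x \<partial>atomic w p) = (\<Sum>n. complex_of_real (w n) * F (p n))"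
proof -
  have sn: "summable (\<lambda>n. cmod (complex_of_real (w n) * F (p n)))"
  proof (rule summable_comparison_test')
    show "summable (\<lambda>n. w n * M)" by (rule summable_mult2[OF w(2)])
    show "norm (cmod (complex_of_real (w n) * F (p n))) \<le> w n * M" for n
      using w(1)[of n] F(2)[of "p n"] by (simp add: norm_mult mult_left_mono)
  qed
  then show "summable (\<lambda>n. complex_of_real (w n) * F (p n))" by (rule summable_norm_cancel)
  have "(\<integral>x. F x \<partial>atomic w p) = (\<integral>n. F (p n) \<partial>density (count_space UNIV) (\<lambda>n. ennreal (w n)))"
    unfolding atomic_def by (rule integral_distr) (use F in auto)
  also have "\<dots> = (\<integral>n. w n *\<^sub>R F (p n) \<partial>count_space UNIV)"
    by (rule integral_density) (use w in auto)
  also have "\<dots> = (\<Sum>n. w n *\<^sub>R F (p n))"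
    by (rule integral_count_space_nat) (use sn in \<open>simp add: integrable_count_space_nat_iff scaleR_conv_of_real\<close>)
  finally show "(\<integral>x. F x \<partial>atomic w p) = (\<Sum>n. complex_of_real (w n) * F (p n))"
    by (simp add: scaleR_conv_of_real)
qed

lemma sum_lessThan_4: "(\<Sum>k<(4::nat). f k) = f 0 + f 1 + f 2 + (f 3 :: complex)"
  by (simp add: eval_nat_numeral)

lemma atomic_cmeasure:
  fixes p :: "nat \<Rightarrow> 'a::euclidean_space"
  assumes a: "summable (\<lambda>n. cmod (a n))"
  obtains \<mu> where "\<mu> \<in> Mb UNIV"
    "\<And>F M. F \<in> borel_measurable borel \<Longrightarrow> (\<And>x. cmod (F x) \<le> M) \<Longrightarrow> cm_integral \<mu> F = (\<Sum>n. a n * F (p n))"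
proof -
  \<comment> \<open>The order of the four nonnegative parts follows the powers 1, \<i>, -1, -\<i> in
    \<open>cm_integral\<close>.\<close>
  define w where "w k n = (if k = 0 then max 0 (Re (a n)) else if k = 1 then max 0 (Im (a n))
     else if k = 2 then max 0 (- Re (a n)) else max 0 (- Im (a n)))" for k n :: nat
  have w0: "0 \<le> w k n" for k n by (simp add: w_def)
  have wle: "w k n \<le> cmod (a n)" for k n
    using abs_Re_le_cmod[of "a n"] abs_Im_le_cmod[of "a n"] by (auto simp: w_def)
  have ws: "summable (w k)" for k
    by (rule summable_comparison_test'[OF a, of 0]) (use w0 wle in auto)
  define \<mu> where "\<mu> k = atomic (w k) p" for k
  have "\<mu> \<in> Mb UNIV" unfolding Mb_def \<mu>_def by (auto intro: finite_atomic w0 ws)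
  moreover have "cm_integral \<mu> F = (\<Sum>n. a n * F (p n))"
    if F: "F \<in> borel_measurable borel" "\<And>x. cmod (F x) \<le> M" for F M
  proof -
    note I = integral_atomic[OF w0 ws F]
    have "(\<lambda>n. \<Sum>k<4. \<i> ^ k * (complex_of_real (w k n) * F (p n))) sums (\<Sum>k<4. \<i> ^ k * (\<integral>x. F x \<partial>\<mu> k))"
      unfolding \<mu>_def by (intro sums_sum sums_mult) (simp only: I(2) summable_sums[OF I(1)])
    moreover have "(\<Sum>k<4. \<i> ^ k * (complex_of_real (w k n) * F (p n))) = a n * F (p n)" for n
    proof -
      have "(\<Sum>k<4. \<i> ^ k * (complex_of_real (w k n) * F (p n))) =
        (complex_of_real (w 0 n) + \<i> * complex_of_real (w 1 n) - complex_of_real (w 2 n) - \<i> * complex_of_real (w 3 n)) * F (p n)"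
        unfolding sum_lessThan_4 by (simp add: power3_eq_cube ring_distribs)
      also have "complex_of_real (w 0 n) + \<i> * complex_of_real (w 1 n) - complex_of_real (w 2 n) - \<i> * complex_of_real (w 3 n) = a n"
        by (simp add: complex_eq_iff w_def max_def)
      finally show ?thesis .
    qed
    ultimately show ?thesis by (simp add: cm_integral_def sums_iff)
  qed
  ultimately show ?thesis by (rule that)
qed

text \<open>The carrier is countable, so \<sigma>-additivity determines the measure by its atoms;
  finiteness makes their masses summable.\<close>

lemma measure_on_sequence:
  fixes E :: "nat \<Rightarrow> 'a::euclidean_space"
  assumes E: "inj E" and \<nu>: "sets \<nu> = sets borel" "finite_measure \<nu>" "emeasure \<nu> (UNIV - range E) = 0"
  shows "\<nu> = atomic (\<lambda>n. measure \<nu> {E n}) E" "summable (\<lambda>n. measure \<nu> {E n})"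
proof -
  interpret finite_measure \<nu> by fact
  have rE: "range E \<in> sets \<nu>" unfolding \<nu>(1) by (rule sets.countable) auto
  have em: "emeasure \<nu> A = (\<Sum>n. ennreal (measure \<nu> {E n}) * indicator A (E n))" if A: "A \<in> sets borel" for A
  proof -
    have A': "A \<in> sets \<nu>" using A \<nu>(1) by simp
    have "emeasure \<nu> A = emeasure \<nu> (A \<inter> range E) + emeasure \<nu> (A - range E)"
      using A' rE by (subst plus_emeasure) (auto intro!: arg_cong[where f="emeasure \<nu>"])
    also have "emeasure \<nu> (A - range E) = 0"
    proof -
      have "emeasure \<nu> (A - range E) \<le> emeasure \<nu> (UNIV - range E)"
        using rE \<nu>(1) by (intro emeasure_mono) auto
      with \<nu>(3) show ?thesis by simp
    qed
    also have "A \<inter> range E = (\<Union>n. A \<inter> {E n})" by auto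
    also have "emeasure \<nu> (\<Union>n. A \<inter> {E n}) = (\<Sum>n. emeasure \<nu> (A \<inter> {E n}))"
    proof (rule suminf_emeasure[symmetric])
      show "range (\<lambda>n. A \<inter> {E n}) \<subseteq> sets \<nu>"
      proof
        fix X assume "X \<in> range (\<lambda>n. A \<inter> {E n})"
        then obtain n where "X = A \<inter> {E n}" by blast
        then show "X \<in> sets \<nu>" unfolding \<nu>(1) using A by simp
      qed
      show "disjoint_family (\<lambda>n. A \<inter> {E n})"
        using E by (auto simp: disjoint_family_on_def inj_def)
    qed
    also have "(\<lambda>n. emeasure \<nu> (A \<inter> {E n})) = (\<lambda>n. ennreal (measure \<nu> {E n}) * indicator A (E n))"
    proof
      fix n
      show "emeasure \<nu> (A \<inter> {E n}) = ennreal (measure \<nu> {E n}) * indicator A (E n)"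
        by (cases "E n \<in> A") (auto simp: emeasure_eq_measure)
    qed
    finally show ?thesis by simp
  qed
  show "\<nu> = atomic (\<lambda>n. measure \<nu> {E n}) E"
  proof (rule measure_eqI)
    show "sets \<nu> = sets (atomic (\<lambda>n. measure \<nu> {E n}) E)" by (simp only: \<nu>(1) sets_atomic)
    fix A assume "A \<in> sets \<nu>"
    then have "A \<in> sets borel" by (simp only: \<nu>(1))
    then show "emeasure \<nu> A = emeasure (atomic (\<lambda>n. measure \<nu> {E n}) E) A"
      by (simp only: em emeasure_atomic)
  qed
  have "emeasure \<nu> UNIV = (\<Sum>n. ennreal (measure \<nu> {E n}))" by (subst em) simp_all
  then have "(\<Sum>n. ennreal (measure \<nu> {E n})) \<noteq> \<top>" using emeasure_finite[of UNIV] by metis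
  then show "summable (\<lambda>n. measure \<nu> {E n})" by (intro summable_suminf_not_top) auto
qed

lemma cmeasure_on_sequence:
  fixes E :: "nat \<Rightarrow> 'a::euclidean_space"
  assumes E: "inj E" and \<nu>: "\<nu> \<in> Mb (range E)"
  obtains a where "summable (\<lambda>n. cmod (a n))"
    "\<And>F M. F \<in> borel_measurable borel \<Longrightarrow> (\<And>x. cmod (F x) \<le> M) \<Longrightarrow> cm_integral \<nu> F = (\<Sum>n. a n * F (E n))"
proof -
  define w where "w k n = measure (\<nu> k) {E n}" for k n
  have \<nu>k: "\<nu> k = atomic (w k) E" "summable (w k)" if "k < 4" for k
  proof -
    have "w k = (\<lambda>n. measure (\<nu> k) {E n})" by (simp add: w_def[abs_def])
    then show "\<nu> k = atomic (w k) E" "summable (w k)"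
      using measure_on_sequence[OF E, of "\<nu> k"] \<nu> that by (auto simp: Mb_def)
  qed
  define a where "a n = (\<Sum>k<4. \<i> ^ k * complex_of_real (w k n))" for n
  have w0: "0 \<le> w k n" for k n by (simp add: w_def)
  have "summable (\<lambda>n. cmod (a n))"
  proof (rule summable_comparison_test')
    show "summable (\<lambda>n. \<Sum>k<4. w k n)" by (intro summable_sum \<nu>k) simp
    show "norm (cmod (a n)) \<le> (\<Sum>k<4. w k n)" for n
      unfolding a_def real_norm_def abs_norm_cancel by (rule order_trans[OF norm_sum]) (simp add: norm_mult norm_power w0)
  qed
  moreover have "cm_integral \<nu> F = (\<Sum>n. a n * F (E n))"
    if F: "F \<in> borel_measurable borel" "\<And>x. cmod (F x) \<le> M" for F M
  proof -
    have "(\<lambda>n. \<Sum>k<4. \<i> ^ k * (complex_of_real (w k n) * F (E n))) sums (\<Sum>k<4. \<i> ^ k * (\<integral>x. F x \<partial>\<nu> k))"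
    proof (intro sums_sum sums_mult)
      fix k :: nat assume "k \<in> {..<4}"
      then have k: "k < 4" by simp
      show "(\<lambda>n. complex_of_real (w k n) * F (E n)) sums (\<integral>x. F x \<partial>\<nu> k)"
        unfolding \<nu>k(1)[OF k] integral_atomic(2)[OF w0 \<nu>k(2)[OF k] F]
        by (rule summable_sums[OF integral_atomic(1)[OF w0 \<nu>k(2)[OF k] F]])
    qed
    moreover have "(\<Sum>k<4. \<i> ^ k * (complex_of_real (w k n) * F (E n))) = a n * F (E n)" for n
      by (simp add: a_def sum_distrib_right mult.assoc)
    ultimately show ?thesis by (simp add: cm_integral_def sums_iff)
  qed
  ultimately show ?thesis by (rule that)
qed

lemma summable_mult_bounded:
  fixes a :: "nat \<Rightarrow> complex"
  assumes "summable (\<lambda>n. cmod (a n))" "\<And>n. cmod (f n) \<le> M"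
  shows "summable (\<lambda>n. cmod (a n * f n))" "cmod (\<Sum>n. a n * f n) \<le> (\<Sum>n. cmod (a n)) * M"
proof -
  have s: "summable (\<lambda>n. cmod (a n) * M)" by (rule summable_mult2[OF assms(1)])
  have le: "cmod (a n * f n) \<le> cmod (a n) * M" for n
    unfolding norm_mult by (intro mult_left_mono assms(2)) simp
  show 1: "summable (\<lambda>n. cmod (a n * f n))"
    by (rule summable_comparison_test'[OF s, of 0]) (use le in simp)
  have "cmod (\<Sum>n. a n * f n) \<le> (\<Sum>n. cmod (a n * f n))" by (rule summable_norm[OF 1])
  also have "\<dots> \<le> (\<Sum>n. cmod (a n) * M)" by (rule suminf_le[OF le 1 s])
  also have "\<dots> = (\<Sum>n. cmod (a n)) * M" by (rule suminf_mult2[OF assms(1), symmetric])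
  finally show "cmod (\<Sum>n. a n * f n) \<le> (\<Sum>n. cmod (a n)) * M" .
qed

section \<open>Balayage of discrete measures\<close>

lemma S_set_atomic:
  fixes p :: "nat \<Rightarrow> 'a::euclidean_space"
  assumes S: "S_set \<Lambda>" and a: "summable (\<lambda>n. cmod (a n))"
    and z: "\<And>\<gamma>. \<gamma> \<in> \<Lambda> \<Longrightarrow> (\<Sum>n. a n * cis (- 2 * pi * (p n \<bullet> \<gamma>))) = 0" and F: "F \<in> Cspec \<Lambda>"
  shows "(\<Sum>n. a n * F (p n)) = 0"
proof -
  obtain \<mu> where \<mu>: "\<mu> \<in> Mb UNIV"
    "\<And>F M. F \<in> borel_measurable borel \<Longrightarrow> (\<And>x. cmod (F x) \<le> M) \<Longrightarrow> cm_integral \<mu> F = (\<Sum>n. a n * F (p n))"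
    using atomic_cmeasure[OF a] by blast
  obtain M where M: "\<And>x. cmod (F x) \<le> M" using CspecD(4)[OF F] by blast
  have "cm_fourier \<mu> \<gamma> = 0" if "\<gamma> \<in> \<Lambda>" for \<gamma>
  proof -
    have "(\<lambda>x. cis (- 2 * pi * (x \<bullet> \<gamma>))) \<in> borel_measurable borel" by measurable
    from \<mu>(2)[OF this, of 1] z[OF that] show ?thesis by (simp add: cm_fourier_def)
  qed
  then have "cm_integral \<mu> F = 0" using S \<mu>(1) F unfolding S_set_def by blast
  then show ?thesis using \<mu>(2)[OF CspecD(2)[OF F] M] by simp
qed

text \<open>Interleaving two series presents the difference of two discrete measures as one sequence
  of atoms.\<close>

lemma sums_if_complex:
  fixes f g :: "nat \<Rightarrow> complex"
  assumes "g sums x" "f sums y"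
  shows "(\<lambda>n. if even n then f (n div 2) else g ((n - 1) div 2)) sums (x + y)"
  unfolding sums_complex_iff if_distrib[of Re] if_distrib[of Im] plus_complex.sel
  using assms[unfolded sums_complex_iff] by (intro conjI sums_if) auto

text \<open>The measure \<mu> - \<nu> has vanishing transform on \<Lambda>; the S-set property
  extends this equality of integrals from the characters in \<Lambda> to all of
  \<open>Cspec \<Lambda>\<close>.\<close>

lemma balayage_atomic:
  fixes E p :: "nat \<Rightarrow> 'a::euclidean_space"
  assumes S: "S_set \<Lambda>" and bal: "balayage_possible (range E) \<Lambda>" and E: "inj E"
    and c: "summable (\<lambda>n. cmod (c n))"
  obtains a where "summable (\<lambda>n. cmod (a n))"
    "\<And>F. F \<in> Cspec \<Lambda> \<Longrightarrow> (\<Sum>n. c n * F (p n)) = (\<Sum>n. a n * F (E n))"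
proof -
  obtain \<mu> where \<mu>: "\<mu> \<in> Mb UNIV"
    "\<And>F M. F \<in> borel_measurable borel \<Longrightarrow> (\<And>x. cmod (F x) \<le> M) \<Longrightarrow> cm_integral \<mu> F = (\<Sum>n. c n * F (p n))"
    using atomic_cmeasure[OF c] by blast
  obtain \<nu> where \<nu>: "\<nu> \<in> Mb (range E)" "\<And>\<gamma>. \<gamma> \<in> \<Lambda> \<Longrightarrow> cm_fourier \<nu> \<gamma> = cm_fourier \<mu> \<gamma>"
    using bal \<mu>(1) unfolding balayage_possible_def by blast
  obtain a where a: "summable (\<lambda>n. cmod (a n))"
    "\<And>F M. F \<in> borel_measurable borel \<Longrightarrow> (\<And>x. cmod (F x) \<le> M) \<Longrightarrow> cm_integral \<nu> F = (\<Sum>n. a n * F (E n))"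
    using cmeasure_on_sequence[OF E \<nu>(1)] by blast
  \<comment> \<open>Masses of the difference: those of \<mu> at even indices, those of \<nu> with
    opposite sign at odd ones.\<close>
  define b where "b n = (if even n then c (n div 2) else - a ((n - 1) div 2))" for n
  define q where "q n = (if even n then p (n div 2) else E ((n - 1) div 2))" for n
  have bq: "(\<lambda>n. b n * G (q n)) sums ((\<Sum>n. c n * G (p n)) - (\<Sum>n. a n * G (E n)))"
    if "\<And>x. cmod (G x) \<le> M" for G M
  proof -
    have "(\<lambda>n. - (a n * G (E n))) sums - (\<Sum>n. a n * G (E n))"
      by (rule sums_minus[OF summable_sums[OF summable_norm_cancel[OF summable_mult_bounded(1)[OF a(1) that]]]])
    moreover have "(\<lambda>n. c n * G (p n)) sums (\<Sum>n. c n * G (p n))"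
      by (rule summable_sums[OF summable_norm_cancel[OF summable_mult_bounded(1)[OF c that]]])
    ultimately have "(\<lambda>n. if even n then c (n div 2) * G (p (n div 2)) else - (a ((n - 1) div 2) * G (E ((n - 1) div 2))))
       sums (- (\<Sum>n. a n * G (E n)) + (\<Sum>n. c n * G (p n)))"
      by (rule sums_if_complex)
    moreover have "(\<lambda>n. if even n then c (n div 2) * G (p (n div 2)) else - (a ((n - 1) div 2) * G (E ((n - 1) div 2)))) =
       (\<lambda>n. b n * G (q n))" by (auto simp: b_def q_def)
    ultimately show ?thesis by simp
  qed
  have bs: "summable (\<lambda>n. cmod (b n))"
  proof -
    have "(\<lambda>n. if even n then cmod (c (n div 2)) else cmod (a ((n - 1) div 2))) sums ((\<Sum>n. cmod (a n)) + (\<Sum>n. cmod (c n)))"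
      by (intro sums_if summable_sums a(1) c)
    moreover have "(\<lambda>n. if even n then cmod (c (n div 2)) else cmod (a ((n - 1) div 2))) = (\<lambda>n. cmod (b n))"
      by (auto simp: b_def)
    ultimately show ?thesis by (simp add: sums_iff)
  qed
  have "(\<Sum>n. c n * F (p n)) = (\<Sum>n. a n * F (E n))" if F: "F \<in> Cspec \<Lambda>" for F
  proof -
    obtain M where M: "\<And>x. cmod (F x) \<le> M" using CspecD(4)[OF F] by blast
    have "(\<Sum>n. b n * F (q n)) = 0"
    proof (rule S_set_atomic[OF S bs _ F])
      fix \<gamma> assume \<gamma>: "\<gamma> \<in> \<Lambda>"
      let ?e = "\<lambda>x. cis (- 2 * pi * (x \<bullet> \<gamma>))"
      have em: "?e \<in> borel_measurable borel" by measurable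
      have "(\<Sum>n. c n * ?e (p n)) = (\<Sum>n. a n * ?e (E n))"
        using \<nu>(2)[OF \<gamma>] \<mu>(2)[OF em, of 1] a(2)[OF em, of 1] by (simp add: cm_fourier_def)
      then show "(\<Sum>n. b n * ?e (q n)) = 0" using bq[of ?e 1] by (simp add: sums_iff)
    qed
    then show ?thesis using bq[of F M, OF M] by (simp add: sums_iff)
  qed
  with a(1) show ?thesis by (rule that)
qed

text \<open>One of A + D and A - D has modulus at least |D|, because they differ by 2D. Each sign
  depends on all earlier coefficients, hence the course-of-values choice.\<close>

lemma gliding_signs:
  fixes B :: "nat \<Rightarrow> nat \<Rightarrow> complex"
  assumes B: "\<And>k. cmod (B k k) \<ge> 1/2"
  obtains c :: "nat \<Rightarrow> real" where "\<And>k. \<bar>c k\<bar> = (1/5)^k"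
    "\<And>k. cmod (\<Sum>j<Suc k. complex_of_real (c j) * B k j) \<ge> (1/5)^k / 2"
proof -
  define P where "P c k r \<longleftrightarrow> \<bar>r\<bar> = (1/5)^k \<and>
     cmod ((\<Sum>j<k. complex_of_real (c j) * B k j) + complex_of_real r * B k k) \<ge> (1/5)^k / 2" for c :: "nat \<Rightarrow> real" and k and r :: real
  have "\<exists>c. \<forall>k. P c k (c k)"
  proof (rule dependent_wellorder_choice)
    show "P f x r = P g x r" if "\<And>y. y < x \<Longrightarrow> f y = g y" for r f g x
      using that by (simp add: P_def)
    show "\<exists>r. P f x r" for f x
    proof -
      define A where "A = (\<Sum>j<x. complex_of_real (f j) * B x j)"
      define D where "D = complex_of_real ((1/5)^x) * B x x"
      have D: "cmod D \<ge> (1/5)^x / 2"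
        using mult_left_mono[OF B[of x], of "(1/5)^x"] by (simp add: D_def norm_mult norm_power norm_divide)
      have "2 * cmod D \<le> cmod (A + D) + cmod (A - D)"
        using norm_triangle_ineq4[of "A + D" "A - D"] by (simp add: norm_mult[symmetric] flip: mult_2)
      then consider "cmod (A + D) \<ge> (1/5)^x / 2" | "cmod (A - D) \<ge> (1/5)^x / 2" using D by linarith
      then show ?thesis
      proof cases
        case 1
        then show ?thesis by (intro exI[of _ "(1/5)^x"]) (simp add: P_def A_def D_def)
      next
        case 2
        then show ?thesis by (intro exI[of _ "- ((1/5)^x)"]) (simp add: P_def A_def D_def)
      qed
    qed
  qed
  then obtain c where "\<And>k. P c k (c k)" by blast
  then show ?thesis by (intro that[of c]) (auto simp: P_def)
qed

text \<open>If it failed, there would be functions bounded by 1 and at least 1/2 somewhere, with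
  samples at most 25^-k. One discrete measure with masses of modulus 5^-k tests them all: against
  the k-th function the terms up to k give at least 5^-k / 2 and the tail at most 5^-k / 4, so its
  balayage onto \<open>E\<close> would have mass at least 25^k 5^-k / 4 = 5^k / 4 for every
  k.\<close>

theorem sampling_inequality:
  fixes E :: "nat \<Rightarrow> 'a::euclidean_space"
  assumes S: "S_set \<Lambda>" and bal: "balayage_possible (range E) \<Lambda>" and E: "inj E"
  obtains K where "K > 0" "\<And>F s y. \<lbrakk>F \<in> Cspec \<Lambda>; \<And>n. cmod (F (E n)) \<le> s\<rbrakk> \<Longrightarrow> cmod (F y) \<le> K * s"
proof (rule ccontr)
  assume neg: "\<not> thesis"
  have "\<exists>G y. G \<in> Cspec \<Lambda> \<and> (\<forall>x. cmod (G x) \<le> 1) \<and> cmod (G y) \<ge> 1/2 \<and> (\<forall>n. cmod (G (E n)) \<le> (1/25)^k)" for k :: nat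
  proof -
    have "\<not> (\<forall>F s y. F \<in> Cspec \<Lambda> \<longrightarrow> (\<forall>n. cmod (F (E n)) \<le> s) \<longrightarrow> cmod (F y) \<le> 25^k * s)"
      using neg that[of "25^k"] by force
    then obtain F s y where F: "F \<in> Cspec \<Lambda>" "\<forall>n. cmod (F (E n)) \<le> s" "\<not> cmod (F y) \<le> 25^k * s" by blast
    from F(2,3) have F: "F \<in> Cspec \<Lambda>" "\<And>n. cmod (F (E n)) \<le> s" "cmod (F y) > 25^k * s" using F(1) by auto
    obtain M0 where M0: "\<And>x. cmod (F x) \<le> M0" using CspecD(4)[OF F(1)] by blast
    define M where "M = (SUP x. cmod (F x))"
    have bdd: "bdd_above (range (\<lambda>x. cmod (F x)))" using M0 by (intro bdd_aboveI2)
    have M: "cmod (F x) \<le> M" for x unfolding M_def by (rule cSUP_upper[OF _ bdd]) simp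
    have s0: "0 \<le> s" using order_trans[OF norm_ge_zero F(2)] .
    have Mp: "M > 25^k * s" using F(3) M[of y] by linarith
    moreover have "0 \<le> 25^k * s" using s0 by simp
    ultimately have M0: "M > 0" by linarith
    have "M / 2 < M" using M0 by simp
    \<comment> \<open>The point that violates the inequality may be far from a maximum; after
      division by \<open>M\<close>, a point above M/2 gives the value 1/2 asked for.\<close>
    then obtain y' where y': "cmod (F y') > M / 2"
      unfolding M_def using less_cSUP_iff[OF _ bdd, of "(SUP x. cmod (F x)) / 2"] by auto
    define G where "G x = complex_of_real (1 / M) * F x" for x
    have nG: "cmod (G x) = cmod (F x) / M" for x using M0 by (simp add: G_def norm_mult norm_divide)
    have "G \<in> Cspec \<Lambda>" unfolding G_def by (rule Cspec_cmult[OF F(1)])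
    moreover have "cmod (G x) \<le> 1" for x using M[of x] M0 by (simp add: nG)
    moreover have "cmod (G y') \<ge> 1/2" using y' M0 by (simp add: nG field_simps)
    moreover have "cmod (G (E n)) \<le> (1/25)^k" for n
    proof -
      have "25^k * cmod (F (E n)) \<le> 25^k * s" using F(2) by simp
      also have "\<dots> \<le> M" using Mp by simp
      finally show ?thesis using M0 by (simp add: nG field_simps power_divide)
    qed
    ultimately show ?thesis by blast
  qed
  then obtain G y where G: "\<And>k. G k \<in> Cspec \<Lambda>" "\<And>k x. cmod (G k x) \<le> 1" "\<And>k. cmod (G k (y k)) \<ge> 1/2"
    "\<And>k n. cmod (G k (E n)) \<le> (1/25)^k" by metis
  obtain c where c: "\<And>k. \<bar>c k\<bar> = (1/5)^k"
    "\<And>k. cmod (\<Sum>j<Suc k. complex_of_real (c j) * G k (y j)) \<ge> (1/5)^k / 2"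
    using gliding_signs[of "\<lambda>k j. G k (y j)", OF G(3)] by blast
  have geo: "summable (\<lambda>n. (1/5::real)^n)" by (rule summable_geometric) simp
  have cs: "summable (\<lambda>n. cmod (complex_of_real (c n)))" unfolding norm_of_real c(1) by (rule geo)
  obtain a where a: "summable (\<lambda>n. cmod (a n))"
    "\<And>F. F \<in> Cspec \<Lambda> \<Longrightarrow> (\<Sum>n. complex_of_real (c n) * F (y n)) = (\<Sum>n. a n * F (E n))"
    using balayage_atomic[OF S bal E cs, of y] by blast
  define N where "N = (\<Sum>n. cmod (a n))"
  have lower: "5^k / 4 \<le> N" for k :: nat
  proof -
    have sk: "summable (\<lambda>n. complex_of_real (c n) * G k (y n))"
      by (rule summable_norm_cancel[OF summable_mult_bounded(1)[OF cs G(2)]])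
    have "(\<Sum>n. complex_of_real (c n) * G k (y n)) =
      (\<Sum>n. complex_of_real (c (n + Suc k)) * G k (y (n + Suc k))) + (\<Sum>j<Suc k. complex_of_real (c j) * G k (y j))"
      by (rule suminf_split_initial_segment[OF sk])
    moreover have "cmod (\<Sum>n. complex_of_real (c (n + Suc k)) * G k (y (n + Suc k))) \<le> (1/5)^k / 4"
    proof -
      have cs': "summable (\<lambda>n. cmod (complex_of_real (c (n + Suc k))))"
        by (rule summable_ignore_initial_segment[OF cs])
      have "cmod (\<Sum>n. complex_of_real (c (n + Suc k)) * G k (y (n + Suc k))) \<le> (\<Sum>n. cmod (complex_of_real (c (n + Suc k)))) * 1"
        by (rule summable_mult_bounded(2)[OF cs' G(2)])
      also have "(\<Sum>n. cmod (complex_of_real (c (n + Suc k)))) = (\<Sum>n. (1/5)^Suc k * (1/5)^n)"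
        unfolding norm_of_real c(1) by (simp add: power_add mult_ac)
      also have "\<dots> = (1/5)^Suc k * (\<Sum>n. (1/5)^n)" by (rule suminf_mult[OF geo])
      also have "(\<Sum>n. (1/5::real)^n) = 5/4" by (subst suminf_geometric) auto
      finally show ?thesis by simp
    qed
    moreover note c(2)[of k]
    ultimately have "cmod (\<Sum>n. complex_of_real (c n) * G k (y n)) \<ge> (1/5)^k / 4"
      using norm_diff_ineq[of "\<Sum>j<Suc k. complex_of_real (c j) * G k (y j)" "\<Sum>n. complex_of_real (c (n + Suc k)) * G k (y (n + Suc k))"]
      by (simp only: add.commute)
    moreover have "cmod (\<Sum>n. complex_of_real (c n) * G k (y n)) \<le> N * (1/25)^k"
      unfolding a(2)[OF G(1)] N_def by (rule summable_mult_bounded(2)[OF a(1) G(4)])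
    ultimately have "(1/5::real)^k / 4 \<le> N * (1/25)^k" by linarith
    moreover have "(1/25::real)^k = (1/5)^k * (1/5)^k" by (simp add: power_mult_distrib[symmetric])
    ultimately show ?thesis by (simp add: field_simps power_divide)
  qed
  obtain k :: nat where "4 * N < 5^k" using real_arch_pow[of 5 "4 * N"] by auto
  then show False using lower[of k] by linarith
qed

section \<open>Stability under dilation of the spectrum\<close>

lemma Cspec_mono: "F \<in> Cspec \<Lambda> \<Longrightarrow> \<Lambda> \<subseteq> \<Lambda>' \<Longrightarrow> F \<in> Cspec \<Lambda>'"
  unfolding Cspec_def fourier_supp_in_def by blast

text \<open>A nonnegative bump of integral 1 has a transform that is 1 at the origin and at most 1
  in modulus; smoothness supplies the decay.\<close>

lemma cutoff_function:
  fixes \<rho> :: real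
  assumes \<rho>: "\<rho> > 0"
  obtains \<kappa> :: "'a::euclidean_space \<Rightarrow> complex" and C where "test_function \<kappa>"
    "\<And>q b. \<kappa> q \<noteq> 0 \<Longrightarrow> b \<in> Basis \<Longrightarrow> \<bar>q \<bullet> b\<bar> \<le> \<rho>"
    "fourier \<kappa> 0 = 1" "\<And>x. cmod (fourier \<kappa> x) \<le> 1" "\<And>x. cmod (fourier \<kappa> x) \<le> C * weight x" "C > 0"
proof -
  \<comment> \<open>\<open>bump R\<close> reaches out to 4R in each coordinate.\<close>
  define R where "R = \<rho> / 4"
  have R: "R > 0" using \<rho> by (simp add: R_def)
  have bt: "test_function (\<lambda>x::'a. complex_of_real (bump R x))" by (rule test_function_bump[OF R])
  have bi: "integrable lborel (\<lambda>x::'a. bump R x)"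
    using test_function_integrable[OF bt] by (simp add: complex_of_real_integrable_eq)
  define I where "I = (\<integral>x. bump R (x::'a) \<partial>lborel)"
  have I: "I > 0"
  proof -
    have "0 < measure lborel (ball (0::'a) R)" using content_ball_pos[OF R] by simp
    also have "\<dots> = (\<integral>x. indicator (ball (0::'a) R) x \<partial>lborel)" by simp
    also have "\<dots> \<le> I"
      unfolding I_def
    proof (rule integral_mono[OF _ bi])
      show "integrable lborel (indicator (ball (0::'a) R) :: 'a \<Rightarrow> real)"
        using emeasure_lborel_ball_finite[of "0::'a" R] by (simp add: integrable_indicator_iff)
      fix x :: 'a
      show "indicator (ball 0 R) x \<le> bump R x"
      proof (cases "x \<in> ball 0 R")
        case True
        have "bump R x = 1"
        proof (rule bump_eq_1[OF _ R])
          fix b :: 'a assume "b \<in> Basis"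
          then show "\<bar>x \<bullet> b\<bar> \<le> 2 * R" using Basis_le_norm[of b x] True R by simp
        qed
        then show ?thesis by (simp add: indicator_def)
      qed (simp add: bump_nonneg)
    qed
    finally show ?thesis .
  qed
  define \<kappa> where "\<kappa> x = complex_of_real (1 / I) * complex_of_real (bump R x)" for x :: 'a
  have \<kappa>: "test_function \<kappa>" unfolding \<kappa>_def by (rule test_function_cmult[OF bt])
  have \<kappa>n: "cmod (\<kappa> x) = bump R x / I" for x
    using I by (simp add: \<kappa>_def norm_mult norm_divide bump_nonneg)
  have \<kappa>i: "(\<integral>x. cmod (\<kappa> x) \<partial>lborel) = 1" unfolding \<kappa>n using I by (simp add: I_def)
  obtain C where C: "\<And>x. cmod (fourier \<kappa> x) \<le> C * weight x" "C > 0" using fourier_test_decay[OF \<kappa>] by blast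
  have f0: "fourier \<kappa> 0 = 1"
  proof -
    have "fourier \<kappa> 0 = (\<integral>x. \<kappa> x \<partial>lborel)" by (subst fourier_lborel[OF borel_measurable_test[OF \<kappa>]]) simp
    also have "\<dots> = 1" unfolding \<kappa>_def using I by (simp add: I_def)
    finally show ?thesis .
  qed
  have f1: "cmod (fourier \<kappa> x) \<le> 1" for x
    using norm_fourier_le[OF test_function_integrable[OF \<kappa>], of x] by (simp add: \<kappa>i)
  have s: "\<bar>q \<bullet> b\<bar> \<le> \<rho>" if "\<kappa> q \<noteq> 0" "b \<in> Basis" for q b
    using bump_neq_0D[of R q b] that R by (simp add: \<kappa>_def R_def)
  show ?thesis by (rule that[OF \<kappa> s f0 f1 C])
qed

text \<open>The endpoints of the open window have ratio \<theta>, which is also the ratio of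
  consecutive scales, so two scales never fit into it.\<close>

lemma geometric_scales_at_most_one:
  fixes \<theta> a T t :: real
  assumes \<theta>: "0 < \<theta>" "\<theta> < 1" and T: "T > 0" and t: "t \<ge> 0"
  shows "card {j. j < (N::nat) \<and> \<theta> * T < 1/2 * \<theta>^j * t \<and> 1/2 * \<theta>^j * t < T} \<le> 1"
proof -
  have False if "i < j" "1/2 * \<theta>^i * t < T" "\<theta> * T < 1/2 * \<theta>^j * t" for i j :: nat
  proof -
    have "\<theta>^j \<le> \<theta>^Suc i" using that(1) \<theta> by (intro power_decreasing) auto
    then have "1/2 * \<theta>^j * t \<le> 1/2 * \<theta>^Suc i * t" using t by (intro mult_right_mono) auto
    also have "\<dots> = \<theta> * (1/2 * \<theta>^i * t)" by simp
    also have "\<dots> < \<theta> * T" using that(2) \<theta> by simp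
    finally show False using that(3) by simp
  qed
  then have "i = j" if "i \<in> {j. j < N \<and> \<theta> * T < 1/2 * \<theta>^j * t \<and> 1/2 * \<theta>^j * t < T}"
    "j \<in> {j. j < N \<and> \<theta> * T < 1/2 * \<theta>^j * t \<and> 1/2 * \<theta>^j * t < T}" for i j
    using that by (metis (mono_tags, lifting) mem_Collect_eq nat_neq_iff)
  then show ?thesis by (subst card_le_Suc0_iff_eq[unfolded One_nat_def[symmetric]]) auto
qed

text \<open>Contracting \<open>f\<close> by r_j takes its spectrum into (1 - \<delta>_j) \<Lambda>,
  the cutoff has spectrum in \<delta>_j \<Lambda>, and by convexity the product has spectrum in
  \<Lambda>. The constants are set so that the averaged function has samples at most s + M / (4 K),
  with M a bound of |f|; its value at y is f(y), which leaves M / 4 to absorb.\<close>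

theorem sampling_inequality_dilated:
  fixes E :: "nat \<Rightarrow> 'a::euclidean_space"
  assumes K: "K > 0" and samp: "\<And>F s y. \<lbrakk>F \<in> Cspec \<Lambda>; \<And>n. cmod (F (E n)) \<le> s\<rbrakk> \<Longrightarrow> cmod (F y) \<le> K * s"
    and R: "R > 0" "\<And>\<gamma> b. \<gamma> \<in> \<Lambda> \<Longrightarrow> b \<in> Basis \<Longrightarrow> \<bar>\<gamma> \<bullet> b\<bar> \<le> R"
    and conv: "convex \<Lambda>" and sym: "\<And>x. x \<in> \<Lambda> \<Longrightarrow> - x \<in> \<Lambda>"
    and \<rho>: "\<rho> > 0" "\<And>x. (\<And>b. b \<in> Basis \<Longrightarrow> \<bar>x \<bullet> b\<bar> \<le> \<rho>) \<Longrightarrow> x \<in> \<Lambda>"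
  obtains \<epsilon> where "0 < \<epsilon>"
    "\<And>f s y. \<lbrakk>f \<in> Cspec ((*\<^sub>R) (1 + \<epsilon>) ` \<Lambda>); \<And>n. cmod (f (E n)) \<le> s\<rbrakk> \<Longrightarrow> cmod (f y) \<le> 4 * K * s"
proof -
  obtain \<kappa> :: "'a \<Rightarrow> complex" and C where \<kappa>: "test_function \<kappa>"
    "\<And>q b. \<kappa> q \<noteq> 0 \<Longrightarrow> b \<in> Basis \<Longrightarrow> \<bar>q \<bullet> b\<bar> \<le> \<rho>"
    "fourier \<kappa> 0 = 1" "\<And>x. cmod (fourier \<kappa> x) \<le> 1" "\<And>x. cmod (fourier \<kappa> x) \<le> C * weight x" "C > 0"
    using cutoff_function[OF \<rho>(1)] by metis
  have \<kappa>\<Lambda>: "- q \<in> \<Lambda>" if "\<kappa> q \<noteq> 0" for q by (intro sym \<rho>(2) \<kappa>(2) that)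
  \<comment> \<open>Half of the error budget M / (4 K). The good scales contribute at most \<eta> M
    to the average, the single bad one at most M / N \<le> M / (8 K).\<close>
  define \<eta> where "\<eta> = 1 / (8 * K)"
  have \<eta>: "\<eta> > 0" using K by (simp add: \<eta>_def)
  \<comment> \<open>A cube that contains (1 + \<epsilon>) \<Lambda> for every \<epsilon> \<le> 1/2.
    The modulus \<open>d\<close> has to be fixed before \<epsilon>, which depends on it through
    \<theta>.\<close>
  define \<Lambda>2 where "\<Lambda>2 = {\<gamma>::'a. \<forall>b\<in>Basis. \<bar>\<gamma> \<bullet> b\<bar> \<le> 2 * R}"
  obtain d where d: "d > 0" "\<And>F M x y. \<lbrakk>F \<in> Cspec \<Lambda>2; \<And>x. cmod (F x) \<le> M; norm (x - y) \<le> d\<rbrakk>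
      \<Longrightarrow> cmod (F x - F (y::'a)) \<le> \<eta> * M"
  proof (rule Cspec_equicontinuous[of "2 * R" \<Lambda>2 \<eta>])
    show "\<bar>\<gamma> \<bullet> b\<bar> \<le> 2 * R" if "\<gamma> \<in> \<Lambda>2" "b \<in> Basis" for \<gamma> b using that by (simp add: \<Lambda>2_def)
  qed (use R \<eta> in auto)
  \<comment> \<open>Start of the far zone: beyond norm T the cutoff is at most \<eta>. The
    requirement T \<ge> d ensures \<theta> < 1.\<close>
  define T where "T = max (max 1 (C / \<eta>)) d"
  have T: "T \<ge> 1" "C / \<eta> \<le> T" "d \<le> T" "T > 0" by (auto simp: T_def)
  have hT: "cmod (fourier \<kappa> x) \<le> \<eta>" if "norm x \<ge> T" for x
  proof -
    have "T * 1 \<le> norm x * norm x" using that T by (intro mult_mono) auto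
    then have "T \<le> 1 + (norm x)^2" by (simp add: power2_eq_square)
    then have "inverse (1 + (norm x)^2) \<le> inverse T" using T by (intro le_imp_inverse_le) auto
    with weight_le[of x] have "weight x \<le> inverse T" by linarith
    then have "C * weight x \<le> C * inverse T" using \<kappa>(6) by (intro mult_left_mono) auto
    also have "\<dots> \<le> \<eta>" using T \<eta> \<kappa>(6) by (simp add: field_simps)
    finally show ?thesis using \<kappa>(5)[of x] by linarith
  qed
  \<comment> \<open>Chosen so that \<theta> T = d / 2 ends the near zone: for \<delta>_j t \<le> d /
    2 the contraction displaces a sample at distance t by at most 2 \<delta>_j t \<le> d.\<close>
  define \<theta> where "\<theta> = (d / 2) / T"
  have \<theta>: "0 < \<theta>" "\<theta> < 1" "\<theta> * T = d / 2" using d(1) T by (auto simp: \<theta>_def field_simps)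
  obtain N :: nat where N: "8 * K < real N" using reals_Archimedean2 by blast
  have N0: "real N > 0" using N K by linarith
  define \<delta> where "\<delta> j = 1/2 * \<theta>^j" for j :: nat
  \<comment> \<open>Not larger than any scale in use, so that the factor 1 / (1 + \<epsilon>) in r_j
    costs no more than 1 - \<delta>_j does and 1 - r_j \<le> 2 \<delta>_j.\<close>
  define \<epsilon> where "\<epsilon> = \<delta> N"
  have \<delta>: "0 < \<delta> j" "\<delta> j \<le> 1/2" for j
    using \<theta> by (auto simp: \<delta>_def power_le_one)
  have \<epsilon>\<delta>: "\<epsilon> \<le> \<delta> j" if "j < N" for j
    unfolding \<epsilon>_def \<delta>_def using that \<theta> by (intro mult_left_mono power_decreasing) auto
  have \<epsilon>: "0 < \<epsilon>" "\<epsilon> \<le> 1/2" unfolding \<epsilon>_def by (rule \<delta>)+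
  define r where "r j = (1 - \<delta> j) / (1 + \<epsilon>)" for j
  have r: "0 < r j" "r j * (1 + \<epsilon>) = 1 - \<delta> j" for j
    using \<delta>[of j] \<epsilon> by (auto simp: r_def)
  have r1: "r j \<le> 1" "1 - r j \<le> 2 * \<delta> j" if "j < N" for j
  proof -
    show "r j \<le> 1" using \<delta>[of j] \<epsilon> by (simp add: r_def)
    have "(1 - 2 * \<delta> j) * (1 + \<epsilon>) \<le> 1 - \<delta> j"
    proof -
      have "0 \<le> \<delta> j * \<epsilon>" using \<delta>[of j] \<epsilon> by simp
      then show ?thesis using \<epsilon>\<delta>[OF that] by (simp add: algebra_simps)
    qed
    then have "1 - 2 * \<delta> j \<le> r j" using \<epsilon> by (simp add: r_def le_divide_eq)
    then show "1 - r j \<le> 2 * \<delta> j" by simp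
  qed
  have main: "cmod (f y) \<le> K * s + M / 4"
    if f: "f \<in> Cspec ((*\<^sub>R) (1 + \<epsilon>) ` \<Lambda>)" and s: "\<And>n. cmod (f (E n)) \<le> s" and M: "\<And>x. cmod (f x) \<le> M" for f s y M
  proof -
    have s0: "0 \<le> s" using order_trans[OF norm_ge_zero s] .
    have M0: "0 \<le> M" using order_trans[OF norm_ge_zero M] .
    have f2: "f \<in> Cspec \<Lambda>2"
    proof (rule Cspec_mono[OF f], clarify)
      fix x assume x: "x \<in> \<Lambda>"
      show "(1 + \<epsilon>) *\<^sub>R x \<in> \<Lambda>2"
        unfolding \<Lambda>2_def
      proof (intro CollectI ballI)
        fix b :: 'a assume b: "b \<in> Basis"
        have "\<bar>(1 + \<epsilon>) * (x \<bullet> b)\<bar> = (1 + \<epsilon>) * \<bar>x \<bullet> b\<bar>" using \<epsilon> by (simp add: abs_mult)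
        also have "\<dots> \<le> 2 * R" using \<epsilon> R(1) R(2)[OF x b] by (intro mult_mono) auto
        finally show "\<bar>(1 + \<epsilon>) *\<^sub>R x \<bullet> b\<bar> \<le> 2 * R" by simp
      qed
    qed
    \<comment> \<open>The contraction is centred at \<open>y\<close>, so every term has the value
      f(y) there.\<close>
    define u where "u j x = f (r j *\<^sub>R (x - y) + y) * fourier \<kappa> (\<delta> j *\<^sub>R (x - y))" for j x
    have u: "u j \<in> Cspec \<Lambda>" for j
    proof -
      have "(\<lambda>x. f (r j *\<^sub>R x + y)) \<in> Cspec ((*\<^sub>R) (r j) ` (*\<^sub>R) (1 + \<epsilon>) ` \<Lambda>)"
        by (rule Cspec_dilate[OF Cspec_translate[OF f] r(1)])
      then have "(\<lambda>x. f (r j *\<^sub>R x + y) * fourier \<kappa> (\<delta> j *\<^sub>R x)) \<in> Cspec \<Lambda>"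
      proof (rule Cspec_mult_fourier[OF _ \<kappa>(1)])
        fix \<gamma> q assume "\<gamma> \<in> (*\<^sub>R) (r j) ` (*\<^sub>R) (1 + \<epsilon>) ` \<Lambda>" and q: "\<kappa> q \<noteq> 0"
        then obtain l where l: "l \<in> \<Lambda>" "\<gamma> = (1 - \<delta> j) *\<^sub>R l" using r(2)[of j] by auto
        have "(1 - \<delta> j) *\<^sub>R l + \<delta> j *\<^sub>R (- q) \<in> \<Lambda>"
          using \<delta>[of j] by (intro convexD[OF conv l(1) \<kappa>\<Lambda>[OF q]]) auto
        then show "\<gamma> - \<delta> j *\<^sub>R q \<in> \<Lambda>" by (simp add: l)
      qed
      from Cspec_translate[OF this, of "- y"] show ?thesis by (simp add: u_def[abs_def])
    qed
    define F where "F x = complex_of_real (1 / real N) * (\<Sum>j<N. u j x)" for x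
    have F: "F \<in> Cspec \<Lambda>" unfolding F_def by (intro Cspec_cmult Cspec_sum u)
    have "cmod (F (E n)) \<le> s + M / (4 * K)" for n
    proof -
      define x where "x = E n"
      define t where "t = norm (x - y)"
      define bad where "bad = {j. j < N \<and> \<theta> * T < 1/2 * \<theta>^j * t \<and> 1/2 * \<theta>^j * t < T}"
      have "cmod (u j x) \<le> (s + \<eta> * M) + (if j \<in> bad then M else 0)" if j: "j < N" for j
      proof -
        have nu: "cmod (u j x) = cmod (f (r j *\<^sub>R (x - y) + y)) * cmod (fourier \<kappa> (\<delta> j *\<^sub>R (x - y)))"
          by (simp add: u_def norm_mult)
        have nt: "norm (\<delta> j *\<^sub>R (x - y)) = \<delta> j * t" using \<delta>(1)[of j] by (simp add: t_def)
        \<comment> \<open>The transition zone, where only |f| \<le> M is used, then the near zone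
          and the far zone.\<close>
        consider "j \<in> bad" | "\<delta> j * t \<le> d / 2" | "T \<le> \<delta> j * t"
          using j \<theta>(3) unfolding bad_def \<delta>_def by force
        then show ?thesis
        proof cases
          case 1
          have "cmod (u j x) \<le> M * 1" unfolding nu by (intro mult_mono M \<kappa>(4)) (use M0 in auto)
          then show ?thesis using 1 s0 \<eta> M0 by (simp add: add_increasing)
        next
          case 2
          have "norm ((r j *\<^sub>R (x - y) + y) - x) = norm ((1 - r j) *\<^sub>R (x - y))"
            by (subst norm_minus_commute) (simp add: algebra_simps)
          also have "\<dots> = (1 - r j) * t" using r1(1)[OF j] by (simp add: t_def)
          also have "\<dots> \<le> 2 * \<delta> j * t" using r1(2)[OF j] by (intro mult_right_mono) (auto simp: t_def)
          also have "\<dots> \<le> d" using 2 by simp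
          finally have "cmod (f (r j *\<^sub>R (x - y) + y) - f x) \<le> \<eta> * M" by (rule d(2)[OF f2 M])
          then have "cmod (f (r j *\<^sub>R (x - y) + y)) \<le> s + \<eta> * M"
            using norm_triangle_ineq2[of "f (r j *\<^sub>R (x - y) + y)" "f x"] s[of n] by (simp add: x_def)
          then have "cmod (u j x) \<le> (s + \<eta> * M) * 1" unfolding nu by (intro mult_mono \<kappa>(4)) (use s0 \<eta> M0 in auto)
          then show ?thesis using M0 by simp
        next
          case 3
          then have "cmod (fourier \<kappa> (\<delta> j *\<^sub>R (x - y))) \<le> \<eta>" by (intro hT) (simp only: nt)
          then have "cmod (u j x) \<le> M * \<eta>" unfolding nu by (intro mult_mono M) (use M0 in auto)
          then show ?thesis using M0 s0 by (simp add: mult.commute)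
        qed
      qed
      then have "(\<Sum>j<N. cmod (u j x)) \<le> (\<Sum>j<N. (s + \<eta> * M) + (if j \<in> bad then M else 0))"
        by (intro sum_mono) simp
      also have "\<dots> = real N * (s + \<eta> * M) + real (card bad) * M"
      proof -
        have "bad \<subseteq> {..<N}" by (auto simp: bad_def)
        then have "(\<Sum>j<N. if j \<in> bad then M else 0) = (\<Sum>j\<in>bad. M)"
          by (subst sum.inter_restrict[symmetric]) (simp_all add: Int_absorb1)
        then show ?thesis by (simp add: sum.distrib Int_absorb1)
      qed
      also have "\<dots> \<le> real N * (s + \<eta> * M) + 1 * M"
      proof -
        have "card bad \<le> 1" unfolding bad_def
          by (rule geometric_scales_at_most_one) (use \<theta> T in \<open>auto simp: t_def\<close>)
        then show ?thesis using M0 by (intro add_left_mono mult_right_mono) auto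
      qed
      finally have "cmod (\<Sum>j<N. u j x) \<le> real N * (s + \<eta> * M) + M"
        using norm_sum[of "\<lambda>j. u j x" "{..<N}"] by linarith
      then have "cmod (F x) \<le> (real N * (s + \<eta> * M) + M) / real N"
        using N0 by (simp add: F_def norm_mult norm_divide divide_right_mono)
      also have "\<dots> = s + \<eta> * M + M / real N" using N0 by (simp add: field_simps)
      also have "M / real N \<le> M / (8 * K)" using N K M0 by (intro divide_left_mono) auto
      also have "s + \<eta> * M + M / (8 * K) = s + M / (4 * K)" using K by (simp add: \<eta>_def field_simps)
      finally show ?thesis by (simp add: x_def)
    qed
    then have "cmod (F y) \<le> K * (s + M / (4 * K))" by (rule samp[OF F])
    moreover have "F y = f y" using N0 by (simp add: F_def u_def \<kappa>(3))
    moreover have "K * (s + M / (4 * K)) = K * s + M / 4" using K by (simp add: field_simps)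
    ultimately show ?thesis by simp
  qed
  have "cmod (f y) \<le> 4 * K * s"
    if f: "f \<in> Cspec ((*\<^sub>R) (1 + \<epsilon>) ` \<Lambda>)" and s: "\<And>n. cmod (f (E n)) \<le> s" for f s y
  proof -
    have s0: "0 \<le> s" using order_trans[OF norm_ge_zero s] .
    obtain M0 where M0: "\<And>x. cmod (f x) \<le> M0" using CspecD(4)[OF f] by blast
    define M where "M = (SUP x. cmod (f x))"
    have bdd: "bdd_above (range (\<lambda>x. cmod (f x)))" using M0 by (intro bdd_aboveI2)
    have M: "cmod (f x) \<le> M" for x unfolding M_def by (rule cSUP_upper[OF _ bdd]) simp
    \<comment> \<open>The supremum is finite, so M / 4 may be subtracted; the resulting 4/3 K s is
      rounded up to 4 K s.\<close>
    have "M \<le> K * s + M / 4"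
      using main[OF f s M] unfolding M_def by (intro cSUP_least) (auto simp: M_def)
    moreover have "0 \<le> K * s" using K s0 by simp
    ultimately have "M \<le> 4 * (K * s)" by linarith
    then show ?thesis using M[of y] by simp
  qed
  with \<epsilon>(1) show ?thesis by (rule that)
qed

text \<open>In the lower bound the largest sample is replaced by the root of the sum of squares.
  Each term keeps its cutoff centred at y, and the integral of the squared cutoff over y is finite
  and the same for all sample points.\<close>

theorem paley_wiener_sampling:
  fixes E :: "nat \<Rightarrow> 'a::euclidean_space"
  assumes S: "S_set \<Lambda>" and bal: "balayage_possible (range E) \<Lambda>" and sep: "separated E"
    and cpt: "compact \<Lambda>" and conv: "convex \<Lambda>" and sym: "\<And>x. x \<in> \<Lambda> \<Longrightarrow> - x \<in> \<Lambda>"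
    and int: "interior \<Lambda> \<noteq> {}"
  obtains A B where "A > 0" "B > 0"
    "\<And>F. F \<in> Cspec \<Lambda> \<Longrightarrow> ennreal A * (\<integral>\<^sup>+x. ennreal ((cmod (F x))^2) \<partial>lborel) \<le> (\<Sum>n. ennreal ((cmod (F (E n)))^2))"
    "\<And>F. F \<in> Cspec \<Lambda> \<Longrightarrow> (\<Sum>n. ennreal ((cmod (F (E n)))^2)) \<le> ennreal B * (\<integral>\<^sup>+x. ennreal ((cmod (F x))^2) \<partial>lborel)"
proof -
  obtain d where d: "d > 0" "\<And>m n. m \<noteq> n \<Longrightarrow> d \<le> dist (E m) (E n)" using sep unfolding separated_def by blast
  have inj: "inj E" by (rule injI) (use d in force)
  obtain R0 where R0: "\<And>x. x \<in> \<Lambda> \<Longrightarrow> norm x \<le> R0" using compact_imp_bounded[OF cpt] unfolding bounded_iff by blast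
  define R where "R = max R0 1"
  have R: "R > 0" "\<And>\<gamma> b. \<gamma> \<in> \<Lambda> \<Longrightarrow> b \<in> Basis \<Longrightarrow> \<bar>\<gamma> \<bullet> b\<bar> \<le> R"
  proof -
    show "\<bar>\<gamma> \<bullet> b\<bar> \<le> R" if "\<gamma> \<in> \<Lambda>" "b \<in> Basis" for \<gamma> b
      using Basis_le_norm[OF that(2), of \<gamma>] R0[OF that(1)] by (simp add: R_def)
  qed (simp add: R_def)
  obtain z where "z \<in> interior \<Lambda>" using int by blast
  then obtain \<sigma> where z: "\<sigma> > 0" "ball z \<sigma> \<subseteq> \<Lambda>" unfolding mem_interior by blast
  \<comment> \<open>x is the midpoint of z + x and -(z - x): symmetry and convexity move the ball
    from z to the origin.\<close>
  have b0: "x \<in> \<Lambda>" if "norm x < \<sigma>" for x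
  proof -
    have "z + x \<in> \<Lambda>" "z - x \<in> \<Lambda>" using z(2) that by (auto simp: dist_norm)
    then have "(1/2) *\<^sub>R (z + x) + (1/2) *\<^sub>R (- (z - x)) \<in> \<Lambda>" by (intro convexD[OF conv] sym) auto
    moreover have "(1/2) *\<^sub>R (z + x) + (1/2) *\<^sub>R (- (z - x)) = x"
      by (simp add: scaleR_right_distrib scaleR_right_diff_distrib flip: scaleR_2)
    ultimately show ?thesis by simp
  qed
  \<comment> \<open>By the l1 bound a cube of half-width \<rho> lies in the ball of radius \<sigma>;
    the factor 2 makes the inequality strict.\<close>
  define \<rho> where "\<rho> = \<sigma> / (2 * real DIM('a))"
  have \<rho>: "\<rho> > 0" "\<And>x. (\<And>b. b \<in> Basis \<Longrightarrow> \<bar>x \<bullet> b\<bar> \<le> \<rho>) \<Longrightarrow> x \<in> \<Lambda>"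
  proof -
    show "\<rho> > 0" using z(1) by (simp add: \<rho>_def)
    fix x :: 'a assume x: "\<And>b. b \<in> Basis \<Longrightarrow> \<bar>x \<bullet> b\<bar> \<le> \<rho>"
    have "norm x \<le> (\<Sum>b\<in>(Basis::'a set). \<rho>)" using x by (intro order_trans[OF norm_le_l1] sum_mono)
    also have "\<dots> = \<sigma> / 2" by (simp add: \<rho>_def)
    finally show "x \<in> \<Lambda>" using z(1) by (intro b0) simp
  qed
  obtain K where K: "K > 0" "\<And>F s y. \<lbrakk>F \<in> Cspec \<Lambda>; \<And>n. cmod (F (E n)) \<le> s\<rbrakk> \<Longrightarrow> cmod (F y) \<le> K * s"
    using sampling_inequality[OF S bal inj] by metis
  have "\<exists>\<epsilon>>0. \<forall>f s y. f \<in> Cspec ((*\<^sub>R) (1 + \<epsilon>) ` \<Lambda>) \<longrightarrow> (\<forall>n. cmod (f (E n)) \<le> s) \<longrightarrow> cmod (f y) \<le> 4 * K * s"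
    (is "?P")
  proof (rule sampling_inequality_dilated[of K \<Lambda> E R \<rho>])
    show "cmod (F y) \<le> K * s" if "F \<in> Cspec \<Lambda>" "\<And>n. cmod (F (E n)) \<le> s" for F s y
      by (rule K(2)[OF that])
    show "x \<in> \<Lambda>" if "\<And>b. b \<in> Basis \<Longrightarrow> \<bar>x \<bullet> b\<bar> \<le> \<rho>" for x
      by (rule \<rho>(2)[OF that])
    show ?P if "0 < \<epsilon>" "\<And>f s y. f \<in> Cspec ((*\<^sub>R) (1 + \<epsilon>) ` \<Lambda>) \<Longrightarrow> (\<And>n. cmod (f (E n)) \<le> s) \<Longrightarrow> cmod (f y) \<le> 4 * K * s" for \<epsilon>
      using that by blast
  qed (fact K(1) R(1) R(2) conv sym \<rho>(1))+
  then obtain \<epsilon> where \<epsilon>: "0 < \<epsilon>"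
    "\<And>f s y. \<lbrakk>f \<in> Cspec ((*\<^sub>R) (1 + \<epsilon>) ` \<Lambda>); \<And>n. cmod (f (E n)) \<le> s\<rbrakk> \<Longrightarrow> cmod (f y) \<le> 4 * K * s"
    by blast
  obtain B where B: "B > 0" "\<And>F. F \<in> Cspec \<Lambda> \<Longrightarrow>
     (\<Sum>n. ennreal ((cmod (F (E n)))^2)) \<le> ennreal B * (\<integral>\<^sup>+x. ennreal ((cmod (F x))^2) \<partial>lborel)"
    using plancherel_polya[OF R sep] by metis
  obtain \<kappa> :: "'a \<Rightarrow> complex" and C where \<kappa>: "test_function \<kappa>"
    "\<And>q b. \<kappa> q \<noteq> 0 \<Longrightarrow> b \<in> Basis \<Longrightarrow> \<bar>q \<bullet> b\<bar> \<le> \<rho>"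
    "fourier \<kappa> 0 = 1" "\<And>x. cmod (fourier \<kappa> x) \<le> 1" "\<And>x. cmod (fourier \<kappa> x) \<le> C * weight x" "C > 0"
    using cutoff_function[OF \<rho>(1)] by metis
  have [measurable]: "fourier \<kappa> \<in> borel_measurable borel" by (rule fourier_measurable[OF test_function_integrable[OF \<kappa>(1)]])
  define H where "H = (\<integral>x. C * weight (0 + \<epsilon> *\<^sub>R (x::'a)) \<partial>lborel)"
  have Hi: "integrable lborel (\<lambda>x::'a. C * weight (0 + \<epsilon> *\<^sub>R x))"
    using \<epsilon>(1) by (intro integrable_mult_right integrable_lborel_affine[OF integrable_weight]) simp
  have H0: "0 \<le> H" unfolding H_def using \<kappa>(6) by (intro Bochner_Integration.integral_nonneg) (simp add: weight_nonneg)
  have Hle: "(\<integral>\<^sup>+y. ennreal ((cmod (fourier \<kappa> (\<epsilon> *\<^sub>R (z - y))))^2) \<partial>lborel) \<le> ennreal H" for z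
  proof -
    have "(\<integral>\<^sup>+y. ennreal ((cmod (fourier \<kappa> (\<epsilon> *\<^sub>R (z - y))))^2) \<partial>lborel) = (\<integral>\<^sup>+y. ennreal ((cmod (fourier \<kappa> (\<epsilon> *\<^sub>R y)))^2) \<partial>lborel)"
      by (rule nn_integral_lborel_reflect) measurable
    also have "\<dots> \<le> (\<integral>\<^sup>+y. ennreal (C * weight (0 + \<epsilon> *\<^sub>R (y::'a))) \<partial>lborel)"
    proof (intro nn_integral_mono ennreal_leI)
      fix y :: 'a
      have "(cmod (fourier \<kappa> (\<epsilon> *\<^sub>R y)))^2 \<le> cmod (fourier \<kappa> (\<epsilon> *\<^sub>R y)) * 1"
        unfolding power2_eq_square by (intro mult_left_mono \<kappa>(4)) simp
      with \<kappa>(5)[of "\<epsilon> *\<^sub>R y"] show "(cmod (fourier \<kappa> (\<epsilon> *\<^sub>R y)))^2 \<le> C * weight (0 + \<epsilon> *\<^sub>R y)" by simp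
    qed
    also have "\<dots> = ennreal H" unfolding H_def
      by (rule nn_integral_eq_integral[OF Hi]) (use \<kappa>(6) in \<open>simp add: weight_nonneg\<close>)
    finally show ?thesis .
  qed
  \<comment> \<open>The square of the constant 4 K of the dilated sampling inequality.\<close>
  define L where "L = 16 * K^2"
  have L: "L > 0" using K by (simp add: L_def)
  \<comment> \<open>H + 1 in place of H keeps the quotient positive, as only H \<ge> 0 is
    recorded.\<close>
  define A where "A = 1 / (L * (H + 1))"
  have A: "A > 0" using L H0 by (simp add: A_def)
  have "ennreal A * (\<integral>\<^sup>+x. ennreal ((cmod (F x))^2) \<partial>lborel) \<le> (\<Sum>n. ennreal ((cmod (F (E n)))^2))" if F: "F \<in> Cspec \<Lambda>" for F
  proof -
    have [measurable]: "F \<in> borel_measurable borel" by (rule CspecD(2)[OF F])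
    define h where "h n y = (cmod (fourier \<kappa> (\<epsilon> *\<^sub>R (E n - y))))^2" for n y
    have hm [measurable]: "h n \<in> borel_measurable borel" for n unfolding h_def by measurable
    define S where "S = (\<Sum>n. ennreal ((cmod (F (E n)))^2))"
    have pt: "ennreal ((cmod (F y))^2) \<le> ennreal L * (\<Sum>n. ennreal ((cmod (F (E n)))^2) * ennreal (h n y))" for y
    \<comment> \<open>The sum is taken in the extended reals; where it is infinite the bound is
      trivial.\<close>
    proof (cases "(\<Sum>n. ennreal ((cmod (F (E n)))^2) * ennreal (h n y))")
      case top
      then show ?thesis using L by (simp add: ennreal_mult_top)
    next
      case (real s2)
      define f where "f x = F x * fourier \<kappa> (\<epsilon> *\<^sub>R (x - y))" for x
      have "(\<lambda>x. F (x + y) * fourier \<kappa> (\<epsilon> *\<^sub>R x)) \<in> Cspec ((*\<^sub>R) (1 + \<epsilon>) ` \<Lambda>)"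
      proof (rule Cspec_mult_fourier[OF Cspec_translate[OF F] \<kappa>(1)])
        fix \<gamma> q assume \<gamma>: "\<gamma> \<in> \<Lambda>" and q: "\<kappa> q \<noteq> 0"
        have mq: "- q \<in> \<Lambda>" by (intro sym \<rho>(2) \<kappa>(2) q)
        \<comment> \<open>The sum of \<Lambda> and \<epsilon> \<Lambda> lies in (1 + \<epsilon>)
          \<Lambda>: division by 1 + \<epsilon> gives a convex combination.\<close>
        have "(1 / (1 + \<epsilon>)) *\<^sub>R \<gamma> + (\<epsilon> / (1 + \<epsilon>)) *\<^sub>R (- q) \<in> \<Lambda>"
          using \<epsilon>(1) by (intro convexD[OF conv \<gamma> mq]) (auto simp: add_divide_distrib[symmetric])
        moreover have "\<gamma> - \<epsilon> *\<^sub>R q = (1 + \<epsilon>) *\<^sub>R ((1 / (1 + \<epsilon>)) *\<^sub>R \<gamma> + (\<epsilon> / (1 + \<epsilon>)) *\<^sub>R (- q))"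
          using \<epsilon>(1) by (simp add: scaleR_right_diff_distrib)
        ultimately show "\<gamma> - \<epsilon> *\<^sub>R q \<in> (*\<^sub>R) (1 + \<epsilon>) ` \<Lambda>" by blast
      qed
      from Cspec_translate[OF this, of "- y"] have f: "f \<in> Cspec ((*\<^sub>R) (1 + \<epsilon>) ` \<Lambda>)" by (simp add: f_def[abs_def])
      have "cmod (f (E n)) \<le> sqrt s2" for n
      proof (rule real_le_rsqrt)
        have "ennreal ((cmod (f (E n)))^2) = ennreal ((cmod (F (E n)))^2) * ennreal (h n y)"
          by (simp add: f_def h_def norm_mult power_mult_distrib ennreal_mult)
        also have "\<dots> \<le> (\<Sum>n. ennreal ((cmod (F (E n)))^2) * ennreal (h n y))"
          using sum_le_suminf[OF summableI, of "{n}" "\<lambda>n. ennreal ((cmod (F (E n)))^2) * ennreal (h n y)"] by simp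
        finally show "(cmod (f (E n)))^2 \<le> s2" using real by simp
      qed
      from \<epsilon>(2)[OF f this, of y] have "cmod (F y) \<le> 4 * K * sqrt s2" by (simp add: f_def \<kappa>(3))
      then have "(cmod (F y))^2 \<le> (4 * K * sqrt s2)^2" by (intro power_mono) auto
      also have "\<dots> = L * s2" using real by (simp add: L_def power_mult_distrib)
      finally show ?thesis using real L by (simp add: ennreal_mult[symmetric] ennreal_leI)
    qed
    have "(\<integral>\<^sup>+y. ennreal ((cmod (F y))^2) \<partial>lborel) \<le> (\<integral>\<^sup>+y. ennreal L * (\<Sum>n. ennreal ((cmod (F (E n)))^2) * ennreal (h n y)) \<partial>lborel)"
      by (intro nn_integral_mono pt)
    also have "\<dots> = ennreal L * (\<integral>\<^sup>+y. (\<Sum>n. ennreal ((cmod (F (E n)))^2) * ennreal (h n y)) \<partial>lborel)"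
      by (rule nn_integral_cmult) measurable
    also have "(\<integral>\<^sup>+y. (\<Sum>n. ennreal ((cmod (F (E n)))^2) * ennreal (h n y)) \<partial>lborel) =
        (\<Sum>n. \<integral>\<^sup>+y. ennreal ((cmod (F (E n)))^2) * ennreal (h n y) \<partial>lborel)"
      by (rule nn_integral_suminf) measurable
    also have "\<dots> = (\<Sum>n. ennreal ((cmod (F (E n)))^2) * (\<integral>\<^sup>+y. ennreal (h n y) \<partial>lborel))"
      by (intro suminf_cong nn_integral_cmult) measurable
    finally have 1: "(\<integral>\<^sup>+y. ennreal ((cmod (F y))^2) \<partial>lborel) \<le>
        ennreal L * (\<Sum>n. ennreal ((cmod (F (E n)))^2) * (\<integral>\<^sup>+y. ennreal (h n y) \<partial>lborel))" .
    have "(\<Sum>n. ennreal ((cmod (F (E n)))^2) * (\<integral>\<^sup>+y. ennreal (h n y) \<partial>lborel)) \<le> (\<Sum>n. ennreal (H + 1) * ennreal ((cmod (F (E n)))^2))"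
    proof (intro suminf_le summableI)
      fix n
      have "(\<integral>\<^sup>+y. ennreal (h n y) \<partial>lborel) \<le> ennreal (H + 1)"
        unfolding h_def by (rule order_trans[OF Hle]) (simp add: ennreal_leI)
      then show "ennreal ((cmod (F (E n)))^2) * (\<integral>\<^sup>+y. ennreal (h n y) \<partial>lborel) \<le> ennreal (H + 1) * ennreal ((cmod (F (E n)))^2)"
        by (subst mult.commute) (rule mult_right_mono, simp_all)
    qed
    also have "\<dots> = ennreal (H + 1) * S" unfolding S_def by (rule ennreal_suminf_cmult)
    finally have "(\<Sum>n. ennreal ((cmod (F (E n)))^2) * (\<integral>\<^sup>+y. ennreal (h n y) \<partial>lborel)) \<le> ennreal (H + 1) * S" .
    from order_trans[OF 1 mult_left_mono[OF this]]
    have "(\<integral>\<^sup>+y. ennreal ((cmod (F y))^2) \<partial>lborel) \<le> ennreal L * (ennreal (H + 1) * S)" by simp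
    then have "ennreal A * (\<integral>\<^sup>+y. ennreal ((cmod (F y))^2) \<partial>lborel) \<le> ennreal A * (ennreal L * (ennreal (H + 1) * S))"
      by (rule mult_left_mono) simp
    also have "\<dots> = (ennreal A * ennreal L * ennreal (H + 1)) * S" by (simp only: mult.assoc)
    also have "ennreal A * ennreal L * ennreal (H + 1) = ennreal (A * L * (H + 1))"
      using A L H0 by (simp only: ennreal_mult[symmetric] less_imp_le mult_nonneg_nonneg add_nonneg_nonneg zero_le_one)
    also have "A * L * (H + 1) = 1" using L H0 by (simp add: A_def)
    finally show ?thesis by (simp add: S_def)
  qed
  then show ?thesis using that A B by blast
qed

section \<open>Gabor frames\<close>

lemma Cspec_translation_invariant:
  fixes v :: "'a::euclidean_space"
  assumes S: "S_set \<Lambda>" and v: "\<And>\<gamma>. \<gamma> \<in> \<Lambda> \<Longrightarrow> v \<bullet> \<gamma> = 0" and F: "F \<in> Cspec \<Lambda>"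
  shows "F (z + v) = F z"
proof -
  define c where "c n = (if n = 0 then 1 else if n = 1 then - 1 else (0::complex))" for n :: nat
  define p where "p n = (if n = 0 then z + v else z)" for n :: nat
  have fin: "(\<lambda>n. c n * G (p n)) sums (G (z + v) - G z)" for G :: "'a \<Rightarrow> complex"
  proof -
    have "(\<lambda>n. c n * G (p n)) sums (\<Sum>n\<in>{0, 1}. c n * G (p n))"
      by (rule sums_finite) (auto simp: c_def)
    then show ?thesis by (simp add: c_def p_def)
  qed
  have "(\<Sum>n. c n * F (p n)) = 0"
  proof (rule S_set_atomic[OF S _ _ F])
    show "summable (\<lambda>n. cmod (c n))"
      by (rule summable_finite[of "{0, 1}"]) (auto simp: c_def)
    show "(\<Sum>n. c n * cis (- 2 * pi * (p n \<bullet> \<gamma>))) = 0" if "\<gamma> \<in> \<Lambda>" for \<gamma>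
      using fin[of "\<lambda>x. cis (- 2 * pi * (x \<bullet> \<gamma>))"] v[OF that] by (simp add: sums_iff inner_add_left)
  qed
  with fin[of F] show ?thesis by (simp add: sums_iff)
qed

text \<open>A square-integrable function that is constant along a line vanishes, because its samples
  along the line violate the Plancherel-Polya inequality otherwise.\<close>

lemma Cspec_hyperplane_L2_zero:
  fixes \<Lambda> :: "'a::euclidean_space set"
  assumes S: "S_set \<Lambda>" and cpt: "compact \<Lambda>" and a: "a \<noteq> 0" "\<And>\<gamma>. \<gamma> \<in> \<Lambda> \<Longrightarrow> a \<bullet> \<gamma> = 0"
    and F: "F \<in> Cspec \<Lambda>" and fin: "(\<integral>\<^sup>+x. ennreal ((cmod (F x))^2) \<partial>lborel) < \<infinity>"
  shows "F z = 0"
proof -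
  obtain R0 where R0: "\<And>x. x \<in> \<Lambda> \<Longrightarrow> norm x \<le> R0" using compact_imp_bounded[OF cpt] unfolding bounded_iff by blast
  have R: "max R0 1 > 0" "\<And>\<gamma> b. \<gamma> \<in> \<Lambda> \<Longrightarrow> b \<in> Basis \<Longrightarrow> \<bar>\<gamma> \<bullet> b\<bar> \<le> max R0 1"
  proof -
    show "\<bar>\<gamma> \<bullet> b\<bar> \<le> max R0 1" if "\<gamma> \<in> \<Lambda>" "b \<in> Basis" for \<gamma> b
      using Basis_le_norm[OF that(2), of \<gamma>] R0[OF that(1)] by simp
  qed simp
  define E where "E n = z + real n *\<^sub>R a" for n
  have "separated E"
    unfolding separated_def
  proof (intro exI[of _ "norm a"] conjI allI impI)
    fix m n :: nat assume "m \<noteq> n"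
    then have "1 \<le> \<bar>real m - real n\<bar>" by linarith
    then have "1 * norm a \<le> \<bar>real m - real n\<bar> * norm a" by (intro mult_right_mono) auto
    also have "\<dots> = dist (E m) (E n)" by (simp add: E_def dist_norm scaleR_left_diff_distrib[symmetric])
    finally show "norm a \<le> dist (E m) (E n)" by simp
  qed (use a in simp)
  then obtain B where "(\<Sum>n. ennreal ((cmod (F (E n)))^2)) \<le> ennreal B * (\<integral>\<^sup>+x. ennreal ((cmod (F x))^2) \<partial>lborel)"
    using plancherel_polya[OF R] F by metis
  also have "\<dots> < \<infinity>" using fin by (simp add: ennreal_mult_less_top)
  finally have "(\<Sum>n. ennreal ((cmod (F (E n)))^2)) \<noteq> \<top>" by simp
  moreover have "F (E n) = F z" for n
    unfolding E_def by (rule Cspec_translation_invariant[OF S _ F]) (simp add: a)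
  ultimately have "summable (\<lambda>n::nat. (cmod (F z))^2)" by (intro summable_suminf_not_top) auto
  then have "(\<lambda>n::nat. (cmod (F z))^2) \<longlonglongrightarrow> 0" by (rule summable_LIMSEQ_zero)
  then show ?thesis by (simp add: LIMSEQ_const_iff)
qed

section \<open>Time-frequency shifts and the space \<open>S0\<close>\<close>

text \<open>\<open>tf_shift\<close> modulates first and translates afterwards, the short-time
  transform does it the other way round. The two differ by a unimodular constant, which disappears
  in moduli.\<close>

lemma tf_shift_eq: "tf_shift s w g = (\<lambda>t. cis (- 2 * pi * (s \<bullet> w)) * (cis (2 * pi * (t \<bullet> w)) * g (t + - s)))"
proof
  fix t
  have "2 * pi * ((t - s) \<bullet> w) = - 2 * pi * (s \<bullet> w) + 2 * pi * (t \<bullet> w)"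
    by (simp add: inner_diff_left algebra_simps)
  then have "cis (2 * pi * ((t - s) \<bullet> w)) = cis (- 2 * pi * (s \<bullet> w)) * cis (2 * pi * (t \<bullet> w))"
    by (simp only: cis_mult)
  then show "tf_shift s w g t = cis (- 2 * pi * (s \<bullet> w)) * (cis (2 * pi * (t \<bullet> w)) * g (t + - s))"
    by (simp add: tf_shift_def)
qed

lemma L2_tf_shift: "L2 g \<Longrightarrow> L2 (tf_shift s w g)"
  unfolding tf_shift_eq by (intro L2_scale L2_modulate_cnj)

lemma L2inner_tf_shift: "L2inner f (tf_shift s w g) = cis (2 * pi * (s \<bullet> w)) * stft g f (s, w)"
  unfolding tf_shift_eq L2inner_scale_right stft_inner by (simp add: cis_cnj)

lemma norm_L2inner_tf_shift: "cmod (L2inner f (tf_shift (fst z) (snd z) g)) = cmod (stft g f z)"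
  by (cases z) (simp add: L2inner_tf_shift norm_mult)

lemma stft_add: "L2 f \<Longrightarrow> L2 h \<Longrightarrow> L2 g \<Longrightarrow> stft g (\<lambda>t. f t + h t) z = stft g f z + stft g h z"
  by (cases z) (simp only: stft_inner L2inner_add_left L2_modulate_cnj)

lemma stft_scale: "stft g (\<lambda>t. c * f t) z = c * stft g f z"
  by (cases z) (simp only: stft_inner L2inner_scale_left)

lemma L2_gauss0: "L2 (gauss0 :: real^'n \<Rightarrow> complex)"
proof (rule L2_bound)
  define c where "c = 2 powr (real CARD('n) / 4)"
  have eq: "gauss0 x = complex_of_real (c * gauss x)" for x :: "real^'n"
    by (simp add: gauss0_def gauss_def c_def)
  show "(gauss0 :: real^'n \<Rightarrow> complex) \<in> borel_measurable lebesgue"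
  proof -
    have "(\<lambda>x::real^'n. complex_of_real (c * gauss x)) \<in> borel_measurable lborel" by measurable
    moreover have "gauss0 = (\<lambda>x::real^'n. complex_of_real (c * gauss x))" by (rule ext) (rule eq)
    ultimately have "(gauss0 :: real^'n \<Rightarrow> complex) \<in> borel_measurable lborel" by (simp only:)
    then show ?thesis by (rule measurable_completion)
  qed
  have "gauss \<in> borel_measurable (lborel :: (real^'n) measure)" by measurable
  then have "integrable lebesgue (gauss :: real^'n \<Rightarrow> real)"
    using gauss_integrable[where 'a="real^'n"] by (simp add: integrable_completion)
  then show "integrable lebesgue (\<lambda>x::real^'n. c^2 * gauss x)" by simp
  fix x :: "real^'n"
  have "(gauss x)^2 \<le> gauss x * 1"
    unfolding power2_eq_square by (intro mult_left_mono gauss_le_1 gauss_nonneg)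
  then have "c^2 * (gauss x)^2 \<le> c^2 * gauss x" by (intro mult_left_mono) auto
  then show "(cmod (gauss0 x))\<^sup>2 \<le> c^2 * gauss x"
    unfolding eq norm_of_real by (simp add: power_mult_distrib)
qed

lemma S0_L2: "f \<in> S0 \<Longrightarrow> L2 f"
  by (simp add: S0_def)

lemma S0_zero: "(\<lambda>t::real^'n. 0) \<in> S0"
proof -
  have "stft gauss0 (\<lambda>t::real^'n. 0) z = 0" for z using stft_scale[of gauss0 0 "\<lambda>t. 0" z] by simp
  then have "stft gauss0 (\<lambda>t::real^'n. 0) = (\<lambda>z. 0)" by auto
  then show ?thesis by (simp add: S0_def)
qed

lemma S0_add:
  assumes "f \<in> S0" "h \<in> S0"
  shows "(\<lambda>t. f t + h t) \<in> S0"
proof -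
  have "stft gauss0 (\<lambda>t. f t + h t) = (\<lambda>z. stft gauss0 f z + stft gauss0 h z)"
    using assms by (intro ext stft_add L2_gauss0 S0_L2)
  then show ?thesis using assms by (simp add: S0_def L2_add)
qed

lemma S0_scale:
  assumes "f \<in> S0"
  shows "(\<lambda>t. c * f t) \<in> S0"
proof -
  have "stft gauss0 (\<lambda>t. c * f t) = (\<lambda>z. c * stft gauss0 f z)" by (intro ext stft_scale)
  then show ?thesis using assms by (simp add: S0_def L2_scale)
qed

lemma stft_in_Cspec:
  assumes "L2 f" "L2 g"
  shows "stft g f \<in> Cspec \<Lambda> \<longleftrightarrow> fourier_supp_in (stft g f) \<Lambda>"
  unfolding Cspec_def using stft_continuous[OF assms] stft_bound[OF assms] by (auto simp: bounded_iff)

lemma gabor_frame_bounds: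
  fixes E :: "nat \<Rightarrow> (real^'n) \<times> (real^'n)" and \<Lambda> :: "((real^'n) \<times> (real^'n)) set"
  assumes sep: "separated E" and Sset: "S_set \<Lambda>" and cpt: "compact \<Lambda>" and cvx: "convex \<Lambda>"
    and sym: "\<forall>z\<in>\<Lambda>. - z \<in> \<Lambda>" and bal: "balayage_possible (range E) \<Lambda>"
    and gL2: "L2 g" and gnorm: "L2norm g = 1"
  obtains A B where "A > 0" "B > 0"
    "\<And>f. \<lbrakk>L2 f; fourier_supp_in (stft g f) \<Lambda>\<rbrakk> \<Longrightarrow> summable (\<lambda>n. (cmod (stft g f (E n)))^2) \<and>
       A * (L2norm f)^2 \<le> (\<Sum>n. (cmod (stft g f (E n)))^2) \<and> (\<Sum>n. (cmod (stft g f (E n)))^2) \<le> B * (L2norm f)^2"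
proof (cases "interior \<Lambda> = {}")
  case False
  obtain A B where AB: "A > 0" "B > 0"
    "\<And>F. F \<in> Cspec \<Lambda> \<Longrightarrow> ennreal A * (\<integral>\<^sup>+x. ennreal ((cmod (F x))^2) \<partial>lborel) \<le> (\<Sum>n. ennreal ((cmod (F (E n)))^2))"
    "\<And>F. F \<in> Cspec \<Lambda> \<Longrightarrow> (\<Sum>n. ennreal ((cmod (F (E n)))^2)) \<le> ennreal B * (\<integral>\<^sup>+x. ennreal ((cmod (F x))^2) \<partial>lborel)"
    using paley_wiener_sampling[OF Sset bal sep cpt cvx _ False] sym by metis
  have "summable (\<lambda>n. (cmod (stft g f (E n)))^2) \<and>
       A * (L2norm f)^2 \<le> (\<Sum>n. (cmod (stft g f (E n)))^2) \<and> (\<Sum>n. (cmod (stft g f (E n)))^2) \<le> B * (L2norm f)^2"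
    if f: "L2 f" "fourier_supp_in (stft g f) \<Lambda>" for f
  proof -
    have F: "stft g f \<in> Cspec \<Lambda>" using f by (simp add: stft_in_Cspec gL2)
    have I: "(\<integral>\<^sup>+x. ennreal ((cmod (stft g f x))^2) \<partial>lborel) = ennreal ((L2norm f)^2)"
      using stft_isometry[OF f(1) gL2] by (simp add: gnorm)
    have up: "(\<Sum>n. ennreal ((cmod (stft g f (E n)))^2)) \<le> ennreal (B * (L2norm f)^2)"
      using AB(4)[OF F] AB(2) by (simp add: I ennreal_mult)
    then have s: "summable (\<lambda>n. (cmod (stft g f (E n)))^2)"
      by (intro summable_suminf_not_top) (auto simp: top_unique)
    have eq: "(\<Sum>n. ennreal ((cmod (stft g f (E n)))^2)) = ennreal (\<Sum>n. (cmod (stft g f (E n)))^2)"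
      by (rule suminf_ennreal2[OF _ s]) simp
    have s0: "0 \<le> (\<Sum>n. (cmod (stft g f (E n)))^2)" by (intro suminf_nonneg s) simp
    have "ennreal (A * (L2norm f)^2) \<le> ennreal (\<Sum>n. (cmod (stft g f (E n)))^2)"
      using AB(3)[OF F] AB(1) by (simp add: I ennreal_mult eq)
    then show ?thesis using up s s0 AB(2) by (simp add: eq)
  qed
  with AB(1,2) show ?thesis by (rule that)
next
  case True
  then obtain a b where ab: "a \<noteq> 0" "\<Lambda> \<subseteq> {x. a \<bullet> x = b}"
    using empty_interior_subset_hyperplane[OF cvx] by metis
  \<comment> \<open>Symmetry forces the hyperplane through the origin: a.x and -a.x both equal
    b.\<close>
  have a0: "a \<bullet> x = 0" if "x \<in> \<Lambda>" for x
  proof -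
    have "a \<bullet> x = b" "a \<bullet> (- x) = b" using ab(2) that sym by blast+
    then show ?thesis by simp
  qed
  have "summable (\<lambda>n. (cmod (stft g f (E n)))^2) \<and>
       1 * (L2norm f)^2 \<le> (\<Sum>n. (cmod (stft g f (E n)))^2) \<and> (\<Sum>n. (cmod (stft g f (E n)))^2) \<le> 1 * (L2norm f)^2"
    if f: "L2 f" "fourier_supp_in (stft g f) \<Lambda>" for f
  proof -
    have F: "stft g f \<in> Cspec \<Lambda>" using f by (simp add: stft_in_Cspec gL2)
    have I: "(\<integral>\<^sup>+x. ennreal ((cmod (stft g f x))^2) \<partial>lborel) = ennreal ((L2norm f)^2)"
      using stft_isometry[OF f(1) gL2] by (simp add: gnorm)
    have z: "stft g f x = 0" for x
      by (rule Cspec_hyperplane_L2_zero[OF Sset cpt ab(1) a0 F]) (simp_all add: I)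
    then have "ennreal ((L2norm f)^2) = 0" using I by simp
    then have "L2norm f = 0" by simp
    with z show ?thesis by simp
  qed
  then show ?thesis by (intro that[of 1 1]) simp_all
qed

text \<open>Invertibility is expressed by weak equations on \<open>H\<close>: every right-hand side
  has a solution, unique up to a null function. Accordingly \<open>\<gamma> n\<close> ranges over
  all representatives of the inverse applied to the n-th shift, and the expansion is claimed for
  each such choice.\<close>

theorem theorem3p4:
  fixes E :: "nat \<Rightarrow> (real^'n) \<times> (real^'n)"
    and \<Lambda> :: "((real^'n) \<times> (real^'n)) set"
    and g :: "real^'n \<Rightarrow> complex"
  assumes sep: "separated E"
    and Sset: "S_set \<Lambda>"
    and strict: "strict_multiplicity \<Lambda>"
    and cpt: "compact \<Lambda>"
    and cvx: "convex \<Lambda>"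
    and sym: "\<forall>z\<in>\<Lambda>. - z \<in> \<Lambda>"
    and bal: "balayage_possible (range E) \<Lambda>"
    and gL2: "L2 g"
    and gnorm: "L2norm g = 1"
  shows "(\<exists>A B. A > 0 \<and> B > 0 \<and>
           (\<forall>f\<in>S0. fourier_supp_in (stft g f) \<Lambda> \<longrightarrow>
              summable (\<lambda>n. (cmod (stft g f (E n)))^2) \<and>
              A * (L2norm f)^2 \<le> (\<Sum>n. (cmod (stft g f (E n)))^2) \<and>
              (\<Sum>n. (cmod (stft g f (E n)))^2) \<le> B * (L2norm f)^2))
       \<and> (let H = L2_closure {f\<in>S0. fourier_supp_in (stft g f) \<Lambda>} in
            (\<forall>u. L2 u \<longrightarrow>
               (\<exists>f\<in>H. \<forall>h\<in>H. frame_op_weak g E f u h) \<and>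
               (\<forall>f1\<in>H. \<forall>f2\<in>H. (\<forall>h\<in>H. frame_op_weak g E f1 u h) \<and>
                  (\<forall>h\<in>H. frame_op_weak g E f2 u h) \<longrightarrow> L2norm (\<lambda>t. f1 t - f2 t) = 0))
          \<and> (\<forall>\<gamma>. (\<forall>n. \<gamma> n \<in> H \<and>
                   (\<forall>h\<in>H. frame_op_weak g E (\<gamma> n) (tf_shift (fst (E n)) (snd (E n)) g) h)) \<longrightarrow>
               (\<forall>f\<in>S0. fourier_supp_in (stft g f) \<Lambda> \<longrightarrow>
                  L2_uncond_sum
                    (\<lambda>n t. L2inner f (tf_shift (fst (E n)) (snd (E n)) g) * \<gamma> n t) f)))"
proof -
  obtain A B where AB: "A > 0" "B > 0"
    "\<And>f. \<lbrakk>L2 f; fourier_supp_in (stft g f) \<Lambda>\<rbrakk> \<Longrightarrow> summable (\<lambda>n. (cmod (stft g f (E n)))^2) \<and>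
       A * (L2norm f)^2 \<le> (\<Sum>n. (cmod (stft g f (E n)))^2) \<and> (\<Sum>n. (cmod (stft g f (E n)))^2) \<le> B * (L2norm f)^2"
    using gabor_frame_bounds[OF sep Sset cpt cvx sym bal gL2 gnorm] by metis
  define V where "V = {f\<in>S0. fourier_supp_in (stft g f) \<Lambda>}"
  define e where "e n = tf_shift (fst (E n)) (snd (E n)) g" for n
  have ne: "cmod (L2inner f (e n)) = cmod (stft g f (E n))" for f n
    unfolding e_def by (rule norm_L2inner_tf_shift)
  \<comment> \<open>Phrasing the spectral condition through \<open>Cspec\<close> brings in its
    closure under sums and multiples, which makes \<open>V\<close> a subspace.\<close>
  have VC: "f \<in> V \<longleftrightarrow> f \<in> S0 \<and> stft g f \<in> Cspec \<Lambda>" for f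
    using stft_in_Cspec[OF S0_L2 gL2] by (auto simp: V_def)
  interpret L2_frame V e A B
  proof
    show "L2 f" if "f \<in> V" for f using that by (simp add: V_def S0_L2)
    show "(\<lambda>x. 0) \<in> V"
    proof -
      have "stft g (\<lambda>t. 0) = (\<lambda>z. 0)" using stft_scale[of g 0 "\<lambda>t. 0"] by auto
      then show ?thesis by (simp add: VC S0_zero Cspec_zero)
    qed
    show "(\<lambda>x. f x + h x) \<in> V" if "f \<in> V" "h \<in> V" for f h
    proof -
      have "stft g (\<lambda>t. f t + h t) = (\<lambda>z. stft g f z + stft g h z)"
        using that by (intro ext stft_add gL2) (simp_all add: V_def S0_L2)
      then show ?thesis using that by (simp add: VC S0_add Cspec_add)
    qed
    show "(\<lambda>x. c * f x) \<in> V" if "f \<in> V" for f c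
    proof -
      have "stft g (\<lambda>t. c * f t) = (\<lambda>z. c * stft g f z)" by (intro ext stft_scale)
      then show ?thesis using that by (simp add: VC S0_scale Cspec_cmult)
    qed
    show "L2 (e n)" for n unfolding e_def by (rule L2_tf_shift[OF gL2])
    show "summable (\<lambda>n. (cmod (L2inner f (e n)))\<^sup>2)" "A * (L2norm f)\<^sup>2 \<le> (\<Sum>n. (cmod (L2inner f (e n)))\<^sup>2)"
      "(\<Sum>n. (cmod (L2inner f (e n)))\<^sup>2) \<le> B * (L2norm f)\<^sup>2" if "f \<in> V" for f
      using AB(3)[of f] that unfolding ne by (auto simp: V_def S0_L2)
  qed (use AB in auto)
  \<comment> \<open>On \<open>H\<close> the series converges to \<open>a f h\<close>, and sums are
    unique, so the relation \<open>frame_op_weak\<close> becomes an equation for the form.\<close>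
  have weak: "frame_op_weak g E f u h \<longleftrightarrow> a f h = L2inner u h" if "f \<in> H" "h \<in> H" for f u h
    using a_sums[OF that] unfolding frame_op_weak_def e_def[symmetric] by (auto dest: sums_unique2)
  have 1: "\<exists>f\<in>H. \<forall>h\<in>H. frame_op_weak g E f u h" if u: "L2 u" for u
    using frame_operator_exists[OF u] weak by metis
  have 2: "L2norm (\<lambda>t. f1 t - f2 t) = 0"
    if "f1 \<in> H" "f2 \<in> H" "\<forall>h\<in>H. frame_op_weak g E f1 u h" "\<forall>h\<in>H. frame_op_weak g E f2 u h" for u f1 f2
    by (rule frame_operator_unique) (use that weak in auto)
  have 3: "L2_uncond_sum (\<lambda>n t. L2inner f (e n) * \<gamma> n t) f"
    if \<gamma>: "\<forall>n. \<gamma> n \<in> H \<and> (\<forall>h\<in>H. frame_op_weak g E (\<gamma> n) (e n) h)" and f: "f \<in> V" for \<gamma> f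
  proof (rule dual_frame_expansion[OF V_H[OF f]])
    show \<gamma>H: "\<gamma> n \<in> H" for n using \<gamma> by blast
    show "a (\<gamma> n) h = L2inner (e n) h" if "h \<in> H" for n h
      using weak[OF \<gamma>H that] \<gamma> that by blast
  qed
  have 0: "\<exists>A B. A > 0 \<and> B > 0 \<and>
           (\<forall>f\<in>S0. fourier_supp_in (stft g f) \<Lambda> \<longrightarrow>
              summable (\<lambda>n. (cmod (stft g f (E n)))^2) \<and>
              A * (L2norm f)^2 \<le> (\<Sum>n. (cmod (stft g f (E n)))^2) \<and>
              (\<Sum>n. (cmod (stft g f (E n)))^2) \<le> B * (L2norm f)^2)"
    using AB S0_L2 by blast
  show ?thesis
    unfolding Let_def V_def[symmetric] e_def[symmetric]
  proof (intro conjI allI impI ballI 0)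
    fix u :: "real^'n \<Rightarrow> complex" assume "L2 u"
    then show "\<exists>f\<in>H. \<forall>h\<in>H. frame_op_weak g E f u h" by (rule 1)
  next
    fix u f1 f2 assume "f1 \<in> H" "f2 \<in> H"
      "(\<forall>h\<in>H. frame_op_weak g E f1 u h) \<and> (\<forall>h\<in>H. frame_op_weak g E f2 u h)"
    then show "L2norm (\<lambda>t. f1 t - f2 t) = 0" using 2 by blast
  next
    fix \<gamma> f assume "\<forall>n. \<gamma> n \<in> H \<and> (\<forall>h\<in>H. frame_op_weak g E (\<gamma> n) (e n) h)" "f \<in> S0" "fourier_supp_in (stft g f) \<Lambda>"
    then show "L2_uncond_sum (\<lambda>n t. L2inner f (e n) * \<gamma> n t) f" by (intro 3) (simp_all add: V_def)
  qed
qed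

end
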